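(* Let $(V_{n_p})_{p\ge1}$ be nested spaces for which there is a constant $\kappa>1$ such that $$k_{n_1}(x)\le 3\,\kappa\,n_1\quad\text{and}\quad k_{n_p}(x)\le k_{n_{p+1}}(x)\le\kappa\,k_{n_p}(x),\qquad p\ge1,\ x\in D.$$ Let $q>1$ and $n=n_q$. Let $\varepsilon_1,\dots,\varepsilon_q>0$ be such that $\varepsilon:=\sum_{p=1}^q\varepsilon_p<1$, and assume that the amounts $M_p$ of offline samples in the multilevel algorithm satisfy $$M_p\ge 3\,\kappa\,\gamma\,n_p\,\ln\frac{2n_p}{\varepsilon_p},\qquad p=1,\dots,q.$$ If $m\ge 3\,\gamma\,n\,\ln\frac{2n}{\varepsilon}$, then the event $E:=\{\|G-I\|_2\le\frac12\ \text{and}\ \|G_q-I\|_2\le\frac12\}$ satisfies $\Pr(E^c)\le2\varepsilon$, and for every $u\in L^2(D,\mu)$ $$\mathbb E\left(\|u-\widetilde u_n\|^2\,\chi_E\right)\le(1+\eta(m))\,e_n(u)^2,$$ and, if $\|u\|_{L^\infty(D)}\le\tau$, $$\mathbb E\left(\|u-\widetilde u_n^T\|^2\right)\le(1+\eta(m))\,e_n(u)^2+8\,\varepsilon\,\tau^2,$$ where $\eta(m)=12\,\frac nm\le\frac4{\gamma\ln(2n/\varepsilon)}$.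
   Context: Setting. $D\subset\mathbb R^d$, $\mu$ is a probability measure on $D$, $\|\cdot\|$ is the norm of $L^2(D,\mu)$. $(V_{n_p})_{p\ge1}$ is a nested family of linear subspaces of $L^2(D,\mu)$ made of real-valued functions defined pointwise on $D$, with $\dim V_{n_p}=n_p$ increasing in $p$; $(L_j)_{j\ge1}$ is an $L^2(D,\mu)$-orthonormal family with $V_{n_p}=\mathrm{Span}\{L_1,\dots,L_{n_p}\}$, and $k_{n_p}(x)=\sum_{j=1}^{n_p}|L_j(x)|^2$. Put $e_n(u)=\min_{v\in V_n}\|u-v\|$ and $\gamma=\left(\frac32\ln\frac32-\frac12\right)^{-1}$. $\|\cdot\|_2$ is the spectral norm and $\chi_E$ an indicator function. Multilevel offline algorithm. Start with $\widetilde w_0=1$, $\widetilde\sigma_0=\mu$. For $p=1,\dots,q$: given the previous draws, draw $z_p^1,\dots,z_p^{M_p}$ independently according to $\widetilde\sigma_{p-1}$; construct an orthonormal basis $(L_j^p)_{1\le j\le n_p}$ of $V_{n_p}$ for the inner product $$\langle u,v\rangle_p=\frac1{M_p}\sum_{i=1}^{M_p}\widetilde w_{p-1}(z_p^i)\,u(z_p^i)\,v(z_p^i);$$ define $\widetilde k_{n_p}=\sum_{j=1}^{n_p}|L_j^p|^2$, the probability measure $d\widetilde\sigma_p=\alpha_p\frac{\widetilde k_{n_p}}{n_p}\,d\mu$ with $\alpha_p$ the normalization constant, and the weight $\widetilde w_p=\frac{n_p}{\alpha_p\widetilde k_{n_p}}$ (so that $\widetilde w_p\,d\widetilde\sigma_p=d\mu$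 where $\widetilde k_{n_p}>0$). Let $G_p=(\langle L_j,L_k\rangle_p)_{j,k=1,\dots,n_p}$. At the end put $\widetilde\sigma=\widetilde\sigma_q$ and $\widetilde w=\widetilde w_q$. (On the event that some $\langle\cdot,\cdot\rangle_p$ is not an inner product on $V_{n_p}$, all subsequent choices of sampling measures in the algorithm and of $\widetilde u_n\in V_n$ are arbitrary, and the event $E$ is considered not to occur.) Online stage. Given the offline draws, $x^1,\dots,x^m$ are drawn independently according to $\widetilde\sigma$. Let $\langle u,v\rangle_m=\frac1m\sum_{i=1}^m\widetilde w(x^i)u(x^i)v(x^i)$ and $G=(\langle L_j,L_k\rangle_m)_{j,k=1,\dots,n}$. The estimator $\widetilde u_n\in V_n$ is a solution of $\min_{v\in V_n}\sum_{i=1}^m\widetilde w(x^i)|u(x^i)-v(x^i)|^2$ (unique when $G$ is nonsingular). For $\tau>0$, $\widetilde u_n^T=T_\tau\circ\widetilde u_n$ with $T_\tau(y)=\min\{\tau,|y|\}\,\mathrm{sgn}(y)$. $\Pr$ and $\mathbb E$ refer to all draws. *)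

theory Defs
  imports "HOL-Probability.Probability"
begin

text \<open>Functions on \<open>D = space \<mu>\<close> are represented by total functions; only their values on
  \<open>D\<close> matter. Families \<open>(F\<^sub>j)\<close>, sample points and levels are indexed from 1.\<close>

definition lin_span :: "nat \<Rightarrow> (nat \<Rightarrow> 'a \<Rightarrow> real) \<Rightarrow> ('a \<Rightarrow> real) set" where
  "lin_span N F = {v. \<exists>c. v = (\<lambda>x. \<Sum>j=1..N. c j * F j x)}"

definition square_integrable :: "'a measure \<Rightarrow> ('a \<Rightarrow> real) \<Rightarrow> bool" where
  "square_integrable \<mu> f \<longleftrightarrow> f \<in> borel_measurable \<mu> \<and> integrable \<mu> (\<lambda>x. (f x)\<^sup>2)"

definition l2_norm :: "'a measure \<Rightarrow> ('a \<Rightarrow> real) \<Rightarrow> real" where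
  "l2_norm \<mu> f = sqrt (\<integral>x. (f x)\<^sup>2 \<partial>\<mu>)"

definition best_error :: "'a measure \<Rightarrow> ('a \<Rightarrow> real) set \<Rightarrow> ('a \<Rightarrow> real) \<Rightarrow> real" where
  "best_error \<mu> V u = (INF v\<in>V. l2_norm \<mu> (\<lambda>x. u x - v x))"

text \<open>Gives both \<open>k\<^bsub>n\<^esub>\<close> (for the \<open>L\<^sup>2\<close>-orthonormal family) and its empirical version (for a
  basis orthonormal with respect to an empirical inner product).\<close>

definition sum_squares :: "nat \<Rightarrow> (nat \<Rightarrow> 'a \<Rightarrow> real) \<Rightarrow> 'a \<Rightarrow> real" where
  "sum_squares N F x = (\<Sum>j=1..N. (F j x)\<^sup>2)"

definition gamma_const :: real where
  "gamma_const = inverse (3/2 * ln (3/2) - 1/2)"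

definition truncate_at :: "real \<Rightarrow> real \<Rightarrow> real" where
  "truncate_at \<tau> y = min \<tau> \<bar>y\<bar> * sgn y"

text \<open>Operator norm, for the Euclidean norm, of the matrix \<open>(A j k)\<close> with \<open>j, k \<in> {1..N}\<close>.\<close>

definition spectral_norm :: "nat \<Rightarrow> (nat \<Rightarrow> nat \<Rightarrow> real) \<Rightarrow> real" where
  "spectral_norm N A =
     (SUP c\<in>{c. L2_set c {1..N} \<le> 1}. L2_set (\<lambda>j. \<Sum>k=1..N. A j k * c k) {1..N})"

definition identity_matrix :: "nat \<Rightarrow> nat \<Rightarrow> real" where
  "identity_matrix j k = (if j = k then 1 else 0)"

definition inner_product_on ::
  "'a set \<Rightarrow> ('a \<Rightarrow> real) set \<Rightarrow> (('a \<Rightarrow> real) \<Rightarrow> ('a \<Rightarrow> real) \<Rightarrow> real) \<Rightarrow> bool" where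
  "inner_product_on D V ip \<longleftrightarrow>
     (\<forall>u\<in>V. \<forall>v\<in>V. ip u v = ip v u) \<and>
     (\<forall>u\<in>V. \<forall>v\<in>V. \<forall>w\<in>V. \<forall>a b. ip (\<lambda>x. a * u x + b * v x) w = a * ip u w + b * ip v w) \<and>
     (\<forall>u\<in>V. 0 \<le> ip u u \<and> (ip u u = 0 \<longrightarrow> (\<forall>x\<in>D. u x = 0)))"

definition orthonormal_basis ::
  "(('a \<Rightarrow> real) \<Rightarrow> ('a \<Rightarrow> real) \<Rightarrow> real) \<Rightarrow> ('a \<Rightarrow> real) set \<Rightarrow> nat \<Rightarrow> (nat \<Rightarrow> 'a \<Rightarrow> real) \<Rightarrow> bool"
where
  "orthonormal_basis ip V N F \<longleftrightarrow>
     lin_span N F = V \<and>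
     (\<forall>j\<in>{1..N}. \<forall>k\<in>{1..N}. ip (F j) (F k) = (if j = k then 1 else 0))"

definition empirical_inner ::
  "nat \<Rightarrow> ('a \<Rightarrow> real) \<Rightarrow> (nat \<Rightarrow> 'a) \<Rightarrow> ('a \<Rightarrow> real) \<Rightarrow> ('a \<Rightarrow> real) \<Rightarrow> real" where
  "empirical_inner N w y u v = (1 / real N) * (\<Sum>i=1..N. w (y i) * u (y i) * v (y i))"

definition gram :: "(('a \<Rightarrow> real) \<Rightarrow> ('a \<Rightarrow> real) \<Rightarrow> real) \<Rightarrow> (nat \<Rightarrow> 'a \<Rightarrow> real) \<Rightarrow> nat \<Rightarrow> nat \<Rightarrow> real"
where
  "gram ip F j k = ip (F j) (F k)"

definition normalization :: "'a measure \<Rightarrow> nat \<Rightarrow> ('a \<Rightarrow> real) \<Rightarrow> real" where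
  "normalization \<mu> N k = inverse (\<integral>x. k x / real N \<partial>\<mu>)"

definition sampling_measure :: "'a measure \<Rightarrow> nat \<Rightarrow> ('a \<Rightarrow> real) \<Rightarrow> 'a measure" where
  "sampling_measure \<mu> N k =
     density \<mu> (\<lambda>x. ennreal (normalization \<mu> N k * (k x / real N)))"

definition sampling_weight :: "'a measure \<Rightarrow> nat \<Rightarrow> ('a \<Rightarrow> real) \<Rightarrow> 'a \<Rightarrow> real" where
  "sampling_weight \<mu> N k x = real N / (normalization \<mu> N k * k x)"

text \<open>Offline draws are arrays \<open>z\<close>, where \<open>z p i\<close> is the \<open>i\<close>-th draw at level \<open>p\<close>. A basis
  selection \<open>B\<close> assigns to a level \<open>p\<close> and the draws of the levels \<open>1, \<dots>, p\<close> (an array that is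
  undefined at all other levels, whence the \<open>restrict\<close> below) the basis constructed at level \<open>p\<close>.\<close>

definition offline_space ::
  "'a measure \<Rightarrow> (nat \<Rightarrow> nat) \<Rightarrow> nat \<Rightarrow> (nat \<Rightarrow> nat \<Rightarrow> 'a) measure" where
  "offline_space \<mu> M p = (\<Pi>\<^sub>M r\<in>{1..p}. \<Pi>\<^sub>M i\<in>{1..M r}. \<mu>)"

context
  fixes \<mu> :: "'a measure"
    and L :: "nat \<Rightarrow> 'a \<Rightarrow> real"
    and n M :: "nat \<Rightarrow> nat"
    and B :: "nat \<Rightarrow> (nat \<Rightarrow> nat \<Rightarrow> 'a) \<Rightarrow> nat \<Rightarrow> 'a \<Rightarrow> real"
begin

definition level_k :: "nat \<Rightarrow> (nat \<Rightarrow> nat \<Rightarrow> 'a) \<Rightarrow> 'a \<Rightarrow> real" where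
  "level_k p z = sum_squares (n p) (B p (restrict z {1..p}))"

definition level_weight :: "nat \<Rightarrow> (nat \<Rightarrow> nat \<Rightarrow> 'a) \<Rightarrow> 'a \<Rightarrow> real" where
  "level_weight p z = (if p = 0 then (\<lambda>_. 1) else sampling_weight \<mu> (n p) (level_k p z))"

definition level_inner ::
  "nat \<Rightarrow> (nat \<Rightarrow> nat \<Rightarrow> 'a) \<Rightarrow> ('a \<Rightarrow> real) \<Rightarrow> ('a \<Rightarrow> real) \<Rightarrow> real" where
  "level_inner p z = empirical_inner (M p) (level_weight (p - 1) z) (z p)"

definition regular_upto :: "nat \<Rightarrow> (nat \<Rightarrow> nat \<Rightarrow> 'a) \<Rightarrow> bool" where
  "regular_upto p z \<longleftrightarrow>
     (\<forall>r\<in>{1..p}. inner_product_on (space \<mu>) (lin_span (n r) L) (level_inner r z))"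

text \<open>\<open>\<sigma> p z\<close> is the measure from which the draws following level \<open>p\<close> are taken. If some
  \<open>level_inner r z\<close> with \<open>r \<le> p\<close> fails to be an inner product, it is an arbitrary probability
  measure; that choice must be measurable in the draws for the draws to have a joint law.\<close>

definition multilevel_algorithm ::
  "nat \<Rightarrow> (nat \<Rightarrow> (nat \<Rightarrow> nat \<Rightarrow> 'a) \<Rightarrow> 'a measure) \<Rightarrow> bool" where
  "multilevel_algorithm q \<sigma> \<longleftrightarrow>
     (\<forall>z\<in>space (offline_space \<mu> M 0). \<sigma> 0 z = \<mu>) \<and>
     (\<forall>p\<in>{1..q}. \<forall>z\<in>space (offline_space \<mu> M p). regular_upto p z \<longrightarrow>
        orthonormal_basis (level_inner p z) (lin_span (n p) L) (n p) (B p z) \<and>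
        \<sigma> p z = sampling_measure \<mu> (n p) (level_k p z)) \<and>
     (\<forall>p\<in>{0..q}. \<sigma> p \<in> offline_space \<mu> M p \<rightarrow>\<^sub>M prob_algebra \<mu>)"

definition online_inner ::
  "nat \<Rightarrow> nat \<Rightarrow> (nat \<Rightarrow> nat \<Rightarrow> 'a) \<times> (nat \<Rightarrow> 'a) \<Rightarrow> ('a \<Rightarrow> real) \<Rightarrow> ('a \<Rightarrow> real) \<Rightarrow> real" where
  "online_inner q m = (\<lambda>(z, x). empirical_inner m (level_weight q z) x)"

definition good_event ::
  "nat \<Rightarrow> nat \<Rightarrow> ((nat \<Rightarrow> nat \<Rightarrow> 'a) \<times> (nat \<Rightarrow> 'a)) set" where
  "good_event q m =
     {(z, x) \<in> space (offline_space \<mu> M q \<Otimes>\<^sub>M (\<Pi>\<^sub>M i\<in>{1..m}. \<mu>)).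
        regular_upto q z \<and>
        spectral_norm (n q)
          (\<lambda>j k. gram (online_inner q m (z, x)) L j k - identity_matrix j k) \<le> 1/2 \<and>
        spectral_norm (n q)
          (\<lambda>j k. gram (level_inner q z) L j k - identity_matrix j k) \<le> 1/2}"

text \<open>The minimizer need not be unique; measurability is required of the selection so that the
  expected errors make sense. Off the regular event any element of the space is allowed.\<close>

definition least_squares_estimator ::
  "nat \<Rightarrow> nat \<Rightarrow> ('a \<Rightarrow> real) \<Rightarrow>
     ((nat \<Rightarrow> nat \<Rightarrow> 'a) \<times> (nat \<Rightarrow> 'a) \<Rightarrow> 'a \<Rightarrow> real) \<Rightarrow> bool" where
  "least_squares_estimator q m u ut \<longleftrightarrow>
     (\<lambda>(\<omega>, y). ut \<omega> y) \<in>
        borel_measurable ((offline_space \<mu> M q \<Otimes>\<^sub>M (\<Pi>\<^sub>M i\<in>{1..m}. \<mu>)) \<Otimes>\<^sub>M \<mu>) \<and>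
     (\<forall>(z, x)\<in>space (offline_space \<mu> M q \<Otimes>\<^sub>M (\<Pi>\<^sub>M i\<in>{1..m}. \<mu>)).
        ut (z, x) \<in> lin_span (n q) L \<and>
        (regular_upto q z \<longrightarrow>
          (\<forall>v\<in>lin_span (n q) L.
             (\<Sum>i=1..m. level_weight q z (x i) * \<bar>u (x i) - ut (z, x) (x i)\<bar>\<^sup>2)
             \<le> (\<Sum>i=1..m. level_weight q z (x i) * \<bar>u (x i) - v (x i)\<bar>\<^sup>2))))"

end

primrec offline_law ::
  "'a measure \<Rightarrow> (nat \<Rightarrow> nat) \<Rightarrow> (nat \<Rightarrow> (nat \<Rightarrow> nat \<Rightarrow> 'a) \<Rightarrow> 'a measure) \<Rightarrow> nat
     \<Rightarrow> (nat \<Rightarrow> nat \<Rightarrow> 'a) measure" where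
  "offline_law \<mu> M \<sigma> 0 = return (offline_space \<mu> M 0) (\<lambda>_. undefined)"
| "offline_law \<mu> M \<sigma> (Suc p) =
     offline_law \<mu> M \<sigma> p \<bind>
       (\<lambda>z. distr (\<Pi>\<^sub>M i\<in>{1..M (Suc p)}. \<sigma> p z) (offline_space \<mu> M (Suc p))
              (\<lambda>y. z(Suc p := y)))"

text \<open>Joint law of the offline draws of \<open>q\<close> levels and of \<open>m\<close> online draws.\<close>

definition draws_law ::
  "'a measure \<Rightarrow> (nat \<Rightarrow> nat) \<Rightarrow> (nat \<Rightarrow> (nat \<Rightarrow> nat \<Rightarrow> 'a) \<Rightarrow> 'a measure) \<Rightarrow> nat \<Rightarrow> nat
     \<Rightarrow> ((nat \<Rightarrow> nat \<Rightarrow> 'a) \<times> (nat \<Rightarrow> 'a)) measure" where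
  "draws_law \<mu> M \<sigma> q m =
     offline_law \<mu> M \<sigma> q \<bind>
       (\<lambda>z. distr (\<Pi>\<^sub>M i\<in>{1..m}. \<sigma> q z) (offline_space \<mu> M q \<Otimes>\<^sub>M (\<Pi>\<^sub>M i\<in>{1..m}. \<mu>))
              (\<lambda>x. (z, x)))"

end

theory Submission
  imports Defs
begin

text \<open>
  Why the theorem holds. Suppose that the Gram matrix of some level is within \<open>1/2\<close> of the identity
  in spectral norm. Then the empirical sum of squares of that level lies between \<open>2/3\<close> and \<open>2\<close> times
  \<open>k\<close> (\<open>sum_squares_comparison\<close>), so the weight of the sampling measure built from it satisfies
  \<open>w k \<le> 3 n\<close> (\<open>weight_times_sum_squares_le\<close>), hence \<open>w k \<le> 3 \<kappa> n\<close> for the \<open>k\<close> and \<open>n\<close> of the next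
  level; at the first level, where \<open>w = 1\<close>, this bound is assumed. The next Gram matrix is therefore a mean of independent rank-one matrices of norm at most \<open>K = 3 \<kappa> n\<close>,
  with the identity as expectation, and it is again within \<open>1/2\<close> of the identity except with
  probability \<open>2 n exp(-M / (\<gamma> K))\<close>. The sample sizes are such that this is at most \<open>\<epsilon>\<^sub>p\<close>. Adding up
  over the levels gives \<open>\<epsilon>\<close> (\<open>offline_failure_probability\<close>), and the online samples, for which
  \<open>K = 3 n\<close>, contribute another \<open>\<epsilon>\<close> (\<open>good_failure_probability\<close>).

  The concentration inequality is \<open>matrix_Chernoff\<close>. As in the argument of Ahlswede and Winter, the
  expectation of \<open>tr exp(\<theta> \<Sum> f(x\<^sub>i) f(x\<^sub>i)\<^sup>T)\<close> is bounded by removing one sample at a time. For rank-one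
  summands the Golden-Thompson inequality needed in that step has an elementary proof
  (\<open>rank_one_Golden_Thompson\<close>): comparing eigenbases of \<open>A\<close> and \<open>A + h v v\<^sup>T\<close> gives exact
  finite-difference formulas, and scalar inequalities for the exponential applied to them give
  one-step bounds, which are iterated with step tending to zero. Besides limits of real sequences,
  this uses only the spectral theorem for symmetric matrices (\<open>spectral_theorem\<close>), which comes from
  maximizing the quadratic form.

  On the good event the squared error is the squared best error plus the squared distance of the
  estimator from the projection of \<open>u\<close>. Since the smallest eigenvalue of \<open>G\<close> is at least \<open>1/2\<close>, this
  squared distance is at most four times the sum of the squared empirical products of the residual with the
  \<open>L\<^sub>j\<close> (\<open>least_squares_stability\<close>). These are centred means of \<open>m\<close> independent variables, and \<open>w k \<le> 3 n\<close> bounds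
  the sum of their variances by \<open>3 n / m\<close> times the squared best error
  (\<open>expected_empirical_residual\<close>); this is where \<open>\<eta> = 12 n / m\<close> comes from. For the truncated
  estimator the exceptional event adds at most \<open>(2 \<tau>)\<^sup>2\<close> times its probability \<open>2 \<epsilon>\<close>.

  Measurability needs care because the bases chosen by the algorithm need not depend measurably on
  the draws. The sums of squares do: they are determined by the Gram matrices through the extremal
  property \<open>sum_squares_orthonormal_basis_le_iff\<close>, a semidefiniteness condition that can be tested
  on rational vectors (\<open>measurable_regular_and_weight\<close>).
\<close>

section \<open>Symmetric matrices on real coordinate space\<close>

text \<open>The dimensions \<open>n\<^sub>p\<close> are values and not types, so a vector of length \<open>N\<close> is a function on the
  naturals of which only the entries \<open>1, \<dots>, N\<close> count, and similarly for matrices.\<close>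

definition dot :: "nat \<Rightarrow> (nat \<Rightarrow> real) \<Rightarrow> (nat \<Rightarrow> real) \<Rightarrow> real" where
  "dot N c d = (\<Sum>k=1..N. c k * d k)"

definition mat_vec :: "nat \<Rightarrow> (nat \<Rightarrow> nat \<Rightarrow> real) \<Rightarrow> (nat \<Rightarrow> real) \<Rightarrow> nat \<Rightarrow> real" where
  "mat_vec N A c j = (\<Sum>k=1..N. A j k * c k)"

definition quad :: "nat \<Rightarrow> (nat \<Rightarrow> nat \<Rightarrow> real) \<Rightarrow> (nat \<Rightarrow> real) \<Rightarrow> real" where
  "quad N A c = dot N c (mat_vec N A c)"

definition symmetric_matrix :: "nat \<Rightarrow> (nat \<Rightarrow> nat \<Rightarrow> real) \<Rightarrow> bool" where
  "symmetric_matrix N A \<longleftrightarrow> (\<forall>j\<in>{1..N}. \<forall>k\<in>{1..N}. A j k = A k j)"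

definition orthonormal_vectors :: "nat \<Rightarrow> nat \<Rightarrow> (nat \<Rightarrow> nat \<Rightarrow> real) \<Rightarrow> bool" where
  "orthonormal_vectors N m b \<longleftrightarrow>
     (\<forall>i\<in>{1..m}. \<forall>j\<in>{1..m}. dot N (b i) (b j) = (if i = j then 1 else 0))"

definition eigensystem ::
  "nat \<Rightarrow> (nat \<Rightarrow> nat \<Rightarrow> real) \<Rightarrow> (nat \<Rightarrow> real) \<Rightarrow> (nat \<Rightarrow> nat \<Rightarrow> real) \<Rightarrow> bool" where
  "eigensystem N A l b \<longleftrightarrow> orthonormal_vectors N N b \<and>
     (\<forall>i\<in>{1..N}. \<forall>j\<in>{1..N}. mat_vec N A (b i) j = l i * b i j)"

lemma dot_commute: "dot N c d = dot N d c"
  by (simp add: dot_def mult.commute)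

lemma dot_cong: "(\<And>k. k \<in> {1..N} \<Longrightarrow> c k = c' k) \<Longrightarrow> (\<And>k. k \<in> {1..N} \<Longrightarrow> d k = d' k) \<Longrightarrow>
    dot N c d = dot N c' d'"
  by (simp add: dot_def)

lemma dot_add_left: "dot N (\<lambda>k. c k + d k) e = dot N c e + dot N d e"
  by (simp add: dot_def sum.distrib algebra_simps)

lemma dot_scale_left: "dot N (\<lambda>k. a * c k) e = a * dot N c e"
  by (simp add: dot_def sum_distrib_left mult_ac)

lemma dot_add_right: "dot N e (\<lambda>k. c k + d k) = dot N e c + dot N e d"
  by (simp add: dot_def sum.distrib algebra_simps)

lemma dot_diff_right: "dot N e (\<lambda>k. c k - d k) = dot N e c - dot N e d"
  by (simp add: dot_def sum_subtractf algebra_simps)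

lemma dot_diff_left: "dot N (\<lambda>k. c k - d k) e = dot N c e - dot N d e"
  by (simp add: dot_def sum_subtractf algebra_simps)

lemma dot_scale_right: "dot N e (\<lambda>k. a * c k) = a * dot N e c"
  by (simp add: dot_def sum_distrib_left mult_ac)

lemmas dot_linear = dot_add_left dot_add_right dot_diff_left dot_diff_right dot_scale_left dot_scale_right

lemma dot_self_nonneg: "0 \<le> dot N c c"
  by (simp add: dot_def sum_nonneg)

lemma dot_self_eq_0: "dot N c c = 0 \<longleftrightarrow> (\<forall>k\<in>{1..N}. c k = 0)"
  by (simp add: dot_def sum_nonneg_eq_0_iff)

lemma dot_self_eq_L2_set: "dot N c c = (L2_set c {1..N})\<^sup>2"
  by (simp add: dot_def L2_set_def power2_eq_square sum_nonneg)

lemma dot_Cauchy_Schwarz: "(dot N c d)\<^sup>2 \<le> dot N c c * dot N d d"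
  using Cauchy_Schwarz_ineq_sum[of c d "{1..N}"] by (simp add: dot_def power2_eq_square)

lemma mat_vec_add: "mat_vec N A (\<lambda>k. c k + d k) j = mat_vec N A c j + mat_vec N A d j"
  by (simp add: mat_vec_def sum.distrib algebra_simps)

lemma mat_vec_scale: "mat_vec N A (\<lambda>k. a * c k) j = a * mat_vec N A c j"
  by (simp add: mat_vec_def sum_distrib_left mult_ac)

lemma dot_mat_vec_commute:
  assumes "symmetric_matrix N A"
  shows "dot N c (mat_vec N A d) = dot N (mat_vec N A c) d"
proof -
  have "dot N c (mat_vec N A d) = (\<Sum>j=1..N. \<Sum>k=1..N. A j k * c j * d k)"
    by (simp add: dot_def mat_vec_def sum_distrib_left mult_ac)
  also have "\<dots> = (\<Sum>k=1..N. \<Sum>j=1..N. A j k * c j * d k)" by (rule sum.swap)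
  also have "\<dots> = (\<Sum>k=1..N. \<Sum>j=1..N. A k j * c j * d k)"
    using assms by (intro sum.cong refl) (auto simp: symmetric_matrix_def)
  also have "\<dots> = dot N (mat_vec N A c) d"
    by (simp add: dot_def mat_vec_def sum_distrib_right)
  finally show ?thesis .
qed

lemma quad_scale: "quad N A (\<lambda>k. a * c k) = a\<^sup>2 * quad N A c"
  by (simp add: quad_def mat_vec_scale[abs_def] dot_linear power2_eq_square)

lemma quad_eq_sum: "quad N A c = (\<Sum>j=1..N. \<Sum>k=1..N. A j k * c j * c k)"
  by (simp add: quad_def dot_def mat_vec_def sum_distrib_left mult_ac)

lemma quad_cong: "(\<And>k. k \<in> {1..N} \<Longrightarrow> c k = d k) \<Longrightarrow> quad N A c = quad N A d"
  by (simp add: quad_eq_sum)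

text \<open>The matrix \<open>r\<close> is the orthogonal projection onto the complement of the given vectors. A
  projection has the same trace and squared Frobenius norm, here the dimension \<open>N - m\<close>. These
  two numbers replace every dimension argument below: \<open>m = N\<close> forces \<open>r = 0\<close> and \<open>m < N\<close>
  forces \<open>r \<noteq> 0\<close>.\<close>

lemma residual_of_orthonormal_vectors:
  assumes "orthonormal_vectors N m b"
  defines "r \<equiv> \<lambda>j k. identity_matrix j k - (\<Sum>i=1..m. b i j * b i k)"
  shows "(\<Sum>j=1..N. r j j) = real N - real m"
    and "(\<Sum>j=1..N. \<Sum>k=1..N. (r j k)\<^sup>2) = real N - real m"
    and "\<And>i j. i \<in> {1..m} \<Longrightarrow> j \<in> {1..N} \<Longrightarrow> dot N (r j) (b i) = 0"
proof -
  have on: "dot N (b i) (b j) = (if i = j then 1 else 0)" if "i \<in> {1..m}" "j \<in> {1..m}" for i j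
    using assms that by (auto simp: orthonormal_vectors_def)
  have "(\<Sum>j=1..N. \<Sum>i=1..m. b i j * b i j) = (\<Sum>i=1..m. dot N (b i) (b i))"
    unfolding dot_def by (rule sum.swap)
  also have "\<dots> = real m" using on by simp
  finally have tr: "(\<Sum>j=1..N. \<Sum>i=1..m. b i j * b i j) = real m" .
  then show 1: "(\<Sum>j=1..N. r j j) = real N - real m"
    by (simp add: r_def identity_matrix_def sum_subtractf)
  show 2: "dot N (r j) (b i) = 0" if i: "i \<in> {1..m}" and j: "j \<in> {1..N}" for i j
  proof -
    have "dot N (r j) (b i) = (\<Sum>k=1..N. identity_matrix j k * b i k)
        - (\<Sum>k=1..N. \<Sum>i'=1..m. b i' j * (b i' k * b i k))"
      by (simp add: dot_def r_def algebra_simps sum_subtractf sum_distrib_left sum_distrib_right)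
    also have "(\<Sum>k=1..N. identity_matrix j k * b i k) = b i j"
      using j by (simp add: identity_matrix_def if_distrib[of "\<lambda>x. x * _"] cong: if_cong)
    also have "(\<Sum>k=1..N. \<Sum>i'=1..m. b i' j * (b i' k * b i k))
        = (\<Sum>i'=1..m. b i' j * dot N (b i') (b i))"
      unfolding dot_def by (subst sum.swap) (simp add: sum_distrib_left)
    also have "\<dots> = (\<Sum>i'=1..m. b i' j * (if i' = i then 1 else 0))"
      using on i by (intro sum.cong) auto
    also have "\<dots> = b i j" using i by (simp add: if_distrib[of "\<lambda>x. _ * x"] cong: if_cong)
    finally show ?thesis by simp
  qed
  have "(\<Sum>k=1..N. (r j k)\<^sup>2) = r j j" if j: "j \<in> {1..N}" for j
  proof -
    have "(\<Sum>k=1..N. (r j k)\<^sup>2) = dot N (r j) (r j)"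
      by (simp add: dot_def power2_eq_square)
    also have "\<dots> = dot N (r j) (identity_matrix j) - dot N (r j) (\<lambda>k. \<Sum>i=1..m. b i j * b i k)"
      by (subst (2) r_def) (simp add: dot_diff_right)
    also have "dot N (r j) (\<lambda>k. \<Sum>i=1..m. b i j * b i k) = (\<Sum>i=1..m. b i j * dot N (r j) (b i))"
      unfolding dot_def sum_distrib_left
      by (subst sum.swap) (simp add: mult_ac)
    also have "\<dots> = 0" using 2 j by simp
    also have "dot N (r j) (identity_matrix j) = r j j"
      using j by (simp add: dot_def identity_matrix_def if_distrib[of "\<lambda>x. _ * x"] cong: if_cong)
    finally show ?thesis by simp
  qed
  then show "(\<Sum>j=1..N. \<Sum>k=1..N. (r j k)\<^sup>2) = real N - real m"
    using 1 by simp
qed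

lemma orthonormal_vectors_complete:
  assumes "orthonormal_vectors N N b" "j \<in> {1..N}" "k \<in> {1..N}"
  shows "(\<Sum>i=1..N. b i j * b i k) = identity_matrix j k"
proof -
  have "(\<Sum>j=1..N. \<Sum>k=1..N. (identity_matrix j k - (\<Sum>i=1..N. b i j * b i k))\<^sup>2) = 0"
    using residual_of_orthonormal_vectors(2)[OF assms(1)] by simp
  then have "(\<Sum>k=1..N. (identity_matrix j k - (\<Sum>i=1..N. b i j * b i k))\<^sup>2) = 0"
    using assms(2) by (subst (asm) sum_nonneg_eq_0_iff) (auto intro!: sum_nonneg)
  then show ?thesis
    using assms(3) by (subst (asm) sum_nonneg_eq_0_iff) auto
qed

lemma dot_orthonormal_expansion:
  assumes "orthonormal_vectors N N b"
  shows "dot N c d = (\<Sum>i=1..N. dot N c (b i) * dot N d (b i))"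
proof -
  have "(\<Sum>i=1..N. dot N c (b i) * dot N d (b i))
      = (\<Sum>i=1..N. \<Sum>j=1..N. \<Sum>k=1..N. c j * d k * (b i j * b i k))"
    by (simp add: dot_def sum_product mult_ac)
  also have "\<dots> = (\<Sum>j=1..N. \<Sum>i=1..N. \<Sum>k=1..N. c j * d k * (b i j * b i k))"
    by (rule sum.swap)
  also have "\<dots> = (\<Sum>j=1..N. \<Sum>k=1..N. \<Sum>i=1..N. c j * d k * (b i j * b i k))"
    by (intro sum.cong refl sum.swap)
  also have "\<dots> = (\<Sum>j=1..N. \<Sum>k=1..N. c j * d k * identity_matrix j k)"
    using orthonormal_vectors_complete[OF assms] by (simp flip: sum_distrib_left)
  also have "\<dots> = dot N c d"
    by (simp add: dot_def identity_matrix_def if_distrib[of "\<lambda>x. _ * x"] cong: if_cong)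
  finally show ?thesis by simp
qed

text \<open>Any nonzero row of the projection, normalized.\<close>

lemma exists_orthogonal_unit_vector:
  assumes "orthonormal_vectors N m b" "m < N"
  obtains c where "dot N c c = 1" "\<And>i. i \<in> {1..m} \<Longrightarrow> dot N c (b i) = 0"
proof -
  define r where "r = (\<lambda>j k. identity_matrix j k - (\<Sum>i=1..m. b i j * b i k))"
  have "(\<Sum>j=1..N. \<Sum>k=1..N. (r j k)\<^sup>2) > 0"
    using residual_of_orthonormal_vectors(2)[OF assms(1)] assms(2) by (simp add: r_def)
  then obtain j where j: "j \<in> {1..N}" "(\<Sum>k=1..N. (r j k)\<^sup>2) > 0"
    by (meson not_less sum_nonpos)
  define s where "s = dot N (r j) (r j)"
  have s: "s > 0" using j by (simp add: s_def dot_def power2_eq_square)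
  define c where "c = (\<lambda>k. (1 / sqrt s) * r j k)"
  have "dot N c c = 1"
    using s unfolding c_def dot_linear by (simp add: s_def[symmetric])
  moreover have "dot N c (b i) = 0" if "i \<in> {1..m}" for i
    using residual_of_orthonormal_vectors(3)[OF assms(1) that j(1)]
    unfolding c_def dot_linear r_def by simp
  ultimately show ?thesis using that by blast
qed

text \<open>The unit sphere of the orthogonal complement is compact once the entries outside \<open>1, \<dots>, N\<close>,
  on which nothing depends, are pinned to zero: it is then closed inside a product of compact
  intervals. The bound extends from the sphere to all vectors by homogeneity.\<close>

lemma exists_maximizer_of_quad:
  assumes "orthonormal_vectors N m b" "m < N"
  obtains c where "dot N c c = 1" "\<And>i. i \<in> {1..m} \<Longrightarrow> dot N c (b i) = 0"
    "\<And>d. (\<And>i. i \<in> {1..m} \<Longrightarrow> dot N d (b i) = 0) \<Longrightarrow> quad N A d \<le> quad N A c * dot N d d"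
proof -
  define K where "K = {c :: nat \<Rightarrow> real. (\<forall>k. c k \<in> (if k \<in> {1..N} then {-1..1} else {0}))
    \<and> dot N c c = 1 \<and> (\<forall>i\<in>{1..m}. dot N c (b i) = 0)}"
  have cont: "continuous_on UNIV (\<lambda>c :: nat \<Rightarrow> real. dot N c d)" for d
    unfolding dot_def by (intro continuous_intros continuous_on_product_coordinates)
  have cont1: "continuous_on UNIV (\<lambda>c :: nat \<Rightarrow> real. dot N c c)"
    unfolding dot_def by (intro continuous_intros continuous_on_product_coordinates)
  have cont2: "continuous_on UNIV (\<lambda>c :: nat \<Rightarrow> real. quad N A c)"
    unfolding quad_eq_sum by (intro continuous_intros continuous_on_product_coordinates)
  have box: "compact (PiE UNIV (\<lambda>k. if k \<in> {1..N} then {-1..1} else {0}) :: (nat \<Rightarrow> real) set)"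
    (is "compact ?B")
  proof -
    have "compactin (product_topology (\<lambda>_. euclidean) UNIV) ?B"
      by (subst compactin_PiE) auto
    then show ?thesis by (simp add: euclidean_product_topology)
  qed
  have "closed {c :: nat \<Rightarrow> real. dot N c c = 1}"
    by (intro closed_Collect_eq cont1 continuous_on_const)
  moreover have "closed (\<Inter>i\<in>{1..m}. {c :: nat \<Rightarrow> real. dot N c (b i) = 0})"
    by (intro closed_INT ballI closed_Collect_eq cont continuous_on_const)
  ultimately have "compact (?B \<inter> ({c. dot N c c = 1} \<inter> (\<Inter>i\<in>{1..m}. {c. dot N c (b i) = 0})))"
    by (intro compact_Int_closed box closed_Int)
  moreover have "K = ?B \<inter> ({c. dot N c c = 1} \<inter> (\<Inter>i\<in>{1..m}. {c. dot N c (b i) = 0}))"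
    by (auto simp: K_def PiE_def Pi_def)
  ultimately have comp: "compact K" by simp
  have in_K: "(\<lambda>k. if k \<in> {1..N} then c k else 0) \<in> K"
    if "dot N c c = 1" "\<And>i. i \<in> {1..m} \<Longrightarrow> dot N c (b i) = 0" for c
  proof -
    have "\<bar>c k\<bar> \<le> 1" if k: "k \<in> {1..N}" for k
    proof -
      have "(c k)\<^sup>2 \<le> (\<Sum>k=1..N. (c k)\<^sup>2)" by (rule member_le_sum[OF k]) auto
      then show ?thesis
        using \<open>dot N c c = 1\<close> by (simp add: dot_def power2_eq_square[symmetric] abs_square_le_1)
    qed
    moreover have "dot N (\<lambda>k. if k \<in> {1..N} then c k else 0) (\<lambda>k. if k \<in> {1..N} then c k else 0)
        = dot N c c"
      by (rule dot_cong) auto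
    moreover have "dot N (\<lambda>k. if k \<in> {1..N} then c k else 0) (b i) = dot N c (b i)" for i
      by (rule dot_cong) auto
    ultimately show ?thesis using that by (auto simp: K_def abs_le_iff)
  qed
  obtain c0 where "dot N c0 c0 = 1" "\<And>i. i \<in> {1..m} \<Longrightarrow> dot N c0 (b i) = 0"
    using exists_orthogonal_unit_vector[OF assms] by blast
  then have "K \<noteq> {}" using in_K by blast
  then obtain c where c: "c \<in> K" "\<And>d. d \<in> K \<Longrightarrow> quad N A d \<le> quad N A c"
    using continuous_attains_sup[OF comp _ continuous_on_subset[OF cont2 subset_UNIV]] by blast
  have max: "quad N A d \<le> quad N A c * dot N d d"
    if d: "\<And>i. i \<in> {1..m} \<Longrightarrow> dot N d (b i) = 0" for d
  proof (cases "dot N d d = 0")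
    case True
    then have "quad N A d = 0"
      by (auto simp: dot_self_eq_0 quad_eq_sum)
    then show ?thesis using True by simp
  next
    case False
    define s where "s = dot N d d"
    have s: "s > 0" using False dot_self_nonneg[of N d] by (simp add: s_def)
    define e where "e = (\<lambda>k. (1 / sqrt s) * d k)"
    have "dot N e e = 1"
      using s unfolding e_def dot_linear by (simp add: s_def[symmetric])
    moreover have "dot N e (b i) = 0" if "i \<in> {1..m}" for i
      using d that unfolding e_def dot_linear by simp
    ultimately have "quad N A (\<lambda>k. if k \<in> {1..N} then e k else 0) \<le> quad N A c"
      by (intro c(2) in_K)
    also have "quad N A (\<lambda>k. if k \<in> {1..N} then e k else 0) = quad N A e"
      by (rule quad_cong) auto
    also have "quad N A e = quad N A d / s"
      using s unfolding e_def quad_scale by (simp add: power_divide)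
    finally show ?thesis using s by (simp add: s_def field_simps)
  qed
  show ?thesis using that[of c] c(1) max by (auto simp: K_def)
qed

text \<open>The component \<open>d\<close> of \<open>A c\<close> orthogonal to \<open>c\<close> is again orthogonal to the previous
  eigenvectors, hence an admissible direction; if it were nonzero, a small move from \<open>c\<close> along \<open>d\<close>
  would increase the quadratic form to first order.\<close>

lemma maximizer_of_quad_is_eigenvector:
  assumes sym: "symmetric_matrix N A"
    and eig: "\<And>i j. i \<in> {1..m} \<Longrightarrow> j \<in> {1..N} \<Longrightarrow> mat_vec N A (b i) j = l i * b i j"
    and c: "dot N c c = 1" "\<And>i. i \<in> {1..m} \<Longrightarrow> dot N c (b i) = 0"
    and max: "\<And>d. (\<And>i. i \<in> {1..m} \<Longrightarrow> dot N d (b i) = 0) \<Longrightarrow> quad N A d \<le> quad N A c * dot N d d"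
    and j: "j \<in> {1..N}"
  shows "mat_vec N A c j = quad N A c * c j"
proof -
  define d where "d = (\<lambda>k. mat_vec N A c k - quad N A c * c k)"
  define s where "s = dot N d d"
  have db: "dot N d (b i) = 0" if i: "i \<in> {1..m}" for i
  proof -
    have "dot N (mat_vec N A c) (b i) = dot N c (mat_vec N A (b i))"
      using dot_mat_vec_commute[OF sym] by simp
    also have "\<dots> = dot N c (\<lambda>k. l i * b i k)" using eig i by (intro dot_cong) auto
    also have "\<dots> = 0" using c i by (simp add: dot_linear)
    finally show ?thesis using c i by (simp add: d_def dot_linear)
  qed
  have dc: "dot N c d = 0"
    using c by (simp add: d_def dot_linear quad_def)
  have dA: "dot N d (mat_vec N A c) = s"
  proof -
    have "dot N d (mat_vec N A c) = dot N d (\<lambda>k. d k + quad N A c * c k)"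
      by (rule dot_cong) (auto simp: d_def)
    also have "\<dots> = s" using dc by (simp add: dot_linear s_def dot_commute)
    finally show ?thesis .
  qed
  have ineq: "2 * t * s \<le> t\<^sup>2 * (quad N A c * s - quad N A d)" for t
  proof -
    have "quad N A (\<lambda>k. c k + t * d k) \<le> quad N A c * dot N (\<lambda>k. c k + t * d k) (\<lambda>k. c k + t * d k)"
      by (rule max) (use c db in \<open>simp add: dot_linear\<close>)
    moreover have "dot N (\<lambda>k. c k + t * d k) (\<lambda>k. c k + t * d k) = 1 + t\<^sup>2 * s"
      using c dc by (simp add: dot_linear s_def dot_commute power2_eq_square)
    moreover have "quad N A (\<lambda>k. c k + t * d k) = quad N A c + 2 * t * s + t\<^sup>2 * quad N A d"
    proof -
      have "dot N c (mat_vec N A d) = s"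
        using dA dot_mat_vec_commute[OF sym, of c d] by (simp add: dot_commute)
      then show ?thesis using dA
        by (simp add: quad_def mat_vec_add[abs_def] mat_vec_scale[abs_def] dot_linear
            power2_eq_square algebra_simps)
    qed
    ultimately show ?thesis by (simp add: algebra_simps)
  qed
  have "s = 0"
  proof (rule ccontr)
    assume "s \<noteq> 0"
    then have s: "s > 0" using dot_self_nonneg[of N d] by (simp add: s_def)
    \<comment> \<open>The step \<open>t = s / C\<close> is short enough for the linear term to dominate.\<close>
    define C where "C = \<bar>quad N A c * s - quad N A d\<bar> + 1"
    have C: "C > 0" "quad N A c * s - quad N A d \<le> C" by (auto simp: C_def)
    have "2 * (s / C) * s \<le> (s / C)\<^sup>2 * (quad N A c * s - quad N A d)" by (rule ineq)
    also have "\<dots> \<le> (s / C)\<^sup>2 * C" using C by (intro mult_left_mono) auto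
    also have "\<dots> = s * s / C" using C by (simp add: power2_eq_square)
    finally show False using s C by (simp add: field_simps)
  qed
  then show ?thesis using j by (simp add: s_def dot_self_eq_0 d_def)
qed

text \<open>Eigenvectors are produced one after the other, each maximizing the quadratic form on the
  orthogonal complement of its predecessors.\<close>

theorem spectral_theorem:
  assumes "symmetric_matrix N A"
  obtains l b where "eigensystem N A l b"
proof -
  have "\<exists>l b. orthonormal_vectors N m b \<and>
      (\<forall>i\<in>{1..m}. \<forall>j\<in>{1..N}. mat_vec N A (b i) j = l i * b i j)" if "m \<le> N" for m
    using that
  proof (induction m)
    case 0
    show ?case by (simp add: orthonormal_vectors_def)
  next
    case (Suc m)
    then obtain l b where lb: "orthonormal_vectors N m b"
      "\<And>i j. i \<in> {1..m} \<Longrightarrow> j \<in> {1..N} \<Longrightarrow> mat_vec N A (b i) j = l i * b i j"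
      by force
    obtain c where c: "dot N c c = 1" "\<And>i. i \<in> {1..m} \<Longrightarrow> dot N c (b i) = 0"
      "\<And>d. (\<And>i. i \<in> {1..m} \<Longrightarrow> dot N d (b i) = 0) \<Longrightarrow> quad N A d \<le> quad N A c * dot N d d"
      using exists_maximizer_of_quad[OF lb(1), of A] Suc.prems by auto
    have e: "mat_vec N A c j = quad N A c * c j" if "j \<in> {1..N}" for j
      by (rule maximizer_of_quad_is_eigenvector[where m = m and b = b and l = l])
        (use assms lb(2) c that in blast)+
    have "orthonormal_vectors N (Suc m) (b(Suc m := c))"
      using lb(1) c by (auto simp: orthonormal_vectors_def dot_commute le_Suc_eq)
    moreover have "\<forall>i\<in>{1..Suc m}. \<forall>j\<in>{1..N}.
        mat_vec N A ((b(Suc m := c)) i) j = (l(Suc m := quad N A c)) i * (b(Suc m := c)) i j"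
      using lb(2) e by (auto simp: le_Suc_eq)
    ultimately show ?case by blast
  qed
  from this[of N] show ?thesis using that by (auto simp: eigensystem_def)
qed

lemma dot_mat_vec_eigensystem:
  assumes "eigensystem N A l b" "symmetric_matrix N A" "i \<in> {1..N}"
  shows "dot N (mat_vec N A c) (b i) = l i * dot N c (b i)"
proof -
  have "dot N (mat_vec N A c) (b i) = dot N c (mat_vec N A (b i))"
    using dot_mat_vec_commute[OF assms(2)] by simp
  also have "\<dots> = dot N c (\<lambda>k. l i * b i k)"
    using assms by (intro dot_cong) (auto simp: eigensystem_def)
  finally show ?thesis by (simp add: dot_linear)
qed

lemma quad_eigensystem:
  assumes "eigensystem N A l b" "symmetric_matrix N A"
  shows "quad N A c = (\<Sum>i=1..N. l i * (dot N c (b i))\<^sup>2)"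
proof -
  have "quad N A c = (\<Sum>i=1..N. dot N c (b i) * dot N (mat_vec N A c) (b i))"
    unfolding quad_def using assms(1) by (intro dot_orthonormal_expansion) (simp add: eigensystem_def)
  also have "\<dots> = (\<Sum>i=1..N. l i * (dot N c (b i))\<^sup>2)"
    using dot_mat_vec_eigensystem[OF assms] by (intro sum.cong refl) (simp add: power2_eq_square)
  finally show ?thesis .
qed

lemma dot_self_eigensystem:
  assumes "eigensystem N A l b"
  shows "dot N c c = (\<Sum>i=1..N. (dot N c (b i))\<^sup>2)"
  using dot_orthonormal_expansion[of N b c c] assms
  by (simp add: eigensystem_def power2_eq_square)

lemma dot_mat_vec_self_eigensystem:
  assumes "eigensystem N A l b" "symmetric_matrix N A"
  shows "dot N (mat_vec N A c) (mat_vec N A c) = (\<Sum>i=1..N. (l i)\<^sup>2 * (dot N c (b i))\<^sup>2)"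
  using dot_self_eigensystem[OF assms(1), of "mat_vec N A c"] dot_mat_vec_eigensystem[OF assms]
  by (simp add: power_mult_distrib)

lemma eigenvector_unit: "eigensystem N A l b \<Longrightarrow> i \<in> {1..N} \<Longrightarrow> dot N (b i) (b i) = 1"
  by (auto simp: eigensystem_def orthonormal_vectors_def)

lemma quad_eigenvector:
  assumes "eigensystem N A l b" "i \<in> {1..N}"
  shows "quad N A (b i) = l i"
proof -
  have "quad N A (b i) = dot N (b i) (\<lambda>k. l i * b i k)"
    unfolding quad_def using assms by (intro dot_cong) (auto simp: eigensystem_def)
  then show ?thesis using eigenvector_unit[OF assms] by (simp add: dot_linear)
qed

section \<open>The exponential of a symmetric matrix under rank-one updates\<close>

text \<open>The number \<open>v \<cdot> e\<^sup>A v\<close> and the trace of \<open>e\<^sup>A\<close>. The power series makes both depend measurably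
  on the entries of \<open>A\<close> and shows that the formulas in terms of an eigensystem do not depend on the
  choice of that system.\<close>

definition exp_form :: "nat \<Rightarrow> (nat \<Rightarrow> nat \<Rightarrow> real) \<Rightarrow> (nat \<Rightarrow> real) \<Rightarrow> real" where
  "exp_form N A v = (\<Sum>k. dot N v ((mat_vec N A ^^ k) v) / fact k)"

definition trace_exp :: "nat \<Rightarrow> (nat \<Rightarrow> nat \<Rightarrow> real) \<Rightarrow> real" where
  "trace_exp N A = (\<Sum>j=1..N. exp_form N A (identity_matrix j))"

definition add_rank_one ::
  "(nat \<Rightarrow> nat \<Rightarrow> real) \<Rightarrow> real \<Rightarrow> (nat \<Rightarrow> real) \<Rightarrow> nat \<Rightarrow> nat \<Rightarrow> real" where
  "add_rank_one A h v = (\<lambda>j k. A j k + h * (v j * v k))"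

lemma symmetric_add_rank_one [simp]:
  "symmetric_matrix N A \<Longrightarrow> symmetric_matrix N (add_rank_one A h v)"
  by (simp add: symmetric_matrix_def add_rank_one_def)

lemma exp_form_eigensystem:
  assumes "eigensystem N A l b" "symmetric_matrix N A"
  shows "exp_form N A v = (\<Sum>i=1..N. exp (l i) * (dot N v (b i))\<^sup>2)"
proof -
  have power: "dot N ((mat_vec N A ^^ k) v) (b i) = l i ^ k * dot N v (b i)"
    if "i \<in> {1..N}" for i k
    using that by (induction k) (simp_all add: dot_mat_vec_eigensystem[OF assms])
  have "dot N v ((mat_vec N A ^^ k) v) = (\<Sum>i=1..N. l i ^ k * (dot N v (b i))\<^sup>2)" for k
  proof -
    have "dot N v ((mat_vec N A ^^ k) v) = (\<Sum>i=1..N. dot N v (b i) * dot N ((mat_vec N A ^^ k) v) (b i))"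
      using assms(1) by (intro dot_orthonormal_expansion) (simp add: eigensystem_def)
    also have "\<dots> = (\<Sum>i=1..N. l i ^ k * (dot N v (b i))\<^sup>2)"
      by (intro sum.cong refl) (simp add: power power2_eq_square)
    finally show ?thesis .
  qed
  then have *: "exp_form N A v = (\<Sum>k. \<Sum>i=1..N. l i ^ k / fact k * (dot N v (b i))\<^sup>2)"
    by (simp add: exp_form_def sum_divide_distrib)
  have "(\<lambda>k. l i ^ k / fact k) sums exp (l i)" for i
    using exp_converges[of "l i"] by (simp add: scaleR_conv_of_real divide_inverse mult.commute)
  then have "(\<lambda>k. \<Sum>i=1..N. l i ^ k / fact k * (dot N v (b i))\<^sup>2)
      sums (\<Sum>i=1..N. exp (l i) * (dot N v (b i))\<^sup>2)"
    by (intro sums_sum sums_mult2)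
  then show ?thesis unfolding * by (rule sums_unique[symmetric])
qed

lemma dot_identity_matrix: "j \<in> {1..N} \<Longrightarrow> dot N (identity_matrix j) c = c j"
  by (simp add: dot_def identity_matrix_def if_distrib[of "\<lambda>x. x * _"] cong: if_cong)

lemma trace_exp_eigensystem:
  assumes "eigensystem N A l b" "symmetric_matrix N A"
  shows "trace_exp N A = (\<Sum>i=1..N. exp (l i))"
proof -
  have "trace_exp N A = (\<Sum>j=1..N. \<Sum>i=1..N. exp (l i) * (b i j)\<^sup>2)"
    unfolding trace_exp_def using exp_form_eigensystem[OF assms]
    by (intro sum.cong refl) (simp add: dot_identity_matrix)
  also have "\<dots> = (\<Sum>i=1..N. exp (l i) * dot N (b i) (b i))"
    by (subst sum.swap) (simp add: dot_def power2_eq_square sum_distrib_left)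
  also have "\<dots> = (\<Sum>i=1..N. exp (l i))"
    using eigenvector_unit[OF assms(1)] by simp
  finally show ?thesis .
qed

lemma exp_form_nonneg: "symmetric_matrix N A \<Longrightarrow> 0 \<le> exp_form N A v"
proof -
  assume sym: "symmetric_matrix N A"
  obtain l b where "eigensystem N A l b" using spectral_theorem[OF sym] .
  then show ?thesis by (subst exp_form_eigensystem[OF _ sym]) (auto intro!: sum_nonneg)
qed

lemma trace_exp_nonneg: "symmetric_matrix N A \<Longrightarrow> 0 \<le> trace_exp N A"
  unfolding trace_exp_def by (intro sum_nonneg exp_form_nonneg)

lemma trace_exp_zero: "trace_exp N (\<lambda>j k. 0) = real N"
proof -
  have "eigensystem N (\<lambda>j k. 0) (\<lambda>_. 0) identity_matrix"
    by (auto simp: eigensystem_def orthonormal_vectors_def dot_identity_matrix mat_vec_def)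
      (auto simp: identity_matrix_def)
  then show ?thesis by (subst trace_exp_eigensystem) (auto simp: symmetric_matrix_def)
qed

text \<open>Exponentials of extreme eigenvalues are controlled by the trace: this is how a large or a small
  value of a quadratic form becomes a tail event for a scalar random variable.\<close>

lemma exp_quad_le_trace_exp:
  assumes sym: "symmetric_matrix N A" and c: "dot N c c = 1"
  shows "exp (quad N A c) \<le> trace_exp N A"
proof -
  obtain l b where e: "eigensystem N A l b" using spectral_theorem[OF sym] .
  have N: "{1..N} \<noteq> {}" using c by (cases "N = 0") (auto simp: dot_def)
  have "Max (l ` {1..N}) \<in> l ` {1..N}" using N by (intro Max_in) auto
  then obtain i where i: "i \<in> {1..N}" "Max (l ` {1..N}) = l i" by blast
  have max: "l j \<le> l i" if "j \<in> {1..N}" for j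
    using that by (subst i(2)[symmetric]) (intro Max_ge, auto)
  have "quad N A c = (\<Sum>j=1..N. l j * (dot N c (b j))\<^sup>2)" by (rule quad_eigensystem[OF e sym])
  also have "\<dots> \<le> (\<Sum>j=1..N. l i * (dot N c (b j))\<^sup>2)"
    by (intro sum_mono mult_right_mono max) auto
  also have "\<dots> = l i" using dot_self_eigensystem[OF e, of c] c by (simp flip: sum_distrib_left)
  finally have "exp (quad N A c) \<le> exp (l i)" by simp
  also have "\<dots> \<le> (\<Sum>j=1..N. exp (l j))" using i by (intro member_le_sum) auto
  finally show ?thesis using trace_exp_eigensystem[OF e sym] by simp
qed

text \<open>The logarithmic mean of \<open>e\<^sup>x\<close> and \<open>e\<^sup>y\<close> is at most their arithmetic mean, multiplied by
  \<open>(x - y)\<^sup>2\<close> so that the order of \<open>x\<close> and \<open>y\<close> does not matter.\<close>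

lemma exp_difference_le_mean:
  fixes x y :: real
  shows "(exp x - exp y) * (x - y) \<le> (x - y)\<^sup>2 * ((exp x + exp y) / 2)"
proof -
  have key: "exp t - 1 \<le> t * (exp t + 1) / 2" if "t \<ge> 0" for t :: real
  proof -
    define f where "f = (\<lambda>t :: real. t * (exp t + 1) / 2 - exp t)"
    have "f 0 \<le> f t"
    proof (rule DERIV_nonneg_imp_nondecreasing[OF that])
      fix s :: real assume "0 \<le> s" "s \<le> t"
      have "(f has_real_derivative (1 - exp s * (1 - s)) / 2) (at s)"
        unfolding f_def by (auto intro!: derivative_eq_intros simp: field_simps)
      moreover have "exp s * (1 - s) \<le> exp s * exp (- s)"
        using exp_ge_add_one_self[of "- s"] by (intro mult_left_mono) auto
      ultimately show "\<exists>y. (f has_real_derivative y) (at s) \<and> 0 \<le> y"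
        by (intro exI[of _ "(1 - exp s * (1 - s)) / 2"]) (simp add: exp_minus)
    qed
    then show ?thesis by (simp add: f_def)
  qed
  have le: "(exp x - exp y) * (x - y) \<le> (x - y)\<^sup>2 * ((exp x + exp y) / 2)" if "y \<le> x" for x y :: real
  proof -
    have "exp y * (exp (x - y) - 1) \<le> exp y * ((x - y) * (exp (x - y) + 1) / 2)"
      using key[of "x - y"] that by (intro mult_left_mono) auto
    then have "exp x - exp y \<le> (x - y) * ((exp x + exp y) / 2)"
      by (simp add: algebra_simps flip: exp_add)
    then have "(exp x - exp y) * (x - y) \<le> (x - y) * ((exp x + exp y) / 2) * (x - y)"
      using that by (intro mult_right_mono) auto
    then show ?thesis by (simp add: power2_eq_square mult_ac)
  qed
  show ?thesis
  proof (cases "y \<le> x")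
    case False
    have "(exp x - exp y) * (x - y) = (exp y - exp x) * (y - x)" by (simp add: algebra_simps)
    also have "\<dots> \<le> (y - x)\<^sup>2 * ((exp y + exp x) / 2)" using False by (intro le) auto
    finally show ?thesis by (simp add: power2_commute add.commute)
  qed (rule le)
qed

context
  fixes N :: nat and A :: "nat \<Rightarrow> nat \<Rightarrow> real" and v :: "nat \<Rightarrow> real"
  assumes sym: "symmetric_matrix N A"
begin

text \<open>Pairing an eigenvector of \<open>A\<close> with one of \<open>A + h v v\<^sup>T\<close> turns the difference of the two matrices
  into a difference of eigenvalues. Finite differences of functions of the matrix thereby become
  double sums of scalar differences, without any differential calculus for matrices.\<close>

lemma rank_one_update_matrix_element:
  assumes "eigensystem N A l a" "eigensystem N (add_rank_one A h v) m b"
    and "i \<in> {1..N}" "j \<in> {1..N}"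
  shows "(m j - l i) * dot N (a i) (b j) = h * (dot N v (a i) * dot N v (b j))"
proof -
  have "mat_vec N (add_rank_one A h v) c k = mat_vec N A c k + (h * dot N v c) * v k" for c k
    by (simp add: mat_vec_def add_rank_one_def dot_def algebra_simps sum.distrib sum_distrib_left)
  then have update: "mat_vec N (add_rank_one A h v) (a i)
      = (\<lambda>k. mat_vec N A (a i) k + (h * dot N v (a i)) * v k)"
    by (simp add: fun_eq_iff)
  have "dot N (mat_vec N (add_rank_one A h v) (a i)) (b j)
      = dot N (mat_vec N A (a i)) (b j) + h * dot N v (a i) * dot N v (b j)"
    unfolding update by (simp add: dot_linear)
  moreover have "dot N (mat_vec N (add_rank_one A h v) (a i)) (b j) = m j * dot N (a i) (b j)"
    using assms sym by (intro dot_mat_vec_eigensystem) auto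
  moreover have "dot N (mat_vec N A (a i)) (b j) = l i * dot N (a i) (b j)"
  proof -
    have "dot N (mat_vec N A (a i)) (b j) = dot N (\<lambda>k. l i * a i k) (b j)"
      using assms by (intro dot_cong) (auto simp: eigensystem_def)
    then show ?thesis by (simp add: dot_linear)
  qed
  ultimately show ?thesis by (simp add: algebra_simps)
qed

text \<open>Klein's inequality for the convex function \<open>exp\<close>: the increment of the trace is at most its
  derivative at the updated matrix. In the mixed basis it reduces to the scalar bound
  \<open>e\<^sup>x - e\<^sup>y \<le> e\<^sup>x (x - y)\<close>.\<close>

lemma trace_exp_rank_one_le_derivative:
  "trace_exp N (add_rank_one A h v) \<le> trace_exp N A + h * exp_form N (add_rank_one A h v) v"
proof -
  let ?H = "add_rank_one A h v"
  obtain l a where a: "eigensystem N A l a" using spectral_theorem[OF sym] .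
  obtain m b where b: "eigensystem N ?H m b"
    using spectral_theorem[of N ?H] sym by auto
  define x where "x = (\<lambda>i j. dot N (a i) (b j))"
  have x1: "(\<Sum>i=1..N. (x i j)\<^sup>2) = 1" if "j \<in> {1..N}" for j
    using dot_self_eigensystem[OF a, of "b j"] eigenvector_unit[OF b that]
    by (simp add: x_def dot_commute)
  have x2: "(\<Sum>j=1..N. (x i j)\<^sup>2) = 1" if "i \<in> {1..N}" for i
    using dot_self_eigensystem[OF b, of "a i"] eigenvector_unit[OF a that]
    by (simp add: x_def)
  have vb: "(\<Sum>i=1..N. dot N v (a i) * x i j) = dot N v (b j)" for j
    using dot_orthonormal_expansion[of N a v "b j"] a
    by (simp add: x_def eigensystem_def dot_commute)
  \<comment> \<open>Rows and columns of the squared overlaps sum to one, so both traces become double sums.\<close>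
  have "(\<Sum>j=1..N. \<Sum>i=1..N. exp (m j) * (x i j)\<^sup>2) = (\<Sum>j=1..N. exp (m j))"
    using x1 by (simp flip: sum_distrib_left)
  moreover have "(\<Sum>j=1..N. \<Sum>i=1..N. exp (l i) * (x i j)\<^sup>2) = (\<Sum>i=1..N. exp (l i))"
    using x2 by (subst sum.swap) (simp flip: sum_distrib_left)
  ultimately have "trace_exp N ?H - trace_exp N A
      = (\<Sum>j=1..N. \<Sum>i=1..N. (exp (m j) - exp (l i)) * (x i j)\<^sup>2)"
    using trace_exp_eigensystem[OF a sym] trace_exp_eigensystem[OF b] sym
    by (simp add: left_diff_distrib sum_subtractf)
  also have "\<dots> \<le> (\<Sum>j=1..N. \<Sum>i=1..N. (exp (m j) * (m j - l i)) * (x i j)\<^sup>2)"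
  proof (intro sum_mono mult_right_mono)
    fix i j
    have "exp (m j) * (1 + (l i - m j)) \<le> exp (m j) * exp (l i - m j)"
      using exp_ge_add_one_self[of "l i - m j"] by (intro mult_left_mono) auto
    also have "\<dots> = exp (l i)" by (simp flip: exp_add)
    finally show "exp (m j) - exp (l i) \<le> exp (m j) * (m j - l i)" by (simp add: algebra_simps)
  qed auto
  also have "\<dots> = (\<Sum>j=1..N. \<Sum>i=1..N. h * exp (m j) * dot N v (b j) * (dot N v (a i) * x i j))"
  proof (intro sum.cong refl)
    fix i j assume ij: "j \<in> {1..N}" "i \<in> {1..N}"
    have "(exp (m j) * (m j - l i)) * (x i j)\<^sup>2 = exp (m j) * ((m j - l i) * x i j) * x i j"
      by (simp add: power2_eq_square)
    also have "(m j - l i) * x i j = h * (dot N v (a i) * dot N v (b j))"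
      unfolding x_def by (rule rank_one_update_matrix_element[OF a b ij(2,1)])
    finally show "(exp (m j) * (m j - l i)) * (x i j)\<^sup>2
        = h * exp (m j) * dot N v (b j) * (dot N v (a i) * x i j)" by (simp add: mult_ac)
  qed
  also have "\<dots> = (\<Sum>j=1..N. h * exp (m j) * dot N v (b j) * dot N v (b j))"
    by (simp only: vb flip: sum_distrib_left)
  also have "\<dots> = (\<Sum>j=1..N. h * (exp (m j) * (dot N v (b j))\<^sup>2))"
    by (simp add: power2_eq_square mult_ac)
  also have "\<dots> = h * exp_form N ?H v"
    using exp_form_eigensystem[OF b] sym by (simp add: sum_distrib_left)
  finally show ?thesis by simp
qed

text \<open>An implicit trapezoidal form of the differential inequality \<open>g' \<le> g\<close> for
  \<open>g(h) = v \<cdot> exp(A + h v v\<^sup>T) v\<close> and \<open>|v| \<le> 1\<close>. In the mixed basis \<open>h (g(h) - g(0))\<close> is the double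
  sum of \<open>(e\<^sup>x - e\<^sup>y) (x - y)\<close> against squared overlaps, to which the comparison of means applies.
  The extra factor \<open>h\<close> covers both signs of \<open>h\<close> at once.\<close>

lemma exp_form_rank_one_step:
  assumes v: "dot N v v \<le> 1"
  shows "h * exp_form N (add_rank_one A h v) v * (1 - h / 2) \<le> h * exp_form N A v * (1 + h / 2)"
proof -
  let ?H = "add_rank_one A h v"
  obtain l a where a: "eigensystem N A l a" using spectral_theorem[OF sym] .
  obtain m b where b: "eigensystem N ?H m b"
    using spectral_theorem[of N ?H] sym by auto
  define x where "x = (\<lambda>i j. dot N (a i) (b j))"
  define p where "p = (\<lambda>i. dot N v (a i))"
  define r where "r = (\<lambda>j. dot N v (b j))"
  have fA: "exp_form N A v = (\<Sum>i=1..N. exp (l i) * (p i)\<^sup>2)"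
    using exp_form_eigensystem[OF a sym] by (simp add: p_def)
  have fH: "exp_form N ?H v = (\<Sum>j=1..N. exp (m j) * (r j)\<^sup>2)"
    using exp_form_eigensystem[OF b] sym by (simp add: r_def)
  have vb: "(\<Sum>i=1..N. p i * x i j) = r j" for j
    using dot_orthonormal_expansion[of N a v "b j"] a
    by (simp add: x_def p_def r_def eigensystem_def dot_commute)
  have va: "(\<Sum>j=1..N. r j * x i j) = p i" for i
    using dot_orthonormal_expansion[of N b v "a i"] b
    by (simp add: x_def p_def r_def eigensystem_def)
  have p1: "(\<Sum>i=1..N. (p i)\<^sup>2) \<le> 1" and r1: "(\<Sum>j=1..N. (r j)\<^sup>2) \<le> 1"
    using dot_self_eigensystem[OF a, of v] dot_self_eigensystem[OF b, of v] v by (simp_all add: p_def r_def)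
  have el: "(m j - l i) * x i j = h * (p i * r j)" if "i \<in> {1..N}" "j \<in> {1..N}" for i j
    using rank_one_update_matrix_element[OF a b that] by (simp add: x_def p_def r_def)
  have "exp_form N ?H v = (\<Sum>j=1..N. \<Sum>i=1..N. exp (m j) * (p i * r j * x i j))"
  proof -
    have "exp_form N ?H v = (\<Sum>j=1..N. exp (m j) * r j * (\<Sum>i=1..N. p i * x i j))"
      unfolding fH vb by (simp add: power2_eq_square mult_ac)
    then show ?thesis by (simp add: sum_distrib_left mult_ac)
  qed
  moreover have "exp_form N A v = (\<Sum>i=1..N. exp (l i) * p i * (\<Sum>j=1..N. r j * x i j))"
    unfolding fA va by (simp add: power2_eq_square mult_ac)
  then have "exp_form N A v = (\<Sum>j=1..N. \<Sum>i=1..N. exp (l i) * (p i * r j * x i j))"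
    by (subst sum.swap) (simp add: sum_distrib_left mult_ac)
  ultimately have "h * (exp_form N ?H v - exp_form N A v)
      = (\<Sum>j=1..N. \<Sum>i=1..N. (exp (m j) - exp (l i)) * x i j * (h * (p i * r j)))"
    by (simp add: sum_distrib_left algebra_simps sum_subtractf)
  also have "\<dots> = (\<Sum>j=1..N. \<Sum>i=1..N. ((exp (m j) - exp (l i)) * (m j - l i)) * (x i j)\<^sup>2)"
    by (intro sum.cong refl) (simp add: el[symmetric] power2_eq_square mult_ac)
  also have "\<dots> \<le> (\<Sum>j=1..N. \<Sum>i=1..N. ((m j - l i)\<^sup>2 * ((exp (m j) + exp (l i)) / 2)) * (x i j)\<^sup>2)"
    by (intro sum_mono mult_right_mono exp_difference_le_mean) auto
  also have "\<dots> = (\<Sum>j=1..N. \<Sum>i=1..N. ((exp (m j) + exp (l i)) / 2) * ((m j - l i) * x i j)\<^sup>2)"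
    by (simp add: power_mult_distrib mult_ac)
  also have "\<dots> = (\<Sum>j=1..N. \<Sum>i=1..N. ((exp (m j) + exp (l i)) / 2) * (h * (p i * r j))\<^sup>2)"
    using el by (intro sum.cong refl) simp
  also have "\<dots> = (\<Sum>j=1..N. \<Sum>i=1..N. h\<^sup>2 / 2 * (exp (m j) * (r j)\<^sup>2) * (p i)\<^sup>2)
      + (\<Sum>j=1..N. \<Sum>i=1..N. h\<^sup>2 / 2 * (exp (l i) * (p i)\<^sup>2) * (r j)\<^sup>2)"
    by (simp add: sum.distrib[symmetric] power_mult_distrib field_simps)
  also have "(\<Sum>j=1..N. \<Sum>i=1..N. h\<^sup>2 / 2 * (exp (m j) * (r j)\<^sup>2) * (p i)\<^sup>2)
      = h\<^sup>2 / 2 * exp_form N ?H v * (\<Sum>i=1..N. (p i)\<^sup>2)"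
    unfolding fH by (subst sum.swap) (simp add: sum_distrib_left sum_distrib_right)
  also have "(\<Sum>j=1..N. \<Sum>i=1..N. h\<^sup>2 / 2 * (exp (l i) * (p i)\<^sup>2) * (r j)\<^sup>2)
      = h\<^sup>2 / 2 * exp_form N A v * (\<Sum>j=1..N. (r j)\<^sup>2)"
    unfolding fA by (simp add: sum_distrib_left sum_distrib_right)
  also have "h\<^sup>2 / 2 * exp_form N ?H v * (\<Sum>i=1..N. (p i)\<^sup>2) + h\<^sup>2 / 2 * exp_form N A v * (\<Sum>j=1..N. (r j)\<^sup>2)
      \<le> h\<^sup>2 / 2 * exp_form N ?H v * 1 + h\<^sup>2 / 2 * exp_form N A v * 1"
    using sym by (intro add_mono mult_left_mono p1 r1 mult_nonneg_nonneg exp_form_nonneg) auto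
  finally show ?thesis by (simp add: algebra_simps power2_eq_square)
qed

end

lemma add_rank_one_add: "add_rank_one (add_rank_one A s v) t v = add_rank_one A (s + t) v"
  by (simp add: add_rank_one_def algebra_simps)

text \<open>Iterating the one-step inequalities; the geometric sum is exact because
  \<open>(1 + h/2) (r - 1) = h r\<close>.\<close>

lemma trace_exp_rank_one_steps:
  fixes h :: real
  assumes sym: "symmetric_matrix N A" and v: "dot N v v \<le> 1" and h: "\<bar>h\<bar> < 2"
  defines "r \<equiv> (1 + h / 2) / (1 - h / 2)"
  shows "trace_exp N (add_rank_one A (real k * h) v) \<le> trace_exp N A + (1 + h / 2) * (r ^ k - 1) * exp_form N A v"
proof -
  define g where "g = (\<lambda>k. exp_form N (add_rank_one A (real k * h) v) v)"
  have g0: "g 0 = exp_form N A v" by (simp add: g_def add_rank_one_def)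
  have r0: "r > 0" using h by (simp add: r_def)
  have h1: "1 - h / 2 > 0" using h by auto
  have step: "add_rank_one (add_rank_one A (real k * h) v) h v = add_rank_one A (real (Suc k) * h) v" for k
    by (simp add: add_rank_one_add algebra_simps)
  have gk: "h * g k \<le> h * (r ^ k * g 0)" for k
  proof (induction k)
    case (Suc k)
    have "h * g (Suc k) * (1 - h / 2) \<le> h * g k * (1 + h / 2)"
      using exp_form_rank_one_step[OF symmetric_add_rank_one[OF sym, of "real k * h" v] v, of h]
      by (simp only: step g_def)
    then have "h * g (Suc k) \<le> r * (h * g k)"
      using h1 by (simp add: r_def field_simps)
    also have "\<dots> \<le> r * (h * (r ^ k * g 0))"
      by (rule mult_left_mono[OF Suc less_imp_le[OF r0]])
    finally show ?case by (simp add: mult_ac)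
  qed simp
  have hr: "(1 + h / 2) * (r - 1) = h * r"
    using h1 by (simp add: r_def field_simps)
  show "trace_exp N (add_rank_one A (real k * h) v) \<le> trace_exp N A + (1 + h / 2) * (r ^ k - 1) * exp_form N A v"
  proof (induction k)
    case 0
    show ?case by (simp add: add_rank_one_def)
  next
    case (Suc k)
    have "trace_exp N (add_rank_one A (real (Suc k) * h) v)
        \<le> trace_exp N (add_rank_one A (real k * h) v) + h * g (Suc k)"
      using trace_exp_rank_one_le_derivative[OF symmetric_add_rank_one[OF sym, of "real k * h" v], of h v]
      by (simp only: step g_def)
    also have "\<dots> \<le> trace_exp N A + (1 + h / 2) * (r ^ k - 1) * g 0 + h * (r ^ Suc k * g 0)"
      using Suc gk[of "Suc k"] g0 by simp
    also have "h * (r ^ Suc k * g 0) = (h * r) * r ^ k * g 0" by simp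
    also have "\<dots> = (1 + h / 2) * (r - 1) * r ^ k * g 0" by (simp only: hr)
    finally have "trace_exp N (add_rank_one A (real (Suc k) * h) v)
        \<le> trace_exp N A + (1 + h / 2) * (r ^ k - 1) * g 0 + (1 + h / 2) * (r - 1) * r ^ k * g 0"
      by simp
    moreover have "x * (r ^ k - 1) * y + x * (r - 1) * r ^ k * y = x * (r ^ Suc k - 1) * y" for x y
      by (simp add: algebra_simps)
    ultimately show ?case by (simp add: g0 add.assoc)
  qed
qed

text \<open>For unit \<open>v\<close> the right-hand side is the trace of \<open>e\<^sup>A exp(\<theta> v v\<^sup>T)\<close>, so this is the Golden-Thompson
  inequality for a rank-one summand. It is the limit of \<open>n\<close> steps of size \<open>\<theta>/n\<close>, since
  \<open>((1 + \<theta>/2n) / (1 - \<theta>/2n))\<^sup>n\<close> tends to \<open>e\<^sup>\<theta>\<close>.\<close>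

theorem rank_one_Golden_Thompson:
  fixes \<theta> :: real
  assumes sym: "symmetric_matrix N A" and v: "dot N v v \<le> 1"
  shows "trace_exp N (add_rank_one A \<theta> v) \<le> trace_exp N A + (exp \<theta> - 1) * exp_form N A v"
proof -
  define F where "F = (\<lambda>n :: nat. (1 + \<theta> / real n / 2) * (((1 + \<theta> / real n / 2) / (1 - \<theta> / real n / 2)) ^ n - 1))"
  have lim1: "(\<lambda>n. (1 + (\<theta> / 2) / real n) ^ n / (1 + (- \<theta> / 2) / real n) ^ n) \<longlonglongrightarrow> exp (\<theta> / 2) / exp (- \<theta> / 2)"
    by (intro tendsto_divide tendsto_exp_limit_sequentially) auto
  have lim2: "(\<lambda>n. 1 + \<theta> / real n / 2) \<longlonglongrightarrow> 1 + 0 / 2"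
    by (intro tendsto_intros lim_const_over_n) auto
  have "(\<lambda>n. (1 + \<theta> / real n / 2) * ((1 + (\<theta> / 2) / real n) ^ n / (1 + (- \<theta> / 2) / real n) ^ n - 1))
      \<longlonglongrightarrow> (1 + 0 / 2) * (exp (\<theta> / 2) / exp (- \<theta> / 2) - 1)"
    by (intro tendsto_mult lim2 tendsto_diff lim1 tendsto_const)
  moreover have "exp (\<theta> / 2) / exp (- \<theta> / 2) = exp \<theta>"
    by (simp flip: exp_diff)
  moreover have "(\<lambda>n. (1 + \<theta> / real n / 2) * ((1 + (\<theta> / 2) / real n) ^ n / (1 + (- \<theta> / 2) / real n) ^ n - 1)) = F"
    by (simp add: F_def power_divide mult.commute fun_eq_iff)
  ultimately have "F \<longlonglongrightarrow> exp \<theta> - 1" by simp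
  then have "(\<lambda>n. trace_exp N A + F n * exp_form N A v) \<longlonglongrightarrow> trace_exp N A + (exp \<theta> - 1) * exp_form N A v"
    by (intro tendsto_intros)
  moreover have "eventually (\<lambda>n. trace_exp N (add_rank_one A \<theta> v) \<le> trace_exp N A + F n * exp_form N A v) sequentially"
  proof (rule eventually_sequentiallyI[of "nat \<lceil>\<bar>\<theta>\<bar>\<rceil> + 1"])
    fix n assume "nat \<lceil>\<bar>\<theta>\<bar>\<rceil> + 1 \<le> n"
    then have n: "real n \<ge> \<bar>\<theta>\<bar> + 1" "n > 0" by linarith+
    have "\<bar>\<theta> / real n\<bar> < 2" using n by (simp add: field_simps)
    then show "trace_exp N (add_rank_one A \<theta> v) \<le> trace_exp N A + F n * exp_form N A v"
      using trace_exp_rank_one_steps[OF sym v, of "\<theta> / real n" n] n by (simp add: F_def)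
  qed
  ultimately show ?thesis
    by (intro tendsto_lowerbound) auto
qed

section \<open>Spectral norm and semidefiniteness\<close>

definition psd :: "nat \<Rightarrow> (nat \<Rightarrow> nat \<Rightarrow> real) \<Rightarrow> bool" where
  "psd N S \<longleftrightarrow> (\<forall>c. 0 \<le> quad N S c)"

lemma quad_add: "quad N (\<lambda>j k. A j k + C j k) c = quad N A c + quad N C c"
  by (simp add: quad_eq_sum algebra_simps sum.distrib)

lemma quad_diff: "quad N (\<lambda>j k. A j k - C j k) c = quad N A c - quad N C c"
  by (simp add: quad_eq_sum algebra_simps sum_subtractf)

lemma quad_smult: "quad N (\<lambda>j k. r * A j k) c = r * quad N A c"
  by (simp add: quad_eq_sum sum_distrib_left mult_ac)

lemma quad_identity: "quad N identity_matrix c = dot N c c"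
  by (simp add: quad_eq_sum dot_def identity_matrix_def if_distrib[of "\<lambda>x. x * _"] cong: if_cong)

lemma quad_rank_one: "quad N (\<lambda>j k. v j * v k) c = (dot N v c)\<^sup>2"
  by (simp add: quad_eq_sum dot_def power2_eq_square sum_product mult_ac)

lemmas quad_linear = quad_add quad_diff quad_smult quad_identity quad_rank_one

text \<open>For symmetric matrices the operator norm is the largest modulus of an eigenvalue, which is also
  what the quadratic form on unit vectors detects. The eigenvalues also show that the supremum in
  the definition of the norm is finite.\<close>

lemma spectral_norm_le_iff:
  assumes sym: "symmetric_matrix N A" and r: "0 \<le> r"
  shows "spectral_norm N A \<le> r \<longleftrightarrow> (\<forall>c. \<bar>quad N A c\<bar> \<le> r * dot N c c)"
proof -
  obtain l b where e: "eigensystem N A l b" using spectral_theorem[OF sym] .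
  have norm_le: "L2_set (mat_vec N A c) {1..N} \<le> s"
    if s: "s \<ge> 0" "\<And>i. i \<in> {1..N} \<Longrightarrow> \<bar>l i\<bar> \<le> s" and c: "L2_set c {1..N} \<le> 1" for s c
  proof -
    have "dot N (mat_vec N A c) (mat_vec N A c) = (\<Sum>i=1..N. (l i)\<^sup>2 * (dot N c (b i))\<^sup>2)"
      by (rule dot_mat_vec_self_eigensystem[OF e sym])
    also have "\<dots> \<le> (\<Sum>i=1..N. s\<^sup>2 * (dot N c (b i))\<^sup>2)"
    proof (intro sum_mono mult_right_mono)
      fix i assume "i \<in> {1..N}"
      then show "(l i)\<^sup>2 \<le> s\<^sup>2" using s by (simp add: abs_le_square_iff[symmetric])
    qed auto
    also have "\<dots> = s\<^sup>2 * dot N c c" using dot_self_eigensystem[OF e] by (simp flip: sum_distrib_left)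
    also have "\<dots> \<le> s\<^sup>2 * 1"
      using c unfolding dot_self_eq_L2_set by (intro mult_left_mono power_le_one) (auto simp: L2_set_nonneg)
    finally have "(L2_set (mat_vec N A c) {1..N})\<^sup>2 \<le> s\<^sup>2" by (simp add: dot_self_eq_L2_set)
    then show ?thesis using s(1) by (rule power2_le_imp_le)
  qed
  have spectral: "spectral_norm N A = (SUP c\<in>{c. L2_set c {1..N} \<le> 1}. L2_set (mat_vec N A c) {1..N})"
    by (simp add: spectral_norm_def mat_vec_def[abs_def])
  have bdd: "bdd_above ((\<lambda>c. L2_set (mat_vec N A c) {1..N}) ` {c. L2_set c {1..N} \<le> 1})"
  proof (rule bdd_aboveI2)
    fix c assume "c \<in> {c. L2_set c {1..N} \<le> 1}"
    then show "L2_set (mat_vec N A c) {1..N} \<le> (\<Sum>i=1..N. \<bar>l i\<bar>)"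
      by (intro norm_le) (auto intro: member_le_sum sum_nonneg)
  qed
  show ?thesis
  proof safe
    fix c assume le: "spectral_norm N A \<le> r"
    have l: "\<bar>l i\<bar> \<le> r" if i: "i \<in> {1..N}" for i
    proof -
      have b1: "L2_set (b i) {1..N} = 1"
        using eigenvector_unit[OF e i] by (simp add: L2_set_def dot_def power2_eq_square)
      have "L2_set (mat_vec N A (b i)) {1..N} \<le> spectral_norm N A"
        unfolding spectral using bdd b1 by (intro cSUP_upper) auto
      also have "L2_set (mat_vec N A (b i)) {1..N} = L2_set (\<lambda>k. l i * b i k) {1..N}"
        using e i by (intro L2_set_cong) (auto simp: eigensystem_def)
      also have "\<dots> = \<bar>l i\<bar>"
        using b1 by (simp add: L2_set_def power_mult_distrib real_sqrt_mult flip: sum_distrib_left)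
      finally show ?thesis using le by simp
    qed
    have "\<bar>quad N A c\<bar> \<le> (\<Sum>i=1..N. \<bar>l i\<bar> * (dot N c (b i))\<^sup>2)"
      unfolding quad_eigensystem[OF e sym] by (rule order_trans[OF sum_abs]) (simp add: abs_mult)
    also have "\<dots> \<le> (\<Sum>i=1..N. r * (dot N c (b i))\<^sup>2)"
      using l by (intro sum_mono mult_right_mono) auto
    also have "\<dots> = r * dot N c c" using dot_self_eigensystem[OF e] by (simp flip: sum_distrib_left)
    finally show "\<bar>quad N A c\<bar> \<le> r * dot N c c" .
  next
    assume le: "\<forall>c. \<bar>quad N A c\<bar> \<le> r * dot N c c"
    have "\<bar>l i\<bar> \<le> r" if "i \<in> {1..N}" for i
      using le[rule_format, of "b i"] quad_eigenvector[OF e that] eigenvector_unit[OF e that] by simp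
    moreover have "(\<lambda>_. 0) \<in> {c. L2_set c {1..N} \<le> 1}" by (simp add: L2_set_def)
    ultimately show "spectral_norm N A \<le> r"
      unfolding spectral using norm_le r by (intro cSUP_least) auto
  qed
qed

abbreviation near_identity :: "nat \<Rightarrow> (nat \<Rightarrow> nat \<Rightarrow> real) \<Rightarrow> bool" where
  "near_identity N A \<equiv> spectral_norm N (\<lambda>j k. A j k - identity_matrix j k) \<le> 1/2"

text \<open>Quadratic forms are continuous, so countably many test vectors suffice. All events and weights
  of the algorithm are expressed through semidefiniteness, and this makes them measurable.\<close>

lemma psd_iff_rational_vectors:
  "psd N S \<longleftrightarrow> (\<forall>c\<in>PiE {1..N} (\<lambda>_. \<rat>). 0 \<le> quad N S c)"
proof
  assume *: "\<forall>c\<in>PiE {1..N} (\<lambda>_. \<rat>). 0 \<le> quad N S c"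
  show "psd N S"
    unfolding psd_def
  proof
    fix c
    define f :: "nat \<Rightarrow> nat \<Rightarrow> real" where "f = (\<lambda>n k. real_of_int \<lfloor>real (Suc n) * c k\<rfloor> / real (Suc n))"
    have lim: "(\<lambda>n. f n k) \<longlonglongrightarrow> c k" for k
    proof -
      have "\<bar>f n k - c k\<bar> \<le> inverse (real (Suc n))" for n
      proof -
        have "\<bar>real_of_int \<lfloor>real (Suc n) * c k\<rfloor> - real (Suc n) * c k\<bar> \<le> 1" by linarith
        moreover have "f n k - c k = (real_of_int \<lfloor>real (Suc n) * c k\<rfloor> - real (Suc n) * c k) / real (Suc n)"
          by (simp add: f_def diff_divide_distrib)
        ultimately have "\<bar>f n k - c k\<bar> \<le> 1 / real (Suc n)"
          by (simp only: abs_divide) (simp add: divide_right_mono)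
        then show ?thesis by (simp add: divide_inverse)
      qed
      then have "(\<lambda>n. f n k - c k) \<longlonglongrightarrow> 0"
        by (intro Lim_null_comparison[OF _ LIMSEQ_inverse_real_of_nat]) auto
      then show ?thesis by (simp add: LIM_zero_iff)
    qed
    have "0 \<le> quad N S (restrict (f n) {1..N})" for n
      using * by (intro bspec[OF *]) (auto simp: f_def)
    moreover have "quad N S (restrict (f n) {1..N}) = quad N S (f n)" for n
      by (rule quad_cong) simp
    ultimately have "0 \<le> quad N S (f n)" for n
      by metis
    moreover have "(\<lambda>n. quad N S (f n)) \<longlonglongrightarrow> quad N S c"
      unfolding quad_eq_sum by (intro tendsto_intros lim)
    ultimately show "0 \<le> quad N S c" by (intro LIMSEQ_le_const) auto
  qed
qed (simp add: psd_def)

lemma sets_Collect_psd: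
  assumes "\<And>j k. j \<in> {1..N} \<Longrightarrow> k \<in> {1..N} \<Longrightarrow> (\<lambda>x. S x j k) \<in> borel_measurable M"
  shows "{x \<in> space M. psd N (S x)} \<in> sets M"
proof -
  have "countable (PiE {1..N} (\<lambda>_. \<rat> :: real set))"
    by (intro countable_PiE countable_rat) auto
  moreover have "(\<lambda>x. quad N (S x) c) \<in> borel_measurable M" for c
    unfolding quad_eq_sum using assms by measurable
  ultimately show ?thesis
    unfolding psd_iff_rational_vectors by (intro sets.sets_Collect_countable_All') measurable
qed

lemma spectral_norm_le_iff_psd:
  assumes "symmetric_matrix N A" "0 \<le> r"
  shows "spectral_norm N A \<le> r \<longleftrightarrow>
    psd N (\<lambda>j k. r * identity_matrix j k - A j k) \<and> psd N (\<lambda>j k. r * identity_matrix j k + A j k)"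
proof -
  have "\<bar>quad N A c\<bar> \<le> r * dot N c c \<longleftrightarrow>
      0 \<le> r * dot N c c - quad N A c \<and> 0 \<le> r * dot N c c + quad N A c" for c
    by linarith
  then show ?thesis
    unfolding spectral_norm_le_iff[OF assms] psd_def quad_linear by blast
qed

lemma sets_Collect_spectral_norm_le:
  assumes "\<And>j k. j \<in> {1..N} \<Longrightarrow> k \<in> {1..N} \<Longrightarrow> (\<lambda>x. S x j k) \<in> borel_measurable T"
    and "\<And>x. symmetric_matrix N (S x)" and "0 \<le> r"
  shows "{x \<in> space T. spectral_norm N (\<lambda>j k. S x j k - identity_matrix j k) \<le> r} \<in> sets T"
proof -
  have "symmetric_matrix N (\<lambda>j k. S x j k - identity_matrix j k)" for x
    using assms(2)[of x] by (simp add: symmetric_matrix_def identity_matrix_def)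
  then have *: "spectral_norm N (\<lambda>j k. S x j k - identity_matrix j k) \<le> r \<longleftrightarrow>
      psd N (\<lambda>j k. r * identity_matrix j k - (S x j k - identity_matrix j k)) \<and>
      psd N (\<lambda>j k. r * identity_matrix j k + (S x j k - identity_matrix j k))" for x
    by (rule spectral_norm_le_iff_psd) (rule assms)
  show ?thesis
    unfolding *
    by (intro sets.sets_Collect_conj sets_Collect_psd borel_measurable_diff borel_measurable_add
        borel_measurable_const assms)
qed

text \<open>Positive definiteness is a strict condition at uncountably many vectors; a lower bound on the
  smallest eigenvalue turns it into a countable union of semidefiniteness conditions.\<close>

lemma positive_definite_iff_psd:
  assumes "symmetric_matrix N A"
  shows "(\<forall>c. quad N A c \<le> 0 \<longrightarrow> (\<forall>k\<in>{1..N}. c k = 0)) \<longleftrightarrow>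
     (\<exists>i :: nat. psd N (\<lambda>j k. A j k - inverse (real (Suc i)) * identity_matrix j k))"
proof
  assume pd: "\<forall>c. quad N A c \<le> 0 \<longrightarrow> (\<forall>k\<in>{1..N}. c k = 0)"
  obtain l b where e: "eigensystem N A l b" using spectral_theorem[OF assms] .
  have pos: "l i > 0" if i: "i \<in> {1..N}" for i
  proof (rule ccontr)
    assume "\<not> l i > 0"
    then have "quad N A (b i) \<le> 0" using quad_eigenvector[OF e i] by simp
    then have "dot N (b i) (b i) = 0" using pd by (simp add: dot_self_eq_0)
    then show False using eigenvector_unit[OF e i] by simp
  qed
  define d where "d = Min (insert 1 (l ` {1..N}))"
  have "finite (insert 1 (l ` {1..N}))" by simp
  then have d: "d > 0" "\<And>i. i \<in> {1..N} \<Longrightarrow> d \<le> l i"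
    unfolding d_def using pos by (auto simp del: Min_insert intro: Min_le)
  obtain i where i: "inverse (real (Suc i)) < d" using reals_Archimedean[OF d(1)] by auto
  have "inverse (real (Suc i)) * dot N c c \<le> quad N A c" for c
  proof -
    have "inverse (real (Suc i)) * dot N c c = (\<Sum>j=1..N. inverse (real (Suc i)) * (dot N c (b j))\<^sup>2)"
      using dot_self_eigensystem[OF e] by (simp add: sum_distrib_left)
    also have "\<dots> \<le> (\<Sum>j=1..N. l j * (dot N c (b j))\<^sup>2)"
      using d(2) i by (intro sum_mono mult_right_mono) (auto intro: order_trans less_imp_le)
    finally show ?thesis using quad_eigensystem[OF e assms] by simp
  qed
  then show "\<exists>i :: nat. psd N (\<lambda>j k. A j k - inverse (real (Suc i)) * identity_matrix j k)"
    unfolding psd_def quad_linear by auto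
next
  assume "\<exists>i :: nat. psd N (\<lambda>j k. A j k - inverse (real (Suc i)) * identity_matrix j k)"
  then obtain i :: nat where i: "\<And>c. inverse (real (Suc i)) * dot N c c \<le> quad N A c"
    unfolding psd_def quad_linear by auto
  show "\<forall>c. quad N A c \<le> 0 \<longrightarrow> (\<forall>k\<in>{1..N}. c k = 0)"
  proof (intro allI impI)
    fix c assume "quad N A c \<le> 0"
    then have "inverse (real (Suc i)) * dot N c c \<le> 0" using i order_trans by blast
    then have "dot N c c = 0"
      using dot_self_nonneg[of N c] by (simp add: mult_le_0_iff del: of_nat_Suc)
    then show "\<forall>k\<in>{1..N}. c k = 0" by (simp add: dot_self_eq_0)
  qed
qed

section \<open>Concentration of empirical Gram matrices\<close>

text \<open>This makes the exponent of the lower tail below at least as good as that of the upper tail.\<close>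

lemma ln_three_halves_le: "ln (3/2 :: real) \<le> 5/12"
proof -
  have "(3/2 :: real) \<le> 1 + 5/12 + (5/12)\<^sup>2 / 2" by (simp add: power2_eq_square)
  also have "\<dots> \<le> exp (5/12)" by (rule exp_lower_Taylor_quadratic) simp
  finally have "ln (3/2 :: real) \<le> ln (exp (5/12))" by (subst ln_le_cancel_iff) auto
  then show ?thesis by simp
qed

lemma gamma_const_pos: "gamma_const > 0"
proof -
  have "ln (2/3 :: real) < 2/3 - 1"
    using ln_le_minus_one[of "2/3 :: real"] ln_eq_minus_one[of "2/3 :: real"] by fastforce
  moreover have "ln (2/3 :: real) = - ln (3/2)" by (simp add: ln_div)
  ultimately show ?thesis by (simp add: gamma_const_def)
qed

lemma borel_measurable_trace_exp:
  assumes "\<And>j k. j \<in> {1..N} \<Longrightarrow> k \<in> {1..N} \<Longrightarrow> (\<lambda>x. S x j k) \<in> borel_measurable M"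
  shows "(\<lambda>x. trace_exp N (S x)) \<in> borel_measurable M"
proof -
  have "(\<lambda>x. (mat_vec N (S x) ^^ k) v j) \<in> borel_measurable M" if "j \<in> {1..N}" for v j k
    using that
  proof (induction k arbitrary: j)
    case (Suc k)
    have "(\<lambda>x. \<Sum>i=1..N. S x j i * (mat_vec N (S x) ^^ k) v i) \<in> borel_measurable M"
      using Suc assms by (intro borel_measurable_sum borel_measurable_times) auto
    moreover have "(mat_vec N (S x) ^^ Suc k) v j = (\<Sum>i=1..N. S x j i * (mat_vec N (S x) ^^ k) v i)" for x
      unfolding funpow.simps o_apply by (rule mat_vec_def)
    ultimately show ?case by simp
  qed simp
  then show ?thesis
    unfolding trace_exp_def exp_form_def dot_def
    by (intro borel_measurable_sum borel_measurable_suminf borel_measurable_times borel_measurable_divide)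
      auto
qed

context prob_space
begin

lemma product_sigma_finite_const: "product_sigma_finite (\<lambda>_ :: nat. M)"
  by (simp add: product_sigma_finite_def sigma_finite_measure_axioms)

lemma nn_integral_iid_insert:
  assumes "f \<in> borel_measurable (\<Pi>\<^sub>M i\<in>{1..Suc m}. M)"
  shows "(\<integral>\<^sup>+x. f x \<partial>(\<Pi>\<^sub>M i\<in>{1..Suc m}. M)) = (\<integral>\<^sup>+x. \<integral>\<^sup>+y. f (x(Suc m := y)) \<partial>M \<partial>(\<Pi>\<^sub>M i\<in>{1..m}. M))"
  using product_sigma_finite.product_nn_integral_insert[OF product_sigma_finite_const,
      of "{1..m}" "Suc m" f] assms
  by (simp add: atLeastAtMostSuc_conv)

text \<open>Centred independent variables have no mixed second moments.\<close>

lemma nn_integral_square_iid_sum: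
  fixes Y :: "'a \<Rightarrow> real"
  assumes [measurable]: "Y \<in> borel_measurable M" and Y2: "integrable M (\<lambda>y. (Y y)\<^sup>2)" and Y0: "(\<integral>y. Y y \<partial>M) = 0"
  shows "(\<integral>\<^sup>+x. ennreal ((\<Sum>i=1..m. Y (x i))\<^sup>2) \<partial>(\<Pi>\<^sub>M i\<in>{1..m}. M)) = ennreal (real m * (\<integral>y. (Y y)\<^sup>2 \<partial>M))"
proof (induction m)
  case 0
  show ?case by simp
next
  case (Suc m)
  have Y1: "integrable M Y" by (rule square_integrable_imp_integrable) (use Y2 in auto)
  have P: "prob_space (\<Pi>\<^sub>M i\<in>{1..m}. M)" by (intro prob_space_PiM) (rule prob_space_axioms)
  have eq: "(\<integral>\<^sup>+y. ennreal ((s + Y y)\<^sup>2) \<partial>M) = ennreal (s\<^sup>2) + ennreal (\<integral>y. (Y y)\<^sup>2 \<partial>M)" for s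
  proof -
    have expand: "(\<lambda>y. (s + Y y)\<^sup>2) = (\<lambda>y. s\<^sup>2 + 2 * s * Y y + (Y y)\<^sup>2)"
      by (simp add: fun_eq_iff power2_eq_square algebra_simps)
    have int: "integrable M (\<lambda>y. (s + Y y)\<^sup>2)"
      unfolding expand using Y1 Y2 by (intro Bochner_Integration.integrable_add integrable_mult_right) auto
    have "(\<integral>\<^sup>+y. ennreal ((s + Y y)\<^sup>2) \<partial>M) = ennreal (\<integral>y. (s + Y y)\<^sup>2 \<partial>M)"
      by (intro nn_integral_eq_integral int) auto
    also have "(\<integral>y. (s + Y y)\<^sup>2 \<partial>M) = s\<^sup>2 + (\<integral>y. (Y y)\<^sup>2 \<partial>M)"
      unfolding expand using Y1 Y2 Y0 by (simp add: prob_space)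
    finally show ?thesis by (simp add: ennreal_plus)
  qed
  have "(\<integral>\<^sup>+x. ennreal ((\<Sum>i=1..Suc m. Y (x i))\<^sup>2) \<partial>(\<Pi>\<^sub>M i\<in>{1..Suc m}. M))
      = (\<integral>\<^sup>+x. \<integral>\<^sup>+y. ennreal ((\<Sum>i=1..Suc m. Y ((x(Suc m := y)) i))\<^sup>2) \<partial>M \<partial>(\<Pi>\<^sub>M i\<in>{1..m}. M))"
    by (rule nn_integral_iid_insert) measurable
  also have "\<dots> = (\<integral>\<^sup>+x. \<integral>\<^sup>+y. ennreal (((\<Sum>i=1..m. Y (x i)) + Y y)\<^sup>2) \<partial>M \<partial>(\<Pi>\<^sub>M i\<in>{1..m}. M))"
    by simp
  also have "\<dots> = (\<integral>\<^sup>+x. ennreal ((\<Sum>i=1..m. Y (x i))\<^sup>2) + ennreal (\<integral>y. (Y y)\<^sup>2 \<partial>M) \<partial>(\<Pi>\<^sub>M i\<in>{1..m}. M))"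
    by (simp only: eq)
  also have "\<dots> = ennreal (real m * (\<integral>y. (Y y)\<^sup>2 \<partial>M)) + ennreal (\<integral>y. (Y y)\<^sup>2 \<partial>M)"
    by (subst nn_integral_add) (auto simp: Suc prob_space.emeasure_space_1[OF P] simp del: One_nat_def)
  also have "\<dots> = ennreal (real (Suc m) * (\<integral>y. (Y y)\<^sup>2 \<partial>M))"
    by (simp add: algebra_simps flip: ennreal_plus)
  finally show ?case .
qed

context
  fixes f :: "'a \<Rightarrow> nat \<Rightarrow> real" and N :: nat and K :: real
  assumes meas: "\<And>j. j \<in> {1..N} \<Longrightarrow> (\<lambda>y. f y j) \<in> borel_measurable M"
    and bound: "\<And>y. y \<in> space M \<Longrightarrow> dot N (f y) (f y) \<le> K"
    and K: "K > 0"
    and isotropic: "\<And>j k. j \<in> {1..N} \<Longrightarrow> k \<in> {1..N} \<Longrightarrow> (\<integral>y. f y j * f y k \<partial>M) = identity_matrix j k"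
begin

text \<open>The normalization by \<open>K\<close> makes each summand \<open>\<theta>\<close> times \<open>v v\<^sup>T\<close> with \<open>|v| \<le> 1\<close>.\<close>

definition exponent :: "real \<Rightarrow> nat \<Rightarrow> (nat \<Rightarrow> 'a) \<Rightarrow> nat \<Rightarrow> nat \<Rightarrow> real" where
  "exponent \<theta> m x = (\<lambda>j k. \<Sum>i=1..m. \<theta> / K * (f (x i) j * f (x i) k))"

lemma symmetric_exponent: "symmetric_matrix N (exponent \<theta> m x)"
  by (simp add: symmetric_matrix_def exponent_def mult.commute)

lemma borel_measurable_trace_exp_exponent:
  "(\<lambda>x. trace_exp N (exponent \<theta> m x)) \<in> borel_measurable (\<Pi>\<^sub>M i\<in>{1..m}. M)"
proof (rule borel_measurable_trace_exp)
  fix j k assume "j \<in> {1..N}" "k \<in> {1..N}"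
  note [measurable] = this[THEN meas]
  show "(\<lambda>x. exponent \<theta> m x j k) \<in> borel_measurable (\<Pi>\<^sub>M i\<in>{1..m}. M)"
    unfolding exponent_def by measurable
qed

lemma integrable_coordinate_product:
  assumes "j \<in> {1..N}" "k \<in> {1..N}"
  shows "integrable M (\<lambda>y. f y j * f y k)"
proof -
  note [measurable] = meas[OF assms(1)] meas[OF assms(2)]
  have sq: "(f y i)\<^sup>2 \<le> K" if "i \<in> {1..N}" "y \<in> space M" for i y
  proof -
    have "(f y i)\<^sup>2 \<le> (\<Sum>i=1..N. (f y i)\<^sup>2)" by (rule member_le_sum[OF that(1)]) auto
    then show ?thesis using bound[OF that(2)] by (simp add: dot_def power2_eq_square)
  qed
  show ?thesis
  proof (rule integrable_const_bound)
    show "AE y in M. norm (f y j * f y k) \<le> K"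
    proof (rule AE_I2)
      fix y assume y: "y \<in> space M"
      have "\<bar>f y j * f y k\<bar> \<le> ((f y j)\<^sup>2 + (f y k)\<^sup>2) / 2"
        using zero_le_power2[of "\<bar>f y j\<bar> - \<bar>f y k\<bar>"] by (simp add: power2_diff abs_mult)
      also have "\<dots> \<le> K" using sq[OF assms(1) y] sq[OF assms(2) y] by simp
      finally show "norm (f y j * f y k) \<le> K" by simp
    qed
  qed simp
qed

lemma expectation_dot_square:
  shows "integrable M (\<lambda>y. (dot N (f y) c)\<^sup>2)" and "(\<integral>y. (dot N (f y) c)\<^sup>2 \<partial>M) = dot N c c"
proof -
  have eq: "(dot N (f y) c)\<^sup>2 = (\<Sum>j=1..N. \<Sum>k=1..N. c j * c k * (f y j * f y k))" for y
    by (simp add: dot_def power2_eq_square sum_product mult_ac)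
  show "integrable M (\<lambda>y. (dot N (f y) c)\<^sup>2)"
    unfolding eq by (intro Bochner_Integration.integrable_sum integrable_mult_right integrable_coordinate_product) auto
  have "(\<integral>y. (dot N (f y) c)\<^sup>2 \<partial>M) = (\<Sum>j=1..N. \<Sum>k=1..N. c j * c k * (\<integral>y. f y j * f y k \<partial>M))"
    unfolding eq using integrable_coordinate_product
    by (subst Bochner_Integration.integral_sum) (auto intro!: sum.cong)
  also have "\<dots> = (\<Sum>j=1..N. \<Sum>k=1..N. identity_matrix j k * c j * c k)"
    by (intro sum.cong refl) (simp add: isotropic)
  also have "\<dots> = quad N identity_matrix c" by (simp only: quad_eq_sum)
  also have "\<dots> = dot N c c" by (rule quad_identity)
  finally show "(\<integral>y. (dot N (f y) c)\<^sup>2 \<partial>M) = dot N c c" .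
qed

text \<open>Isotropy gives \<open>E (f \<cdot> e\<^sup>A f) = tr e\<^sup>A\<close>, so by the rank-one Golden-Thompson inequality one more
  sample multiplies the expected trace by at most \<open>1 + (e\<^sup>\<theta> - 1)/K\<close>. Nothing is lost by taking
  expectations one sample at a time, because each increment has a multiple of the identity as mean.\<close>

lemma expectation_trace_exp_add_sample:
  assumes sym: "symmetric_matrix N A"
  shows "(\<integral>\<^sup>+y. ennreal (trace_exp N (\<lambda>j k. A j k + \<theta> / K * (f y j * f y k))) \<partial>M)
    \<le> ennreal (exp ((exp \<theta> - 1) / K)) * ennreal (trace_exp N A)"
proof -
  obtain l b where e: "eigensystem N A l b" using spectral_theorem[OF sym] .
  define v where "v = (\<lambda>y k. 1 / sqrt K * f y k)"
  have form: "exp_form N A (v y) = (\<Sum>i=1..N. exp (l i) / K * (dot N (f y) (b i))\<^sup>2)" for y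
    using K unfolding exp_form_eigensystem[OF e sym] v_def dot_scale_left
    by (simp add: power_mult_distrib power_divide)
  have int: "integrable M (\<lambda>y. exp_form N A (v y))"
    unfolding form by (intro Bochner_Integration.integrable_sum integrable_mult_right expectation_dot_square)
  have "(\<integral>y. exp_form N A (v y) \<partial>M) = (\<Sum>i=1..N. exp (l i) / K * dot N (b i) (b i))"
    unfolding form by (simp add: expectation_dot_square Bochner_Integration.integral_sum)
  also have "\<dots> = trace_exp N A / K"
    using trace_exp_eigensystem[OF e sym] eigenvector_unit[OF e] by (simp add: sum_divide_distrib)
  finally have expect: "(\<integral>y. exp_form N A (v y) \<partial>M) = trace_exp N A / K" .
  have update: "trace_exp N (\<lambda>j k. A j k + \<theta> / K * (f y j * f y k))
      \<le> trace_exp N A + (exp \<theta> - 1) * exp_form N A (v y)" if y: "y \<in> space M" for y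
  proof -
    have "dot N (v y) (v y) = dot N (f y) (f y) / K"
      using K unfolding v_def dot_linear by simp
    also have "\<dots> \<le> 1" using bound[OF y] K by simp
    finally have "dot N (v y) (v y) \<le> 1" .
    moreover have "(\<lambda>j k. A j k + \<theta> / K * (f y j * f y k)) = add_rank_one A \<theta> (v y)"
      using K by (simp add: add_rank_one_def v_def fun_eq_iff)
    ultimately show ?thesis using rank_one_Golden_Thompson[OF sym] by simp
  qed
  have "(\<integral>\<^sup>+y. ennreal (trace_exp N (\<lambda>j k. A j k + \<theta> / K * (f y j * f y k))) \<partial>M)
      \<le> (\<integral>\<^sup>+y. ennreal (trace_exp N A + (exp \<theta> - 1) * exp_form N A (v y)) \<partial>M)"
    by (intro nn_integral_mono ennreal_leI update)
  also have "\<dots> = ennreal (\<integral>y. trace_exp N A + (exp \<theta> - 1) * exp_form N A (v y) \<partial>M)"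
  proof (rule nn_integral_eq_integral)
    show "integrable M (\<lambda>y. trace_exp N A + (exp \<theta> - 1) * exp_form N A (v y))"
      using int by simp
    show "AE y in M. 0 \<le> trace_exp N A + (exp \<theta> - 1) * exp_form N A (v y)"
    proof (rule AE_I2)
      fix y assume "y \<in> space M"
      from update[OF this] show "0 \<le> trace_exp N A + (exp \<theta> - 1) * exp_form N A (v y)"
        by (rule order_trans[rotated])
          (use sym in \<open>auto intro!: trace_exp_nonneg simp: symmetric_matrix_def mult.commute\<close>)
    qed
  qed
  also have "(\<integral>y. trace_exp N A + (exp \<theta> - 1) * exp_form N A (v y) \<partial>M)
      = trace_exp N A + (exp \<theta> - 1) * (trace_exp N A / K)"
    using int expect by (simp add: prob_space)
  also have "\<dots> = trace_exp N A * (1 + (exp \<theta> - 1) / K)" by (simp add: algebra_simps)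
  also have "\<dots> \<le> trace_exp N A * exp ((exp \<theta> - 1) / K)"
    by (intro mult_left_mono trace_exp_nonneg sym exp_ge_add_one_self)
  finally show ?thesis
    using trace_exp_nonneg[OF sym] by (simp add: ennreal_mult' mult.commute ennreal_leI)
qed

lemma expectation_trace_exp_exponent:
  "(\<integral>\<^sup>+x. ennreal (trace_exp N (exponent \<theta> m x)) \<partial>(\<Pi>\<^sub>M i\<in>{1..m}. M))
     \<le> ennreal (real N * exp (real m * ((exp \<theta> - 1) / K)))"
proof (induction m)
  case 0
  interpret P: prob_space "\<Pi>\<^sub>M i\<in>({} :: nat set). M" by (intro prob_space_PiM) (rule prob_space_axioms)
  show ?case using P.emeasure_space_1 by (simp add: exponent_def trace_exp_zero)
next
  case (Suc m)
  have "(\<integral>\<^sup>+x. ennreal (trace_exp N (exponent \<theta> (Suc m) x)) \<partial>(\<Pi>\<^sub>M i\<in>{1..Suc m}. M))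
      = (\<integral>\<^sup>+x. \<integral>\<^sup>+y. ennreal (trace_exp N (exponent \<theta> (Suc m) (x(Suc m := y)))) \<partial>M \<partial>(\<Pi>\<^sub>M i\<in>{1..m}. M))"
    using borel_measurable_trace_exp_exponent by (intro nn_integral_iid_insert) measurable
  also have "\<dots> = (\<integral>\<^sup>+x. \<integral>\<^sup>+y. ennreal (trace_exp N
      (\<lambda>j k. exponent \<theta> m x j k + \<theta> / K * (f y j * f y k))) \<partial>M \<partial>(\<Pi>\<^sub>M i\<in>{1..m}. M))"
    by (simp add: exponent_def)
  also have "\<dots> \<le> (\<integral>\<^sup>+x. ennreal (exp ((exp \<theta> - 1) / K)) * ennreal (trace_exp N (exponent \<theta> m x)) \<partial>(\<Pi>\<^sub>M i\<in>{1..m}. M))"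
    by (intro nn_integral_mono expectation_trace_exp_add_sample symmetric_exponent)
  also have "\<dots> = ennreal (exp ((exp \<theta> - 1) / K)) * (\<integral>\<^sup>+x. ennreal (trace_exp N (exponent \<theta> m x)) \<partial>(\<Pi>\<^sub>M i\<in>{1..m}. M))"
    using borel_measurable_trace_exp_exponent by (intro nn_integral_cmult) measurable
  also have "\<dots> \<le> ennreal (exp ((exp \<theta> - 1) / K)) * ennreal (real N * exp (real m * ((exp \<theta> - 1) / K)))"
    by (intro mult_left_mono Suc) auto
  also have "\<dots> = ennreal (real N * exp (real (Suc m) * ((exp \<theta> - 1) / K)))"
    by (simp add: ennreal_mult'[symmetric] algebra_simps exp_add add_divide_distrib diff_divide_distrib flip: exp_add)
  finally show ?case .
qed

lemma trace_exp_tail: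
  "{x \<in> space (\<Pi>\<^sub>M i\<in>{1..m}. M). exp s \<le> trace_exp N (exponent \<theta> m x)} \<in> sets (\<Pi>\<^sub>M i\<in>{1..m}. M)"
  "emeasure (\<Pi>\<^sub>M i\<in>{1..m}. M) {x \<in> space (\<Pi>\<^sub>M i\<in>{1..m}. M). exp s \<le> trace_exp N (exponent \<theta> m x)}
     \<le> ennreal (real N * exp (real m * ((exp \<theta> - 1) / K) - s))"
proof -
  let ?P = "\<Pi>\<^sub>M i\<in>{1..m}. M"
  note [measurable] = borel_measurable_trace_exp_exponent[of \<theta> m]
  show "{x \<in> space ?P. exp s \<le> trace_exp N (exponent \<theta> m x)} \<in> sets ?P"
    by measurable
  have "{x \<in> space ?P. exp s \<le> trace_exp N (exponent \<theta> m x)}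
      = {x \<in> space ?P. 1 \<le> ennreal (exp (- s)) * ennreal (trace_exp N (exponent \<theta> m x))}"
    using trace_exp_nonneg[OF symmetric_exponent]
    by (auto simp: ennreal_mult'[symmetric] exp_minus field_simps simp flip: ennreal_1)
  then have "emeasure ?P {x \<in> space ?P. exp s \<le> trace_exp N (exponent \<theta> m x)}
      \<le> ennreal (exp (- s)) * (\<integral>\<^sup>+x. ennreal (trace_exp N (exponent \<theta> m x)) \<partial>?P)"
    using nn_integral_Markov_inequality[of "\<lambda>x. ennreal (trace_exp N (exponent \<theta> m x))" "space ?P" ?P "ennreal (exp (- s))"]
    by (simp del: One_nat_def cong: nn_integral_cong)
  also have "\<dots> \<le> ennreal (exp (- s)) * ennreal (real N * exp (real m * ((exp \<theta> - 1) / K)))"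
    by (intro mult_left_mono expectation_trace_exp_exponent) auto
  also have "\<dots> = ennreal (real N * exp (real m * ((exp \<theta> - 1) / K) - s))"
    by (simp add: ennreal_mult'[symmetric] exp_diff exp_minus field_simps)
  finally show "emeasure ?P {x \<in> space ?P. exp s \<le> trace_exp N (exponent \<theta> m x)}
     \<le> ennreal (real N * exp (real m * ((exp \<theta> - 1) / K) - s))" .
qed

text \<open>A deviation of \<open>G\<close> by more than \<open>1/2\<close> is seen by a unit vector \<open>d\<close> with \<open>d \<cdot> G d > 3/2\<close> or
  \<open>d \<cdot> G d < 1/2\<close>, and each case forces a large trace of the exponential of \<open>\<plusminus>\<theta> (m/K) G\<close>. The value
  \<open>\<theta> = ln (3/2)\<close> minimizes \<open>e\<^sup>\<theta> - 1 - 3\<theta>/2\<close>, whose minimum is \<open>-1/\<gamma>\<close>; the same \<open>\<theta>\<close> with the opposite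
  sign is good enough for the lower tail.\<close>

lemma matrix_Chernoff:
  fixes m :: nat
  assumes m: "m > 0"
  defines "G \<equiv> \<lambda>x j k. (1 / real m) * (\<Sum>i=1..m. f (x i) j * f (x i) k)"
  shows "emeasure (\<Pi>\<^sub>M i\<in>{1..m}. M)
      {x \<in> space (\<Pi>\<^sub>M i\<in>{1..m}. M). \<not> near_identity N (G x)}
    \<le> ennreal (2 * real N * exp (- (real m / (gamma_const * K))))"
proof -
  let ?P = "\<Pi>\<^sub>M i\<in>{1..m}. M"
  define \<theta> :: real where "\<theta> = ln (3/2)"
  define T1 where "T1 = {x \<in> space ?P. exp (real m / K * (3/2 * \<theta>)) \<le> trace_exp N (exponent \<theta> m x)}"
  define T2 where "T2 = {x \<in> space ?P. exp (real m / K * (- \<theta> / 2)) \<le> trace_exp N (exponent (- \<theta>) m x)}"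
  have \<theta>: "\<theta> > 0" "\<theta> \<le> 5/12" "exp \<theta> = 3/2" using ln_three_halves_le by (simp_all add: \<theta>_def)
  have G: "exponent t m x = (\<lambda>j k. (t * (real m / K)) * G x j k)" for t x
    using m by (simp add: exponent_def G_def fun_eq_iff sum_distrib_left mult_ac)
  have sub: "{x \<in> space ?P. \<not> near_identity N (G x)} \<subseteq> T1 \<union> T2"
  proof safe
    fix x assume x: "x \<in> space ?P" "\<not> near_identity N (G x)" "x \<notin> T2"
    have "symmetric_matrix N (\<lambda>j k. G x j k - identity_matrix j k)"
      by (simp add: symmetric_matrix_def G_def identity_matrix_def mult.commute)
    then obtain c where c: "\<bar>quad N (G x) c - dot N c c\<bar> > 1/2 * dot N c c"
      using x(2) spectral_norm_le_iff[of N "\<lambda>j k. G x j k - identity_matrix j k" "1/2"]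
      by (auto simp: quad_linear not_le)
    define s where "s = dot N c c"
    have "s \<noteq> 0"
    proof
      assume "s = 0"
      then have "quad N (G x) c = 0" by (auto simp: s_def dot_self_eq_0 quad_eq_sum)
      then show False using c \<open>s = 0\<close> by (simp add: s_def)
    qed
    then have s: "s > 0" using dot_self_nonneg[of N c] by (simp add: s_def)
    define d where "d = (\<lambda>k. 1 / sqrt s * c k)"
    have d1: "dot N d d = 1" using s unfolding d_def dot_linear by (simp add: s_def[symmetric])
    have "quad N (G x) d = quad N (G x) c / s"
      using s unfolding d_def quad_scale by (simp add: power_divide)
    then have "quad N (G x) d - 1 = (quad N (G x) c - s) / s"
      using s by (simp add: diff_divide_distrib)
    then have "\<bar>quad N (G x) d - 1\<bar> = \<bar>quad N (G x) c - s\<bar> / s"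
      using s by (simp only: abs_divide abs_of_pos)
    also have "\<dots> > 1/2"
      using c s by (simp add: s_def[symmetric] pos_less_divide_eq)
    finally have d2: "\<bar>quad N (G x) d - 1\<bar> > 1/2" .
    have tr: "exp (t * (real m / K) * quad N (G x) d) \<le> trace_exp N (exponent t m x)" for t
      using exp_quad_le_trace_exp[OF symmetric_exponent d1, of t m x] unfolding G quad_smult .
    have mK: "0 \<le> \<theta> * (real m / K)" using m K \<theta> by simp
    show "x \<in> T1"
    proof (cases "quad N (G x) d > 3/2")
      case True
      have "real m / K * (3/2 * \<theta>) = (\<theta> * (real m / K)) * (3/2)" by simp
      also have "\<dots> \<le> (\<theta> * (real m / K)) * quad N (G x) d"
        by (rule mult_left_mono[OF less_imp_le[OF True] mK])
      finally have "exp (real m / K * (3/2 * \<theta>)) \<le> exp (\<theta> * (real m / K) * quad N (G x) d)"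
        unfolding exp_le_cancel_iff .
      then show ?thesis using order_trans[OF _ tr[of \<theta>]] x(1) unfolding T1_def by blast
    next
      case False
      then have le: "quad N (G x) d \<le> 1/2" using d2 by linarith
      have "(\<theta> * (real m / K)) * quad N (G x) d \<le> (\<theta> * (real m / K)) * (1/2)"
        by (rule mult_left_mono[OF le mK])
      then have "exp (real m / K * (- \<theta> / 2)) \<le> exp (- \<theta> * (real m / K) * quad N (G x) d)"
        by (simp add: mult_ac)
      then have "x \<in> T2" using order_trans[OF _ tr[of "- \<theta>"]] x(1) unfolding T2_def by blast
      then show ?thesis using x(3) by simp
    qed
  qed
  have sets: "T1 \<in> sets ?P" "T2 \<in> sets ?P"
    unfolding T1_def T2_def by (intro trace_exp_tail(1))+
  have g: "1 / gamma_const = 3/2 * \<theta> - 1/2" 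
    unfolding gamma_const_def \<theta>_def divide_inverse[of 1] inverse_inverse_eq mult_1 by simp
  have e1: "emeasure ?P T1 \<le> ennreal (real N * exp (- (real m / (gamma_const * K))))"
  proof -
    have "real m * ((exp \<theta> - 1) / K) - real m / K * (3/2 * \<theta>) = - (real m / K * (1 / gamma_const))"
      using K unfolding g \<theta>(3) by (simp add: field_simps)
    then have "real m * ((exp \<theta> - 1) / K) - real m / K * (3/2 * \<theta>) = - (real m / (gamma_const * K))"
      by (simp add: mult.commute)
    then show ?thesis
      using trace_exp_tail(2)[of m "real m / K * (3/2 * \<theta>)" \<theta>] unfolding T1_def by simp
  qed
  have e2: "emeasure ?P T2 \<le> ennreal (real N * exp (- (real m / (gamma_const * K))))"
  proof -
    have "exp (- \<theta>) = 2/3" by (simp add: exp_minus \<theta>(3))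
    then have "real m * ((exp (- \<theta>) - 1) / K) - real m / K * (- \<theta> / 2) = real m / K * (\<theta> / 2 - 1/3)"
      using K by (simp add: field_simps)
    also have "\<dots> \<le> real m / K * (- (1 / gamma_const))"
      using \<theta> K unfolding g by (intro mult_left_mono) auto
    also have "\<dots> = - (real m / (gamma_const * K))" by (simp add: mult.commute)
    finally have "real N * exp (real m * ((exp (- \<theta>) - 1) / K) - real m / K * (- \<theta> / 2))
        \<le> real N * exp (- (real m / (gamma_const * K)))"
      by (intro mult_left_mono) auto
    then show ?thesis
      using trace_exp_tail(2)[of m "real m / K * (- \<theta> / 2)" "- \<theta>"] unfolding T2_def
      by (meson ennreal_leI order_trans)
  qed
  have "emeasure ?P {x \<in> space ?P. \<not> near_identity N (G x)}
      \<le> emeasure ?P (T1 \<union> T2)" using sub sets by (intro emeasure_mono) auto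
  also have "\<dots> \<le> emeasure ?P T1 + emeasure ?P T2" using sets by (rule emeasure_subadditive)
  also have "\<dots> \<le> ennreal (real N * exp (- (real m / (gamma_const * K)))) + ennreal (real N * exp (- (real m / (gamma_const * K))))"
    by (intro add_mono e1 e2)
  also have "\<dots> = ennreal (2 * real N * exp (- (real m / (gamma_const * K))))"
    by (simp flip: ennreal_plus)
  finally show ?thesis .
qed

end

lemma empirical_gram_concentration:
  fixes w :: "'a \<Rightarrow> real" and L :: "nat \<Rightarrow> 'a \<Rightarrow> real"
  assumes [measurable]: "w \<in> borel_measurable M" and w: "\<And>y. y \<in> space M \<Longrightarrow> 0 \<le> w y"
    and L: "\<And>j. j \<in> {1..N} \<Longrightarrow> L j \<in> borel_measurable M"
    and bound: "\<And>y. y \<in> space M \<Longrightarrow> w y * sum_squares N L y \<le> K"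
    and iso: "\<And>j k. j \<in> {1..N} \<Longrightarrow> k \<in> {1..N} \<Longrightarrow> (\<integral>y. w y * L j y * L k y \<partial>M) = identity_matrix j k"
    and K: "K > 0" and N: "N > 0" and \<delta>: "0 < \<delta>" "\<delta> < 1"
    and m: "real m \<ge> gamma_const * K * ln (2 * real N / \<delta>)"
  shows "emeasure (\<Pi>\<^sub>M i\<in>{1..m}. M) {x \<in> space (\<Pi>\<^sub>M i\<in>{1..m}. M).
      \<not> near_identity N (gram (empirical_inner m w x) L)}
    \<le> ennreal \<delta>"
proof -
  let ?P = "\<Pi>\<^sub>M i\<in>{1..m}. M"
  define f where "f = (\<lambda>y j. sqrt (w y) * L j y)"
  have ff: "f y j * f y k = w y * L j y * L k y" if "y \<in> space M" for y j k
  proof -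
    have "f y j * f y k = (sqrt (w y) * sqrt (w y)) * (L j y * L k y)" by (simp add: f_def mult_ac)
    then show ?thesis using w[OF that] by simp
  qed
  have ratio: "2 * real N / \<delta> > 1" using N \<delta> by (simp add: field_simps)
  have "real m > 0"
    using m gamma_const_pos K ratio by (intro less_le_trans[OF _ m] mult_pos_pos) auto
  then have m0: "m > 0" by simp
  have G: "gram (empirical_inner m w x) L j k = (1 / real m) * (\<Sum>i=1..m. f (x i) j * f (x i) k)"
    if "x \<in> space ?P" for x j k
  proof -
    have "(\<Sum>i=1..m. f (x i) j * f (x i) k) = (\<Sum>i=1..m. w (x i) * L j (x i) * L k (x i))"
      using that by (intro sum.cong refl ff) (auto simp: space_PiM)
    then show ?thesis by (simp add: gram_def empirical_inner_def)
  qed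
  have 1: "(\<lambda>y. f y j) \<in> borel_measurable M" if "j \<in> {1..N}" for j
    using L[OF that] unfolding f_def by measurable
  have 2: "dot N (f y) (f y) \<le> K" if "y \<in> space M" for y
    using bound[OF that] ff[OF that]
    by (simp add: dot_def sum_squares_def sum_distrib_left power2_eq_square mult_ac)
  have 3: "(\<integral>y. f y j * f y k \<partial>M) = identity_matrix j k" if "j \<in> {1..N}" "k \<in> {1..N}" for j k
    using iso[OF that] by (subst Bochner_Integration.integral_cong[OF refl ff]) auto
  have "emeasure ?P {x \<in> space ?P.
      \<not> near_identity N (gram (empirical_inner m w x) L)}
    = emeasure ?P {x \<in> space ?P.
      \<not> near_identity N (\<lambda>j k. (1 / real m) * (\<Sum>i=1..m. f (x i) j * f (x i) k))}"
    by (intro arg_cong[where f = "emeasure ?P"]) (auto simp: G)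
  also have "\<dots> \<le> ennreal (2 * real N * exp (- (real m / (gamma_const * K))))"
    by (rule matrix_Chernoff[OF 1 2 K 3 m0])
  also have "\<dots> \<le> ennreal \<delta>"
  proof (rule ennreal_leI)
    have "ln (2 * real N / \<delta>) \<le> real m / (gamma_const * K)"
      using m gamma_const_pos K by (simp add: field_simps)
    then have "exp (- (real m / (gamma_const * K))) \<le> exp (- ln (2 * real N / \<delta>))" by simp
    also have "\<dots> = \<delta> / (2 * real N)" using ratio N \<delta> by (simp add: exp_minus)
    finally show "2 * real N * exp (- (real m / (gamma_const * K))) \<le> \<delta>"
      using N by (simp add: field_simps)
  qed
  finally show ?thesis .
qed

end

section \<open>Weighted empirical inner products\<close>

(* Index ranges start at 1; the simplifier should not rewrite that bound to a successor term. *)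
declare One_nat_def [simp del]

definition lin_comb :: "nat \<Rightarrow> (nat \<Rightarrow> 'a \<Rightarrow> real) \<Rightarrow> (nat \<Rightarrow> real) \<Rightarrow> 'a \<Rightarrow> real" where
  "lin_comb N F c = (\<lambda>x. \<Sum>j=1..N. c j * F j x)"

lemma lin_span_eq_range: "lin_span N F = range (lin_comb N F)"
  by (auto simp: lin_span_def lin_comb_def)

lemma lin_comb_eq_dot: "lin_comb N F c x = dot N c (\<lambda>j. F j x)"
  by (simp add: lin_comb_def dot_def)

lemma lin_comb_identity: "j \<in> {1..N} \<Longrightarrow> lin_comb N F (identity_matrix j) = F j"
  by (simp add: lin_comb_eq_dot dot_identity_matrix fun_eq_iff)

lemma lin_comb_add: "lin_comb N F (\<lambda>j. c j + d j) x = lin_comb N F c x + lin_comb N F d x"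
  by (simp add: lin_comb_eq_dot dot_linear)

lemma lin_comb_diff: "lin_comb N F (\<lambda>j. c j - d j) x = lin_comb N F c x - lin_comb N F d x"
  by (simp add: lin_comb_eq_dot dot_linear)

lemma lin_comb_scale: "lin_comb N F (\<lambda>j. a * c j) x = a * lin_comb N F c x"
  by (simp add: lin_comb_eq_dot dot_linear)

lemma sum_squares_eq_dot: "sum_squares N F x = dot N (\<lambda>j. F j x) (\<lambda>j. F j x)"
  by (simp add: sum_squares_def dot_def power2_eq_square)

lemma sum_squares_nonneg: "0 \<le> sum_squares N F x"
  by (simp add: sum_squares_def sum_nonneg)

lemma sum_squares_eq_0: "sum_squares N F x = 0 \<longleftrightarrow> (\<forall>j\<in>{1..N}. F j x = 0)"
  by (simp add: sum_squares_eq_dot dot_self_eq_0)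

lemma empirical_inner_commute: "empirical_inner m w y u v = empirical_inner m w y v u"
  by (simp add: empirical_inner_def mult_ac)

lemma empirical_inner_linear_left:
  "empirical_inner m w y (\<lambda>x. a * u x + b * v x) f
     = a * empirical_inner m w y u f + b * empirical_inner m w y v f"
  by (simp add: empirical_inner_def sum.distrib sum_distrib_left algebra_simps)

lemma empirical_inner_lin_comb_right:
  "empirical_inner m w y u (lin_comb N F c) = (\<Sum>j=1..N. c j * empirical_inner m w y u (F j))"
proof -
  have "empirical_inner m w y u (lin_comb N F c)
      = (\<Sum>i=1..m. \<Sum>j=1..N. 1 / real m * (w (y i) * u (y i) * (c j * F j (y i))))"
    by (simp add: empirical_inner_def lin_comb_def sum_distrib_left mult_ac)
  also have "\<dots> = (\<Sum>j=1..N. \<Sum>i=1..m. 1 / real m * (w (y i) * u (y i) * (c j * F j (y i))))"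
    by (rule sum.swap)
  finally show ?thesis by (simp add: empirical_inner_def sum_distrib_left mult_ac)
qed

lemma symmetric_gram_empirical: "symmetric_matrix N (gram (empirical_inner m w y) F)"
  by (simp add: symmetric_matrix_def gram_def empirical_inner_commute)

lemma empirical_inner_lin_comb_self:
  "empirical_inner m w y (lin_comb N F c) (lin_comb N F c) = quad N (gram (empirical_inner m w y) F) c"
proof -
  have "empirical_inner m w y (lin_comb N F c) (lin_comb N F c)
      = (\<Sum>j=1..N. c j * (\<Sum>k=1..N. c k * empirical_inner m w y (F j) (F k)))"
    by (subst empirical_inner_lin_comb_right, subst empirical_inner_commute,
        subst empirical_inner_lin_comb_right) rule
  then show ?thesis by (simp add: quad_def dot_def mat_vec_def gram_def mult_ac)
qed

lemma quad_gram_orthonormal_basis: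
  assumes "orthonormal_basis (empirical_inner m w y) V N F"
  shows "quad N (gram (empirical_inner m w y) F) c = dot N c c"
proof -
  have "quad N (gram (empirical_inner m w y) F) c = quad N identity_matrix c"
    unfolding quad_eq_sum using assms
    by (intro sum.cong refl) (auto simp: orthonormal_basis_def gram_def identity_matrix_def)
  then show ?thesis by (simp add: quad_identity)
qed

text \<open>Symmetry and linearity hold for every weight. What remains is definiteness, which for a family
  that is linearly independent on \<open>D\<close> is a property of the Gram matrix.\<close>

lemma inner_product_on_iff_positive_definite:
  fixes L :: "nat \<Rightarrow> 'a \<Rightarrow> real"
  assumes w: "\<And>x. 0 \<le> w x"
    and indep: "\<And>c. (\<And>x. x \<in> D \<Longrightarrow> lin_comb N L c x = 0) \<Longrightarrow> \<forall>k\<in>{1..N}. c k = 0"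
  shows "inner_product_on D (lin_span N L) (empirical_inner m w y) \<longleftrightarrow>
    (\<forall>c. quad N (gram (empirical_inner m w y) L) c \<le> 0 \<longrightarrow> (\<forall>k\<in>{1..N}. c k = 0))"
    (is "?ip \<longleftrightarrow> ?pd")
proof
  assume ip: ?ip
  show ?pd
  proof (intro allI impI)
    fix c assume "quad N (gram (empirical_inner m w y) L) c \<le> 0"
    then have le: "empirical_inner m w y (lin_comb N L c) (lin_comb N L c) \<le> 0"
      by (simp add: empirical_inner_lin_comb_self)
    have "lin_comb N L c \<in> lin_span N L" by (simp add: lin_span_eq_range)
    then have "\<forall>x\<in>D. lin_comb N L c x = 0"
      using ip le unfolding inner_product_on_def by (meson order_antisym)
    then show "\<forall>k\<in>{1..N}. c k = 0" by (intro indep) auto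
  qed
next
  assume pd: ?pd
  have nonneg: "0 \<le> empirical_inner m w y u u" for u
  proof -
    have "empirical_inner m w y u u = 1 / real m * (\<Sum>i=1..m. w (y i) * (u (y i))\<^sup>2)"
      by (simp add: empirical_inner_def power2_eq_square mult_ac)
    then show ?thesis using w by (simp add: sum_nonneg)
  qed
  have "u x = 0" if u: "u \<in> lin_span N L" and 0: "empirical_inner m w y u u = 0" for u x
  proof -
    obtain c where c: "u = lin_comb N L c" using u by (auto simp: lin_span_eq_range)
    have "\<forall>k\<in>{1..N}. c k = 0" using pd 0 by (simp add: c empirical_inner_lin_comb_self)
    then show ?thesis by (simp add: c lin_comb_def)
  qed
  then show ?ip
    unfolding inner_product_on_def
    using nonneg empirical_inner_commute empirical_inner_linear_left by blast
qed

text \<open>The extremal property of the Christoffel function: the sum of squares of an orthonormal basis at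
  \<open>x\<close> is the largest value of \<open>v(x)\<^sup>2\<close> over unit vectors \<open>v\<close>. The right-hand side does not mention the basis,
  so the sampling densities are measurable in the draws although the choice of the bases is not
  assumed to be.\<close>

lemma sum_squares_orthonormal_basis_le_iff:
  assumes on: "orthonormal_basis (empirical_inner m w y) (lin_span N L) N F" and N: "N > 0"
  shows "sum_squares N F x \<le> t \<longleftrightarrow>
    (\<forall>c. (lin_comb N L c x)\<^sup>2 \<le> t * quad N (gram (empirical_inner m w y) L) c)"
proof
  assume le: "sum_squares N F x \<le> t"
  show "\<forall>c. (lin_comb N L c x)\<^sup>2 \<le> t * quad N (gram (empirical_inner m w y) L) c"
  proof
    fix c
    have "lin_comb N L c \<in> lin_span N F"
      using on by (auto simp: orthonormal_basis_def lin_span_eq_range)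
    then obtain a where a: "lin_comb N L c = lin_comb N F a" by (auto simp: lin_span_eq_range)
    have "(lin_comb N F a x)\<^sup>2 \<le> dot N a a * sum_squares N F x"
      unfolding lin_comb_eq_dot sum_squares_eq_dot by (rule dot_Cauchy_Schwarz)
    also have "\<dots> \<le> dot N a a * t" using le dot_self_nonneg by (intro mult_left_mono)
    also have "dot N a a = quad N (gram (empirical_inner m w y) L) c"
      using quad_gram_orthonormal_basis[OF on, of a] a by (metis empirical_inner_lin_comb_self)
    finally show "(lin_comb N L c x)\<^sup>2 \<le> t * quad N (gram (empirical_inner m w y) L) c"
      by (simp add: a mult.commute)
  qed
next
  assume "\<forall>c. (lin_comb N L c x)\<^sup>2 \<le> t * quad N (gram (empirical_inner m w y) L) c"
  then have "(lin_comb N F a x)\<^sup>2 \<le> t * dot N a a" for a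
  proof -
    assume *: "\<forall>c. (lin_comb N L c x)\<^sup>2 \<le> t * quad N (gram (empirical_inner m w y) L) c"
    have "lin_comb N F a \<in> lin_span N L"
      using on by (auto simp: orthonormal_basis_def lin_span_eq_range)
    then obtain c where c: "lin_comb N F a = lin_comb N L c" by (auto simp: lin_span_eq_range)
    have "dot N a a = quad N (gram (empirical_inner m w y) L) c"
      using quad_gram_orthonormal_basis[OF on, of a] c by (metis empirical_inner_lin_comb_self)
    then show ?thesis using * c by simp
  qed
  note * = this
  \<comment> \<open>Needed separately when the sum of squares vanishes, since the test with the coefficients \<open>F\<^sub>j(x)\<close> is
    then void.\<close>
  have "0 \<le> t"
    using *[of "identity_matrix 1"] N order_trans[OF zero_le_power2]
    by (fastforce simp: dot_identity_matrix identity_matrix_def)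
  moreover have "(sum_squares N F x)\<^sup>2 \<le> t * sum_squares N F x"
    using *[of "\<lambda>j. F j x"] by (simp add: lin_comb_eq_dot sum_squares_eq_dot)
  ultimately show "sum_squares N F x \<le> t"
    using sum_squares_nonneg[of N F x] by (cases "sum_squares N F x = 0") (auto simp: power2_eq_square)
qed

lemma gram_close_to_identity:
  assumes "near_identity N (gram (empirical_inner m w y) L)"
  shows "1/2 * dot N c c \<le> quad N (gram (empirical_inner m w y) L) c"
    and "quad N (gram (empirical_inner m w y) L) c \<le> 3/2 * dot N c c"
proof -
  have "symmetric_matrix N (\<lambda>j k. gram (empirical_inner m w y) L j k - identity_matrix j k)"
    using symmetric_gram_empirical[of N m w y L] by (simp add: symmetric_matrix_def identity_matrix_def)
  then have *: "\<bar>quad N (gram (empirical_inner m w y) L) c - dot N c c\<bar> \<le> 1/2 * dot N c c"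
    using assms by (subst (asm) spectral_norm_le_iff) (auto simp: quad_linear)
  then show "1/2 * dot N c c \<le> quad N (gram (empirical_inner m w y) L) c"
    "quad N (gram (empirical_inner m w y) L) c \<le> 3/2 * dot N c c" by linarith+
qed

text \<open>Both bounds compare the unit balls of two equivalent inner products through the extremal property
  above; \<open>2\<close> and \<open>2/3\<close> are the reciprocals of the extreme eigenvalues \<open>1/2\<close> and \<open>3/2\<close>.\<close>

lemma sum_squares_comparison:
  assumes on: "orthonormal_basis (empirical_inner m w y) (lin_span N L) N F" and N: "N > 0"
    and close: "near_identity N (gram (empirical_inner m w y) L)"
  shows "sum_squares N F x \<le> 2 * sum_squares N L x"
    and "2/3 * sum_squares N L x \<le> sum_squares N F x"
proof -
  have "(lin_comb N L c x)\<^sup>2 \<le> 2 * sum_squares N L x * quad N (gram (empirical_inner m w y) L) c" for c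
  proof -
    have "(lin_comb N L c x)\<^sup>2 \<le> dot N c c * sum_squares N L x"
      unfolding lin_comb_eq_dot sum_squares_eq_dot by (rule dot_Cauchy_Schwarz)
    also have "\<dots> \<le> (2 * quad N (gram (empirical_inner m w y) L) c) * sum_squares N L x"
      using gram_close_to_identity(1)[OF close, of c] sum_squares_nonneg by (intro mult_right_mono) auto
    finally show ?thesis by (simp add: mult_ac)
  qed
  then show "sum_squares N F x \<le> 2 * sum_squares N L x"
    unfolding sum_squares_orthonormal_basis_le_iff[OF on N] by blast
  define k where "k = sum_squares N L x"
  have "k\<^sup>2 \<le> sum_squares N F x * quad N (gram (empirical_inner m w y) L) (\<lambda>j. L j x)"
    using sum_squares_orthonormal_basis_le_iff[OF on N, of x "sum_squares N F x"]
    by (auto simp: k_def lin_comb_eq_dot sum_squares_eq_dot)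
  also have "\<dots> \<le> sum_squares N F x * (3/2 * k)"
    using gram_close_to_identity(2)[OF close, of "\<lambda>j. L j x"]
    by (intro mult_left_mono sum_squares_nonneg) (simp add: k_def sum_squares_eq_dot)
  finally have "k * k \<le> (3/2 * sum_squares N F x) * k" by (simp add: power2_eq_square mult_ac)
  moreover have "0 \<le> k" by (simp add: k_def sum_squares_nonneg)
  ultimately have "k \<le> 3/2 * sum_squares N F x"
    using sum_squares_nonneg[of N F x] by (cases "k = 0") auto
  then show "2/3 * sum_squares N L x \<le> sum_squares N F x" by (simp add: k_def)
qed

section \<open>Sampling from a density\<close>

lemma sampling_weight_nonneg: "(\<And>x. 0 \<le> k x) \<Longrightarrow> 0 \<le> sampling_weight \<mu> N k x"
  unfolding sampling_weight_def normalization_def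
  by (intro divide_nonneg_nonneg mult_nonneg_nonneg iffD2[OF inverse_nonnegative_iff_nonnegative]
      Bochner_Integration.integral_nonneg) auto

text \<open>The weight is the reciprocal of the density where \<open>k\<close> is positive. Where \<open>k\<close> vanishes the weight is
  \<open>0\<close> by the convention for division, so functions supported there are lost; hence the last
  assumption.\<close>

lemma
  fixes k h :: "'a \<Rightarrow> real"
  assumes [measurable]: "k \<in> borel_measurable \<mu>" "h \<in> borel_measurable \<mu>"
    and k: "\<And>x. 0 \<le> k x" and N: "N > 0" and pos: "(\<integral>x. k x / real N \<partial>\<mu>) > 0"
    and h: "\<And>x. x \<in> space \<mu> \<Longrightarrow> k x = 0 \<Longrightarrow> h x = 0"
  shows integral_sampling_measure:
      "(\<integral>x. sampling_weight \<mu> N k x * h x \<partial>sampling_measure \<mu> N k) = (\<integral>x. h x \<partial>\<mu>)"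
    and integrable_sampling_measure:
      "integrable (sampling_measure \<mu> N k) (\<lambda>x. sampling_weight \<mu> N k x * h x) \<longleftrightarrow> integrable \<mu> h"
proof -
  define \<alpha> where "\<alpha> = normalization \<mu> N k"
  have \<alpha>: "\<alpha> > 0" using pos unfolding \<alpha>_def normalization_def by (rule positive_imp_inverse_positive)
  have [measurable]: "(\<lambda>x. sampling_weight \<mu> N k x * h x) \<in> borel_measurable \<mu>"
    unfolding sampling_weight_def by measurable
  have nonneg: "AE x in \<mu>. 0 \<le> \<alpha> * (k x / real N)" using \<alpha> k by simp
  have eq: "(\<alpha> * (k x / real N)) * (sampling_weight \<mu> N k x * h x) = h x" if "x \<in> space \<mu>" for x
    using h[OF that] \<alpha> N by (cases "k x = 0") (simp_all add: sampling_weight_def flip: \<alpha>_def)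
  have "(\<integral>x. sampling_weight \<mu> N k x * h x \<partial>sampling_measure \<mu> N k)
      = (\<integral>x. (\<alpha> * (k x / real N)) * (sampling_weight \<mu> N k x * h x) \<partial>\<mu>)"
    unfolding sampling_measure_def \<alpha>_def[symmetric] using nonneg by (subst integral_density) auto
  also have "\<dots> = (\<integral>x. h x \<partial>\<mu>)" using eq by (intro Bochner_Integration.integral_cong) auto
  finally show "(\<integral>x. sampling_weight \<mu> N k x * h x \<partial>sampling_measure \<mu> N k) = (\<integral>x. h x \<partial>\<mu>)" .
  have "integrable (sampling_measure \<mu> N k) (\<lambda>x. sampling_weight \<mu> N k x * h x)
      \<longleftrightarrow> integrable \<mu> (\<lambda>x. (\<alpha> * (k x / real N)) * (sampling_weight \<mu> N k x * h x))"
    unfolding sampling_measure_def \<alpha>_def[symmetric] using nonneg by (subst integrable_density) auto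
  also have "\<dots> \<longleftrightarrow> integrable \<mu> h"
    using eq by (intro Bochner_Integration.integrable_cong) auto
  finally show "integrable (sampling_measure \<mu> N k) (\<lambda>x. sampling_weight \<mu> N k x * h x) \<longleftrightarrow> integrable \<mu> h" .
qed

text \<open>On the generating boxes the product measure is a finite product of the given probabilities.\<close>

lemma measurable_PiM_kernel:
  assumes \<sigma>: "\<sigma> \<in> S \<rightarrow>\<^sub>M prob_algebra \<mu>" and I: "finite I"
  shows "(\<lambda>z. \<Pi>\<^sub>M i\<in>I. \<sigma> z) \<in> S \<rightarrow>\<^sub>M prob_algebra (\<Pi>\<^sub>M i\<in>I. \<mu>)"
proof (rule measurable_prob_algebra_generated)
  have s: "prob_space (\<sigma> z) \<and> sets (\<sigma> z) = sets \<mu>" if "z \<in> space S" for z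
    using measurable_space[OF \<sigma> that] by (simp add: space_prob_algebra)
  show "sets (\<Pi>\<^sub>M i\<in>I. \<mu>) = sigma_sets (\<Pi>\<^sub>E i\<in>I. space \<mu>) (prod_algebra I (\<lambda>_. \<mu>))"
    by (rule sets_PiM)
  show "Int_stable (prod_algebra I (\<lambda>_. \<mu>))" by (rule Int_stable_prod_algebra)
  show "prod_algebra I (\<lambda>_. \<mu>) \<subseteq> Pow (\<Pi>\<^sub>E i\<in>I. space \<mu>)" by (rule prod_algebra_sets_into_space)
  fix z assume z: "z \<in> space S"
  show "prob_space (\<Pi>\<^sub>M i\<in>I. \<sigma> z)" using s[OF z] by (intro prob_space_PiM) simp
  show "sets (\<Pi>\<^sub>M i\<in>I. \<sigma> z) = sets (\<Pi>\<^sub>M i\<in>I. \<mu>)" using s[OF z] by (intro sets_PiM_cong) auto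
next
  fix A assume "A \<in> prod_algebra I (\<lambda>_. \<mu>)"
  then obtain X where X: "A = (\<Pi>\<^sub>E i\<in>I. X i)" "\<And>i. i \<in> I \<Longrightarrow> X i \<in> sets \<mu>"
    by (auto simp: prod_algebra_eq_finite[OF I])
  have "emeasure (\<Pi>\<^sub>M i\<in>I. \<sigma> z) A = (\<Prod>i\<in>I. emeasure (\<sigma> z) (X i))" if z: "z \<in> space S" for z
  proof -
    have s: "prob_space (\<sigma> z)" "sets (\<sigma> z) = sets \<mu>"
      using measurable_space[OF \<sigma> z] by (simp_all add: space_prob_algebra)
    interpret \<sigma>: prob_space "\<sigma> z" by (rule s)
    interpret product_sigma_finite "\<lambda>_. \<sigma> z"
      by (simp add: product_sigma_finite_def \<sigma>.sigma_finite_measure_axioms)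
    show ?thesis unfolding X(1) using I X(2) s by (intro emeasure_PiM) auto
  qed
  moreover have "(\<lambda>z. \<Prod>i\<in>I. emeasure (\<sigma> z) (X i)) \<in> borel_measurable S"
    using X(2) \<sigma> by (intro borel_measurable_prod_ennreal measurable_emeasure_kernel[OF measurable_prob_algebraD[OF \<sigma>]]) auto
  ultimately show "(\<lambda>z. emeasure (\<Pi>\<^sub>M i\<in>I. \<sigma> z) A) \<in> borel_measurable S"
    by (subst measurable_cong) auto
qed

text \<open>The union bound for a two-stage experiment: either the first stage fails, or the second stage
  does so given a successful first one.\<close>

lemma emeasure_bind_le:
  assumes Q: "Q \<in> space (prob_algebra S)" and K: "K \<in> S \<rightarrow>\<^sub>M prob_algebra T"
    and X: "X \<in> sets T" and Y: "Y \<in> sets S"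
    and le: "\<And>z. z \<in> space S \<Longrightarrow> z \<notin> Y \<Longrightarrow> emeasure (K z) X \<le> ennreal \<delta>"
  shows "emeasure (Q \<bind> K) X \<le> emeasure Q Y + ennreal \<delta>"
proof -
  have Q': "prob_space Q" "sets Q = sets S" "space Q = space S"
    using Q sets_eq_imp_space_eq[of Q S] by (auto simp: space_prob_algebra)
  have "emeasure (Q \<bind> K) X = (\<integral>\<^sup>+z. emeasure (K z) X \<partial>Q)"
    by (rule emeasure_bind_prob_algebra[OF Q K X])
  also have "\<dots> \<le> (\<integral>\<^sup>+z. indicator Y z + ennreal \<delta> \<partial>Q)"
  proof (rule nn_integral_mono)
    fix z assume "z \<in> space Q"
    then have z: "z \<in> space S" by (simp add: Q')
    have "prob_space (K z)" using measurable_space[OF K z] by (simp add: space_prob_algebra)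
    then have "emeasure (K z) X \<le> 1" by (simp add: prob_space.emeasure_le_1)
    then show "emeasure (K z) X \<le> indicator Y z + ennreal \<delta>"
      using le[OF z] by (cases "z \<in> Y") (auto intro: add_increasing2)
  qed
  also have "\<dots> = emeasure Q Y + ennreal \<delta>"
    using Y by (subst nn_integral_add)
      (auto simp: Q'(2) prob_space.emeasure_space_1[OF Q'(1)] intro!: borel_measurable_indicator)
  finally show ?thesis .
qed

section \<open>The multilevel algorithm\<close>

lemma level_k_nonneg: "0 \<le> level_k n B p z x"
  by (simp add: level_k_def sum_squares_nonneg)

lemma level_weight_nonneg: "0 \<le> level_weight \<mu> n B p z x"
  by (simp add: level_weight_def sampling_weight_nonneg level_k_nonneg)

lemma level_weight_restrict:
  assumes "p \<le> r"
  shows "level_weight \<mu> n B p (restrict z {1..r}) = level_weight \<mu> n B p z"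
proof -
  have "restrict (restrict z {1..r}) {1..p} = restrict z {1..p}"
    using assms by (auto simp: restrict_def fun_eq_iff)
  then show ?thesis by (simp add: level_weight_def level_k_def)
qed

lemma level_inner_restrict:
  assumes "p \<in> {1..r}"
  shows "level_inner \<mu> n M B p (restrict z {1..r}) = level_inner \<mu> n M B p z"
proof -
  have "p - 1 \<le> r" using assms by auto
  then show ?thesis using assms by (simp add: level_inner_def level_weight_restrict)
qed

lemma regular_upto_restrict:
  "p \<le> r \<Longrightarrow> regular_upto \<mu> L n M B p (restrict z {1..r}) = regular_upto \<mu> L n M B p z"
  unfolding regular_upto_def by (intro ball_cong refl) (simp add: level_inner_restrict)

lemma restrict_offline_space:
  "z \<in> space (offline_space \<mu> M p) \<Longrightarrow> restrict z {1..p} = z"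
  by (simp add: offline_space_def space_PiM PiE_restrict)

lemma restrict_in_offline_space:
  "z \<in> space (offline_space \<mu> M r) \<Longrightarrow> p \<le> r \<Longrightarrow> restrict z {1..p} \<in> space (offline_space \<mu> M p)"
  by (auto simp: offline_space_def space_PiM PiE_iff)

lemma measurable_restrict_offline:
  "p \<le> r \<Longrightarrow> (\<lambda>z. restrict z {1..p}) \<in> offline_space \<mu> M r \<rightarrow>\<^sub>M offline_space \<mu> M p"
  unfolding offline_space_def by (intro measurable_restrict_subset) auto

lemma measurable_offline_draw:
  assumes "r \<in> {1..p}" "i \<in> {1..M r}"
  shows "(\<lambda>z. z r i) \<in> offline_space \<mu> M p \<rightarrow>\<^sub>M \<mu>"
proof -
  have "(\<lambda>z. z r) \<in> offline_space \<mu> M p \<rightarrow>\<^sub>M (\<Pi>\<^sub>M i\<in>{1..M r}. \<mu>)"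
    unfolding offline_space_def using assms(1) by measurable
  then show ?thesis using assms(2) by measurable
qed

locale multilevel = prob_space \<mu> for \<mu> :: "'a measure" +
  fixes L :: "nat \<Rightarrow> 'a \<Rightarrow> real" and n M :: "nat \<Rightarrow> nat"
    and B :: "nat \<Rightarrow> (nat \<Rightarrow> nat \<Rightarrow> 'a) \<Rightarrow> nat \<Rightarrow> 'a \<Rightarrow> real"
    and q :: nat
    and \<sigma> :: "nat \<Rightarrow> (nat \<Rightarrow> nat \<Rightarrow> 'a) \<Rightarrow> 'a measure"
  assumes square_integrable_L: "\<And>j. 1 \<le> j \<Longrightarrow> square_integrable \<mu> (L j)"
    and orthonormal_L: "\<And>j k. 1 \<le> j \<Longrightarrow> 1 \<le> k \<Longrightarrow> (\<integral>x. L j x * L k x \<partial>\<mu>) = identity_matrix j k"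
    and n_pos: "\<And>p. 1 \<le> p \<Longrightarrow> 0 < n p"
    and algorithm: "multilevel_algorithm \<mu> L n M B q \<sigma>"
begin

abbreviation "weight \<equiv> level_weight \<mu> n B"
abbreviation "regular \<equiv> regular_upto \<mu> L n M B"
abbreviation "offline \<equiv> offline_space \<mu> M"
abbreviation "level_gram p z \<equiv> gram (level_inner \<mu> n M B p z) L"

lemma L_measurable [measurable]: "1 \<le> j \<Longrightarrow> L j \<in> borel_measurable \<mu>"
  using square_integrable_L by (simp add: square_integrable_def)

lemma L_measurable' : "j \<in> {1..N} \<Longrightarrow> L j \<in> borel_measurable \<mu>"
  by (simp add: L_measurable)

lemma integrable_product:
  assumes "square_integrable \<mu> f" "square_integrable \<mu> g"
  shows "integrable \<mu> (\<lambda>x. f x * g x)"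
proof -
  have [measurable]: "f \<in> borel_measurable \<mu>" "g \<in> borel_measurable \<mu>"
    using assms by (simp_all add: square_integrable_def)
  have "integrable \<mu> (\<lambda>x. (f x)\<^sup>2 + (g x)\<^sup>2)"
    using assms by (simp add: square_integrable_def)
  then show ?thesis
  proof (rule Bochner_Integration.integrable_bound)
    have "\<bar>f x * g x\<bar> \<le> (f x)\<^sup>2 + (g x)\<^sup>2" for x
    proof -
      have "2 * \<bar>f x * g x\<bar> \<le> (f x)\<^sup>2 + (g x)\<^sup>2"
        using zero_le_power2[of "\<bar>f x\<bar> - \<bar>g x\<bar>"] by (simp add: power2_diff abs_mult)
      then show ?thesis by linarith
    qed
    then show "AE x in \<mu>. norm (f x * g x) \<le> norm ((f x)\<^sup>2 + (g x)\<^sup>2)" by simp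
  qed simp
qed

lemma square_integrable_lin_comb: "square_integrable \<mu> (lin_comb N L c)"
proof -
  have "lin_comb N L c \<in> borel_measurable \<mu>"
    unfolding lin_comb_def by (intro borel_measurable_sum borel_measurable_times measurable_const L_measurable) auto
  moreover have "(\<lambda>x. (lin_comb N L c x)\<^sup>2) = (\<lambda>x. \<Sum>j=1..N. \<Sum>k=1..N. c j * c k * (L j x * L k x))"
    by (simp add: lin_comb_def power2_eq_square sum_product mult_ac)
  moreover have "integrable \<mu> (\<lambda>x. \<Sum>j=1..N. \<Sum>k=1..N. c j * c k * (L j x * L k x))"
    by (intro Bochner_Integration.integrable_sum integrable_mult_right integrable_product square_integrable_L) auto
  ultimately show ?thesis by (simp add: square_integrable_def)
qed

lemma integral_times_lin_comb:
  assumes "square_integrable \<mu> f"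
  shows "(\<integral>x. f x * lin_comb N L c x \<partial>\<mu>) = (\<Sum>j=1..N. c j * (\<integral>x. f x * L j x \<partial>\<mu>))"
proof -
  have "(\<integral>x. f x * lin_comb N L c x \<partial>\<mu>) = (\<integral>x. (\<Sum>j=1..N. c j * (f x * L j x)) \<partial>\<mu>)"
    by (simp add: lin_comb_def sum_distrib_left mult.left_commute)
  also have "\<dots> = (\<Sum>j=1..N. \<integral>x. c j * (f x * L j x) \<partial>\<mu>)"
    using assms
    by (intro Bochner_Integration.integral_sum integrable_mult_right integrable_product square_integrable_L) auto
  finally show ?thesis by simp
qed

lemma integral_L_times_lin_comb:
  assumes "k \<in> {1..N}"
  shows "(\<integral>x. L k x * lin_comb N L c x \<partial>\<mu>) = c k"
proof -
  have "(\<integral>x. L k x * lin_comb N L c x \<partial>\<mu>) = dot N (identity_matrix k) c"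
    using assms
    by (simp add: integral_times_lin_comb square_integrable_L orthonormal_L dot_def identity_matrix_def
        if_distrib[of "\<lambda>x. _ * x"] if_distrib[of "\<lambda>x. x * _"] cong: if_cong)
  then show ?thesis using dot_identity_matrix[OF assms] by simp
qed

lemma lin_comb_independent:
  assumes "\<And>x. x \<in> space \<mu> \<Longrightarrow> lin_comb N L c x = 0"
  shows "\<forall>k\<in>{1..N}. c k = 0"
proof
  fix k assume "k \<in> {1..N}"
  then have "c k = (\<integral>x. L k x * lin_comb N L c x \<partial>\<mu>)" by (simp add: integral_L_times_lin_comb)
  also have "\<dots> = (\<integral>x. 0 \<partial>\<mu>)" using assms by (intro Bochner_Integration.integral_cong) auto
  finally show "c k = 0" by simp
qed

lemma regular_Suc_iff:
  "regular (Suc p) z \<longleftrightarrow> regular p z \<and>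
     (\<exists>i :: nat. psd (n (Suc p)) (\<lambda>j k. level_gram (Suc p) z j k - inverse (real (Suc i)) * identity_matrix j k))"
proof -
  have "inner_product_on (space \<mu>) (lin_span (n (Suc p)) L) (level_inner \<mu> n M B (Suc p) z) \<longleftrightarrow>
     (\<exists>i :: nat. psd (n (Suc p)) (\<lambda>j k. level_gram (Suc p) z j k - inverse (real (Suc i)) * identity_matrix j k))"
    unfolding level_inner_def
    by (subst inner_product_on_iff_positive_definite[OF level_weight_nonneg lin_comb_independent])
      (assumption, rule positive_definite_iff_psd[OF symmetric_gram_empirical])
  then show ?thesis
    by (auto simp: regular_upto_def atLeastAtMostSuc_conv)
qed

lemma basis_of_regular:
  assumes "p \<in> {1..q}" "z \<in> space (offline p)" "regular p z"
  shows "orthonormal_basis (level_inner \<mu> n M B p z) (lin_span (n p) L) (n p) (B p z)"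
    and "\<sigma> p z = sampling_measure \<mu> (n p) (level_k n B p z)"
  using algorithm assms unfolding multilevel_algorithm_def by blast+

lemma level_k_eq: "z \<in> space (offline p) \<Longrightarrow> level_k n B p z = sum_squares (n p) (B p z)"
  by (simp add: level_k_def restrict_offline_space)

lemma level_k_le_iff_psd:
  assumes "p \<in> {1..q}" "z \<in> space (offline p)" "regular p z"
  shows "level_k n B p z x \<le> t \<longleftrightarrow> psd (n p) (\<lambda>j k. t * level_gram p z j k - L j x * L k x)"
proof -
  have "n p > 0" using assms n_pos by simp
  then show ?thesis
    using sum_squares_orthonormal_basis_le_iff[OF basis_of_regular(1)[OF assms, unfolded level_inner_def]]
    unfolding level_k_eq[OF assms(2)] psd_def quad_linear level_inner_def
    by (simp add: lin_comb_eq_dot dot_commute)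
qed

lemma borel_measurable_empirical_gram:
  assumes f: "f \<in> borel_measurable (S \<Otimes>\<^sub>M \<mu>)" and r: "r \<in> T \<rightarrow>\<^sub>M S"
    and y: "\<And>i. i \<in> {1..N} \<Longrightarrow> (\<lambda>\<omega>. y \<omega> i) \<in> T \<rightarrow>\<^sub>M \<mu>"
    and jk: "1 \<le> j" "1 \<le> k"
  shows "(\<lambda>\<omega>. gram (empirical_inner N (\<lambda>x. f (r \<omega>, x)) (y \<omega>)) L j k) \<in> borel_measurable T"
  unfolding gram_def empirical_inner_def
  by (intro borel_measurable_times borel_measurable_sum borel_measurable_const
      measurable_compose[OF measurable_Pair[OF r y] f] measurable_compose[OF y L_measurable] jk)

text \<open>Off the regular event the basis is arbitrary and the weight need not be measurable in the draws.
  The weight cut off there, and the Gram matrix computed with it, are measurable and agree with the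
  original ones on the regular event.\<close>

definition regular_weight :: "nat \<Rightarrow> (nat \<Rightarrow> nat \<Rightarrow> 'a) \<times> 'a \<Rightarrow> real" where
  "regular_weight p = (\<lambda>(z, x). if regular p z then weight p z x else 0)"

definition measurable_gram :: "nat \<Rightarrow> (nat \<Rightarrow> nat \<Rightarrow> 'a) \<Rightarrow> nat \<Rightarrow> nat \<Rightarrow> real" where
  "measurable_gram p z =
     gram (empirical_inner (M (Suc p)) (\<lambda>x. regular_weight p (restrict z {1..p}, x)) (z (Suc p))) L"

lemma level_gram_eq_measurable_gram:
  assumes "regular p z"
  shows "level_gram (Suc p) z = measurable_gram p z"
  using assms by (simp add: measurable_gram_def regular_weight_def level_inner_def
      regular_upto_restrict level_weight_restrict)

lemma borel_measurable_measurable_gram: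
  assumes "regular_weight p \<in> borel_measurable (offline p \<Otimes>\<^sub>M \<mu>)" "1 \<le> j" "1 \<le> k"
  shows "(\<lambda>z. measurable_gram p z j k) \<in> borel_measurable (offline (Suc p))"
  unfolding measurable_gram_def
  by (intro borel_measurable_empirical_gram[OF assms(1) measurable_restrict_offline] measurable_offline_draw
      assms) auto

text \<open>The two claims are proved together by induction on the level: the weight of a level determines
  the next Gram matrix, whose definiteness is the next regularity condition, and the next weight is
  determined by that Gram matrix through the extremal property.\<close>

lemma measurable_regular_and_weight:
  assumes "p \<le> q"
  shows "{z \<in> space (offline p). regular p z} \<in> sets (offline p)"
    and "regular_weight p \<in> borel_measurable (offline p \<Otimes>\<^sub>M \<mu>)"
proof -
  have "{z \<in> space (offline p). regular p z} \<in> sets (offline p) \<and>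
    regular_weight p \<in> borel_measurable (offline p \<Otimes>\<^sub>M \<mu>)"
    using assms
  proof (induction p)
    case 0
    then show ?case by (simp add: regular_weight_def regular_upto_def level_weight_def)
  next
    case (Suc p)
    have Rp: "{z \<in> space (offline p). regular p z} \<in> sets (offline p)"
      using Suc by simp
    define N where "N = n (Suc p)"
    define G where "G = measurable_gram p"
    note G_eq = level_gram_eq_measurable_gram[of p, folded G_def]
    have G_meas: "(\<lambda>z. G z j k) \<in> borel_measurable (offline (Suc p))"
      if "j \<in> {1..N}" "k \<in> {1..N}" for j k
      using Suc that unfolding G_def by (intro borel_measurable_measurable_gram) auto
    have reg_eq: "{z \<in> space (offline (Suc p)). regular (Suc p) z}
        = {z \<in> space (offline (Suc p)). regular p (restrict z {1..p}) \<and>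
            (\<exists>i :: nat. psd N (\<lambda>j k. G z j k - inverse (real (Suc i)) * identity_matrix j k))}"
      using G_eq by (auto simp: regular_Suc_iff regular_upto_restrict N_def)
    have "{z \<in> space (offline (Suc p)). regular p (restrict z {1..p})}
        = (\<lambda>z. restrict z {1..p}) -` {z \<in> space (offline p). regular p z} \<inter> space (offline (Suc p))"
      by (auto intro: restrict_in_offline_space)
    also have "\<dots> \<in> sets (offline (Suc p))"
      by (rule measurable_sets[OF measurable_restrict_offline Rp]) simp
    finally have R1: "{z \<in> space (offline (Suc p)). regular p (restrict z {1..p})} \<in> sets (offline (Suc p))" .
    have R2: "{z \<in> space (offline (Suc p)). psd N (\<lambda>j k. G z j k - inverse (real (Suc i)) * identity_matrix j k)}
        \<in> sets (offline (Suc p))" for i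
      by (rule sets_Collect_psd) (intro borel_measurable_diff G_meas borel_measurable_const)
    have R: "{z \<in> space (offline (Suc p)). regular (Suc p) z} \<in> sets (offline (Suc p))"
      unfolding reg_eq by (intro sets.sets_Collect_conj R1 sets.sets_Collect_countable_Ex R2)
    let ?S = "offline (Suc p) \<Otimes>\<^sub>M \<mu>"
    define KK where "KK = (\<lambda>(z, x). if regular (Suc p) z then level_k n B (Suc p) z x else 0)"
    have RS: "{\<omega> \<in> space ?S. regular (Suc p) (fst \<omega>)} \<in> sets ?S"
    proof -
      have "{\<omega> \<in> space ?S. regular (Suc p) (fst \<omega>)}
          = fst -` {z \<in> space (offline (Suc p)). regular (Suc p) z} \<inter> space ?S"
        by (auto simp: space_pair_measure)
      then show ?thesis using measurable_sets[OF measurable_fst R, of \<mu>] by simp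
    qed
    have KK: "KK \<in> borel_measurable ?S"
    proof (rule borel_measurable_iff_le[THEN iffD2], rule allI)
      fix t
      have "{\<omega> \<in> space ?S. KK \<omega> \<le> t}
          = {\<omega> \<in> space ?S. (regular (Suc p) (fst \<omega>) \<and>
              psd N (\<lambda>j k. t * G (fst \<omega>) j k - L j (snd \<omega>) * L k (snd \<omega>)))
            \<or> (\<not> regular (Suc p) (fst \<omega>) \<and> 0 \<le> t)}"
      proof (rule Collect_cong, rule conj_cong[OF refl])
        fix \<omega> assume "\<omega> \<in> space ?S"
        then have z: "fst \<omega> \<in> space (offline (Suc p))" by (auto simp: space_pair_measure)
        have KK_\<omega>: "KK \<omega> = (if regular (Suc p) (fst \<omega>) then level_k n B (Suc p) (fst \<omega>) (snd \<omega>) else 0)"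
          by (simp add: KK_def split_beta)
        show "KK \<omega> \<le> t \<longleftrightarrow> (regular (Suc p) (fst \<omega>) \<and>
              psd N (\<lambda>j k. t * G (fst \<omega>) j k - L j (snd \<omega>) * L k (snd \<omega>)))
            \<or> (\<not> regular (Suc p) (fst \<omega>) \<and> 0 \<le> t)"
        proof (cases "regular (Suc p) (fst \<omega>)")
          case True
          then have "level_gram (Suc p) (fst \<omega>) = G (fst \<omega>)" by (simp add: regular_Suc_iff G_eq)
          with True Suc.prems z show ?thesis
            by (simp add: KK_\<omega> level_k_le_iff_psd N_def)
        qed (simp add: KK_\<omega>)
      qed
      also have "\<dots> \<in> sets ?S"
      proof (intro sets.sets_Collect RS)
        show "{\<omega> \<in> space ?S. psd N (\<lambda>j k. t * G (fst \<omega>) j k - L j (snd \<omega>) * L k (snd \<omega>))} \<in> sets ?S"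
        proof (rule sets_Collect_psd)
          fix j k assume jk: "j \<in> {1..N}" "k \<in> {1..N}"
          note [measurable] = G_meas[OF jk] L_measurable'[OF jk(1)] L_measurable'[OF jk(2)]
          show "(\<lambda>\<omega>. t * G (fst \<omega>) j k - L j (snd \<omega>) * L k (snd \<omega>)) \<in> borel_measurable ?S"
            by measurable
        qed
      qed
      finally show "{\<omega> \<in> space ?S. KK \<omega> \<le> t} \<in> sets ?S" .
    qed
    define \<alpha> where "\<alpha> = (\<lambda>z. inverse (\<integral>x. KK (z, x) / real N \<partial>\<mu>))"
    have [measurable]: "\<alpha> \<in> borel_measurable (offline (Suc p))"
      unfolding \<alpha>_def using KK by measurable
    have "(\<lambda>\<omega>. if regular (Suc p) (fst \<omega>) then real N / (\<alpha> (fst \<omega>) * KK \<omega>) else 0) \<in> borel_measurable ?S"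
      by (intro measurable_If borel_measurable_const RS) (use KK in measurable)
    also have "(\<lambda>\<omega>. if regular (Suc p) (fst \<omega>) then real N / (\<alpha> (fst \<omega>) * KK \<omega>) else 0)
        = regular_weight (Suc p)"
      by (auto simp: regular_weight_def fun_eq_iff level_weight_def sampling_weight_def normalization_def \<alpha>_def KK_def N_def)
    finally show ?case using R by blast
  qed
  then show "{z \<in> space (offline p). regular p z} \<in> sets (offline p)"
    and "regular_weight p \<in> borel_measurable (offline p \<Otimes>\<^sub>M \<mu>)"
    by auto
qed

end

section \<open>Accurate levels\<close>

context multilevel
begin

definition close :: "nat \<Rightarrow> (nat \<Rightarrow> nat \<Rightarrow> 'a) \<Rightarrow> bool" where
  "close p z \<longleftrightarrow> near_identity (n p) (level_gram p z)"

text \<open>The events along which the algorithm is followed. There is no Gram matrix at level \<open>0\<close>.\<close>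

definition accurate :: "nat \<Rightarrow> (nat \<Rightarrow> nat \<Rightarrow> 'a) \<Rightarrow> bool" where
  "accurate p z \<longleftrightarrow> regular p z \<and> (p = 0 \<or> close p z)"

text \<open>A Gram matrix within \<open>1/2\<close> of the identity is positive definite, so regularity propagates.\<close>

lemma accurate_SucI:
  assumes "regular p z" "close (Suc p) z"
  shows "accurate (Suc p) z"
proof -
  have "1/2 * dot (n (Suc p)) c c \<le> quad (n (Suc p)) (level_gram (Suc p) z) c" for c
    using assms(2) unfolding close_def level_inner_def by (intro gram_close_to_identity)
  then have "psd (n (Suc p)) (\<lambda>j k. level_gram (Suc p) z j k - inverse (real (Suc 1)) * identity_matrix j k)"
    unfolding psd_def quad_linear by simp
  then have "regular (Suc p) z" unfolding regular_Suc_iff using assms(1) by blast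
  then show ?thesis using assms by (simp add: accurate_def)
qed

lemma sets_accurate:
  assumes "p \<le> q"
  shows "{z \<in> space (offline p). accurate p z} \<in> sets (offline p)"
proof (cases p)
  case 0
  then show ?thesis using measurable_regular_and_weight(1)[of 0] by (simp add: accurate_def)
next
  case (Suc r)
  let ?S = "offline (Suc r)"
  have "{z \<in> space ?S. near_identity (n (Suc r)) (measurable_gram r z)} \<in> sets ?S"
    using Suc assms
    by (intro sets_Collect_spectral_norm_le borel_measurable_measurable_gram measurable_regular_and_weight)
      (auto simp: measurable_gram_def symmetric_gram_empirical)
  moreover have "{z \<in> space ?S. regular (Suc r) z} \<in> sets ?S"
    using Suc assms by (intro measurable_regular_and_weight) simp
  moreover have "{z \<in> space (offline p). accurate p z} = {z \<in> space ?S. regular (Suc r) z} \<inter>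
     {z \<in> space ?S. near_identity (n (Suc r)) (measurable_gram r z)}"
    by (auto simp: Suc accurate_def close_def regular_Suc_iff level_gram_eq_measurable_gram)
  ultimately show ?thesis by (simp add: Suc)
qed

lemma sigma_prob_space:
  assumes "p \<le> q" "z \<in> space (offline p)"
  shows "prob_space (\<sigma> p z)" and "sets (\<sigma> p z) = sets \<mu>"
proof -
  have "\<sigma> p \<in> offline p \<rightarrow>\<^sub>M prob_algebra \<mu>" using algorithm assms by (auto simp: multilevel_algorithm_def)
  from measurable_space[OF this assms(2)] show "prob_space (\<sigma> p z)" "sets (\<sigma> p z) = sets \<mu>"
    by (simp_all add: space_prob_algebra)
qed

lemma sets_PiM_sigma:
  "p \<le> q \<Longrightarrow> z \<in> space (offline p) \<Longrightarrow> sets (\<Pi>\<^sub>M i\<in>I. \<sigma> p z) = sets (\<Pi>\<^sub>M i\<in>I. \<mu>)"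
  by (intro sets_PiM_cong refl sigma_prob_space)

lemma space_PiM_sigma:
  "p \<le> q \<Longrightarrow> z \<in> space (offline p) \<Longrightarrow> space (\<Pi>\<^sub>M i\<in>I. \<sigma> p z) = space (\<Pi>\<^sub>M i\<in>I. \<mu>)"
  by (intro sets_eq_imp_space_eq sets_PiM_sigma)

lemma integral_sum_squares_L: "(\<integral>x. sum_squares N L x \<partial>\<mu>) = real N"
  and integrable_sum_squares_L: "integrable \<mu> (sum_squares N L)"
proof -
  have int: "integrable \<mu> (\<lambda>x. (L j x)\<^sup>2)" if "j \<in> {1..N}" for j
    using that square_integrable_L by (simp add: square_integrable_def)
  have eq: "sum_squares N L = (\<lambda>x. \<Sum>j=1..N. (L j x)\<^sup>2)"
    by (simp add: sum_squares_def fun_eq_iff)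
  show "integrable \<mu> (sum_squares N L)"
    unfolding eq by (intro Bochner_Integration.integrable_sum int)
  have "(\<integral>x. (L j x)\<^sup>2 \<partial>\<mu>) = 1" if "j \<in> {1..N}" for j
    using orthonormal_L[of j j] that by (simp add: power2_eq_square identity_matrix_def)
  then show "(\<integral>x. sum_squares N L x \<partial>\<mu>) = real N"
    unfolding eq by (subst Bochner_Integration.integral_sum) (use int in auto)
qed

lemma weight_eq: "p \<noteq> 0 \<Longrightarrow> weight p z = sampling_weight \<mu> (n p) (level_k n B p z)"
  by (simp add: level_weight_def)

context
  fixes p :: nat and z :: "nat \<Rightarrow> nat \<Rightarrow> 'a"
  assumes p: "p \<in> {1..q}" and z: "z \<in> space (offline p)" and acc: "accurate p z"
begin

lemma accurate_level_k_comparison: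
  "level_k n B p z x \<le> 2 * sum_squares (n p) L x"
  "2/3 * sum_squares (n p) L x \<le> level_k n B p z x"
proof -
  have on: "orthonormal_basis (empirical_inner (M p) (weight (p - 1) z) (z p)) (lin_span (n p) L) (n p) (B p z)"
    using basis_of_regular(1)[OF p z] acc by (simp add: accurate_def level_inner_def)
  have "n p > 0" using p n_pos by simp
  moreover have "near_identity (n p) (gram (empirical_inner (M p) (weight (p - 1) z) (z p)) L)"
    using acc p by (simp add: accurate_def close_def level_inner_def)
  ultimately show "level_k n B p z x \<le> 2 * sum_squares (n p) L x"
    "2/3 * sum_squares (n p) L x \<le> level_k n B p z x"
    unfolding level_k_eq[OF z] using sum_squares_comparison[OF on] by blast+
qed

lemma borel_measurable_level_k [measurable]: "level_k n B p z \<in> borel_measurable \<mu>"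
proof -
  have "B p z j \<in> borel_measurable \<mu>" if "j \<in> {1..n p}" for j
  proof -
    have "B p z j \<in> lin_span (n p) (B p z)"
      using lin_comb_identity[OF that, of "B p z"] by (metis lin_span_eq_range rangeI)
    then have "B p z j \<in> lin_span (n p) L"
      using basis_of_regular(1)[OF p z] acc by (simp add: accurate_def orthonormal_basis_def)
    then obtain c where "B p z j = lin_comb (n p) L c" by (auto simp: lin_span_eq_range)
    then show ?thesis using square_integrable_lin_comb by (simp add: square_integrable_def)
  qed
  then show ?thesis
    unfolding level_k_eq[OF z] sum_squares_def[abs_def] by (intro borel_measurable_sum borel_measurable_power)
qed

lemma borel_measurable_weight: "weight p z \<in> borel_measurable \<mu>"
  using p unfolding level_weight_def sampling_weight_def[abs_def] by simp

lemma normalization_bounds: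
  "0 < (\<integral>x. level_k n B p z x / real (n p) \<partial>\<mu>)" "(\<integral>x. level_k n B p z x / real (n p) \<partial>\<mu>) \<le> 2"
proof -
  have N: "n p > 0" using p n_pos by simp
  have int: "integrable \<mu> (\<lambda>x. level_k n B p z x / real (n p))"
  proof (rule Bochner_Integration.integrable_bound)
    show "integrable \<mu> (\<lambda>x. 2 * sum_squares (n p) L x / real (n p))"
      using integrable_sum_squares_L by simp
    show "AE x in \<mu>. norm (level_k n B p z x / real (n p)) \<le> norm (2 * sum_squares (n p) L x / real (n p))"
      using accurate_level_k_comparison(1) N
      by (auto simp: level_k_nonneg sum_squares_nonneg divide_right_mono)
  qed simp
  have "2/3 = (\<integral>x. 2/3 * sum_squares (n p) L x / real (n p) \<partial>\<mu>)"
    using N integral_sum_squares_L[of "n p"] by simp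
  also have "\<dots> \<le> (\<integral>x. level_k n B p z x / real (n p) \<partial>\<mu>)"
    using integrable_sum_squares_L int accurate_level_k_comparison(2)
    by (intro integral_mono divide_right_mono) auto
  finally show "0 < (\<integral>x. level_k n B p z x / real (n p) \<partial>\<mu>)"
    by linarith
  have "(\<integral>x. level_k n B p z x / real (n p) \<partial>\<mu>) \<le> (\<integral>x. 2 * sum_squares (n p) L x / real (n p) \<partial>\<mu>)"
    using integrable_sum_squares_L int accurate_level_k_comparison(1)
    by (intro integral_mono divide_right_mono) auto
  also have "\<dots> = 2" using N integral_sum_squares_L[of "n p"] by simp
  finally show "(\<integral>x. level_k n B p z x / real (n p) \<partial>\<mu>) \<le> 2" .
qed

text \<open>The normalization contributes at most the factor \<open>2\<close>, the comparison of \<open>k\<close> with its empirical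
  version the factor \<open>3/2\<close>.\<close>

lemma weight_times_sum_squares_le: "weight p z x * sum_squares (n p) L x \<le> 3 * real (n p)"
proof -
  define a where "a = (\<integral>x. level_k n B p z x / real (n p) \<partial>\<mu>)"
  have a: "0 < a" "a \<le> 2" using normalization_bounds by (simp_all add: a_def)
  have w: "weight p z x = real (n p) * a / level_k n B p z x"
  proof -
    have "p \<noteq> 0" using p by simp
    then show ?thesis
      unfolding weight_eq[OF \<open>p \<noteq> 0\<close>] sampling_weight_def normalization_def a_def[symmetric]
      by (simp add: divide_inverse)
  qed
  show ?thesis
  proof (cases "level_k n B p z x = 0")
    case False
    then have k: "level_k n B p z x > 0" using level_k_nonneg[of n B p z x] by simp
    have "a * sum_squares (n p) L x \<le> 2 * (3/2 * level_k n B p z x)"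
      using a accurate_level_k_comparison(2)[of x] sum_squares_nonneg[of "n p" L x] k
      by (intro mult_mono) auto
    then have "real (n p) * (a * sum_squares (n p) L x) \<le> real (n p) * (3 * level_k n B p z x)"
      by (intro mult_left_mono) auto
    then show ?thesis using k by (simp add: w field_simps)
  qed (simp add: w)
qed

lemma
  assumes "h \<in> borel_measurable \<mu>" "\<And>x. x \<in> space \<mu> \<Longrightarrow> sum_squares (n p) L x = 0 \<Longrightarrow> h x = 0"
  shows integral_weight_sigma: "(\<integral>x. weight p z x * h x \<partial>\<sigma> p z) = (\<integral>x. h x \<partial>\<mu>)"
    and integrable_weight_sigma: "integrable (\<sigma> p z) (\<lambda>x. weight p z x * h x) \<longleftrightarrow> integrable \<mu> h"
proof -
  have \<sigma>: "\<sigma> p z = sampling_measure \<mu> (n p) (level_k n B p z)"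
    using basis_of_regular(2)[OF p z] acc by (simp add: accurate_def)
  have hz: "h x = 0" if "x \<in> space \<mu>" "level_k n B p z x = 0" for x
    using assms(2)[OF that(1)] accurate_level_k_comparison(2)[of x] sum_squares_nonneg[of "n p" L x] that(2)
    by simp
  have pos: "n p > 0" "p \<noteq> 0" using p n_pos by auto
  note conditions = borel_measurable_level_k assms(1) level_k_nonneg pos(1) normalization_bounds(1) hz
  show "(\<integral>x. weight p z x * h x \<partial>\<sigma> p z) = (\<integral>x. h x \<partial>\<mu>)"
    unfolding \<sigma> weight_eq[OF pos(2)] by (rule integral_sampling_measure[OF conditions])
  show "integrable (\<sigma> p z) (\<lambda>x. weight p z x * h x) \<longleftrightarrow> integrable \<mu> h"
    unfolding \<sigma> weight_eq[OF pos(2)] by (rule integrable_sampling_measure[OF conditions])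
qed

end

section \<open>Joint law of the draws\<close>

lemma measurable_append_level:
  "(\<lambda>(z, y). z(Suc p := y)) \<in> offline p \<Otimes>\<^sub>M (\<Pi>\<^sub>M i\<in>{1..M (Suc p)}. \<mu>) \<rightarrow>\<^sub>M offline (Suc p)"
  using measurable_add_dim[of "Suc p" "{1..p}" "\<lambda>r. \<Pi>\<^sub>M i\<in>{1..M r}. \<mu>"]
  by (simp add: offline_space_def atLeastAtMostSuc_conv)

lemma measurable_offline_step:
  assumes "Suc p \<le> q"
  shows "(\<lambda>z. distr (\<Pi>\<^sub>M i\<in>{1..M (Suc p)}. \<sigma> p z) (offline (Suc p)) (\<lambda>y. z(Suc p := y)))
    \<in> offline p \<rightarrow>\<^sub>M prob_algebra (offline (Suc p))"
proof (rule measurable_distr_prob_space2)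
  have "\<sigma> p \<in> offline p \<rightarrow>\<^sub>M prob_algebra \<mu>" using algorithm assms by (auto simp: multilevel_algorithm_def)
  then show "(\<lambda>z. \<Pi>\<^sub>M i\<in>{1..M (Suc p)}. \<sigma> p z) \<in> offline p \<rightarrow>\<^sub>M prob_algebra (\<Pi>\<^sub>M i\<in>{1..M (Suc p)}. \<mu>)"
    by (rule measurable_PiM_kernel) simp
qed (rule measurable_append_level)

lemma offline_law_in_prob_algebra:
  "p \<le> q \<Longrightarrow> offline_law \<mu> M \<sigma> p \<in> space (prob_algebra (offline p))"
proof (induction p)
  case 0
  have "(\<lambda>_. undefined) \<in> space (offline 0)" by (simp add: offline_space_def)
  then show ?case by (simp add: space_prob_algebra prob_space_return)
next
  case (Suc p)
  then have "offline_law \<mu> M \<sigma> p \<in> space (prob_algebra (offline p))" by simp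
  from prob_space_bind'[OF this measurable_offline_step[OF Suc.prems]]
    sets_bind'[OF this measurable_offline_step[OF Suc.prems]]
  show ?case by (simp add: space_prob_algebra)
qed

abbreviation (input) "joint_space (m :: nat) \<equiv> offline q \<Otimes>\<^sub>M (\<Pi>\<^sub>M i\<in>{1..m}. \<mu>)"

lemma measurable_online_step:
  "(\<lambda>z. distr (\<Pi>\<^sub>M i\<in>{1..m}. \<sigma> q z) (joint_space m) (\<lambda>x. (z, x)))
    \<in> offline q \<rightarrow>\<^sub>M prob_algebra (joint_space m)"
proof (rule measurable_distr_prob_space2)
  have "\<sigma> q \<in> offline q \<rightarrow>\<^sub>M prob_algebra \<mu>" using algorithm by (auto simp: multilevel_algorithm_def)
  then show "(\<lambda>z. \<Pi>\<^sub>M i\<in>{1..m}. \<sigma> q z) \<in> offline q \<rightarrow>\<^sub>M prob_algebra (\<Pi>\<^sub>M i\<in>{1..m}. \<mu>)"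
    by (rule measurable_PiM_kernel) simp
qed simp

lemma draws_law_in_prob_algebra:
  "draws_law \<mu> M \<sigma> q m \<in> space (prob_algebra (joint_space m))"
  using prob_space_bind'[OF offline_law_in_prob_algebra[OF order_refl] measurable_online_step]
    sets_bind'[OF offline_law_in_prob_algebra[OF order_refl] measurable_online_step]
  by (simp add: space_prob_algebra draws_law_def)

lemma sets_draws_law: "sets (draws_law \<mu> M \<sigma> q m) = sets (joint_space m)"
  and prob_space_draws_law: "prob_space (draws_law \<mu> M \<sigma> q m)"
  using draws_law_in_prob_algebra[of m] by (simp_all add: space_prob_algebra)

lemma nn_integral_draws_law:
  assumes f: "f \<in> borel_measurable (joint_space m)"
  shows "(\<integral>\<^sup>+\<omega>. f \<omega> \<partial>draws_law \<mu> M \<sigma> q m)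
    = (\<integral>\<^sup>+z. (\<integral>\<^sup>+x. f (z, x) \<partial>(\<Pi>\<^sub>M i\<in>{1..m}. \<sigma> q z)) \<partial>offline_law \<mu> M \<sigma> q)"
proof -
  have law: "sets (offline_law \<mu> M \<sigma> q) = sets (offline q)"
    using offline_law_in_prob_algebra[OF order_refl] by (simp add: space_prob_algebra)
  have "(\<integral>\<^sup>+\<omega>. f \<omega> \<partial>draws_law \<mu> M \<sigma> q m)
      = (\<integral>\<^sup>+z. (\<integral>\<^sup>+\<omega>. f \<omega> \<partial>distr (\<Pi>\<^sub>M i\<in>{1..m}. \<sigma> q z) (joint_space m) (\<lambda>x. (z, x))) \<partial>offline_law \<mu> M \<sigma> q)"
    unfolding draws_law_def
  proof (rule nn_integral_bind[OF f])
    show "(\<lambda>z. distr (\<Pi>\<^sub>M i\<in>{1..m}. \<sigma> q z) (joint_space m) (\<lambda>x. (z, x)))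
      \<in> offline_law \<mu> M \<sigma> q \<rightarrow>\<^sub>M subprob_algebra (joint_space m)"
      using measurable_prob_algebraD[OF measurable_online_step] by (simp cong: measurable_cong_sets add: law)
  qed
  also have "\<dots> = (\<integral>\<^sup>+z. (\<integral>\<^sup>+x. f (z, x) \<partial>(\<Pi>\<^sub>M i\<in>{1..m}. \<sigma> q z)) \<partial>offline_law \<mu> M \<sigma> q)"
  proof (rule nn_integral_cong)
    fix z assume "z \<in> space (offline_law \<mu> M \<sigma> q)"
    then have z: "z \<in> space (offline q)" using sets_eq_imp_space_eq[OF law] by simp
    have "(\<lambda>x. (z, x)) \<in> (\<Pi>\<^sub>M i\<in>{1..m}. \<sigma> q z) \<rightarrow>\<^sub>M joint_space m"
      using z by (simp cong: measurable_cong_sets add: sets_PiM_sigma)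
    then show "(\<integral>\<^sup>+\<omega>. f \<omega> \<partial>distr (\<Pi>\<^sub>M i\<in>{1..m}. \<sigma> q z) (joint_space m) (\<lambda>x. (z, x)))
        = (\<integral>\<^sup>+x. f (z, x) \<partial>(\<Pi>\<^sub>M i\<in>{1..m}. \<sigma> q z))"
      using f by (intro nn_integral_distr) simp_all
  qed
  finally show ?thesis .
qed

lemma good_event_eq:
  "good_event \<mu> L n M B q m = {\<omega> \<in> space (joint_space m). regular q (fst \<omega>) \<and> close q (fst \<omega>) \<and>
     near_identity (n q) (gram (empirical_inner m (weight q (fst \<omega>)) (snd \<omega>)) L)}"
  by (auto simp: good_event_def close_def online_inner_def)

lemma sets_good_event:
  assumes "q \<ge> 1"
  shows "good_event \<mu> L n M B q m \<in> sets (joint_space m)"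
proof -
  let ?J = "joint_space m"
  define A where "A = {z \<in> space (offline q). accurate q z}"
  have "fst -` A \<inter> space ?J \<in> sets ?J"
    using measurable_sets[OF measurable_fst sets_accurate[OF order_refl]] by (simp add: A_def)
  moreover have "{\<omega> \<in> space ?J. near_identity (n q) (gram (empirical_inner m (\<lambda>x. regular_weight q (fst \<omega>, x)) (snd \<omega>)) L)} \<in> sets ?J"
    by (intro sets_Collect_spectral_norm_le
          borel_measurable_empirical_gram[OF measurable_regular_and_weight(2)[OF order_refl] measurable_fst])
      (auto simp: symmetric_gram_empirical)
  moreover have "good_event \<mu> L n M B q m = (fst -` A \<inter> space ?J) \<inter>
    {\<omega> \<in> space ?J. near_identity (n q) (gram (empirical_inner m (\<lambda>x. regular_weight q (fst \<omega>, x)) (snd \<omega>)) L)}"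
    unfolding good_event_eq A_def accurate_def
    using assms by (auto simp: regular_weight_def space_pair_measure)
  ultimately show ?thesis by simp
qed

end

section \<open>Probability of the good event\<close>

locale multilevel_sampling = multilevel \<mu> L n M B q \<sigma>
  for \<mu> :: "'a measure" and L n M B q \<sigma> +
  fixes \<kappa> \<epsilon> :: real and eps :: "nat \<Rightarrow> real" and m :: nat
  assumes n_mono: "\<And>p. 1 \<le> p \<Longrightarrow> n p \<le> n (Suc p)"
    and kappa: "1 < \<kappa>"
    and k_first: "\<And>x. x \<in> space \<mu> \<Longrightarrow> sum_squares (n 1) L x \<le> 3 * \<kappa> * real (n 1)"
    and k_step: "\<And>p x. 1 \<le> p \<Longrightarrow> x \<in> space \<mu> \<Longrightarrow>
      sum_squares (n (Suc p)) L x \<le> \<kappa> * sum_squares (n p) L x"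
    and q_pos: "1 \<le> q"
    and eps_pos: "\<And>p. p \<in> {1..q} \<Longrightarrow> 0 < eps p"
    and epsilon_eq: "\<epsilon> = (\<Sum>p=1..q. eps p)" and epsilon_less_1: "\<epsilon> < 1"
    and M_bound: "\<And>p. p \<in> {1..q} \<Longrightarrow>
      3 * \<kappa> * gamma_const * real (n p) * ln (2 * real (n p) / eps p) \<le> real (M p)"
    and m_bound: "3 * gamma_const * real (n q) * ln (2 * real (n q) / \<epsilon>) \<le> real m"
begin

lemma eps_le_epsilon: "p \<in> {1..q} \<Longrightarrow> eps p \<le> \<epsilon>"
  unfolding epsilon_eq by (rule member_le_sum) (simp_all add: eps_pos less_imp_le)

lemma epsilon_pos: "0 < \<epsilon>"
  using eps_le_epsilon[of 1] eps_pos[of 1] q_pos by simp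

lemma sigma_0: "z \<in> space (offline 0) \<Longrightarrow> \<sigma> 0 z = \<mu>"
  using algorithm by (simp add: multilevel_algorithm_def)

lemma space_sigma: "p \<le> q \<Longrightarrow> z \<in> space (offline p) \<Longrightarrow> space (\<sigma> p z) = space \<mu>"
  by (intro sets_eq_imp_space_eq sigma_prob_space)

text \<open>Given the draws so far, new samples are independent with the weighted law under which the functions
  \<open>L\<^sub>j\<close> are orthonormal, so the matrix Chernoff bound applies with \<open>K\<close> bounding the weighted sum of
  squares. Orthonormality survives because the \<open>L\<^sub>j\<close> vanish wherever the sampling density does.\<close>

lemma sampling_concentration:
  assumes p: "p \<le> q" and z: "z \<in> space (offline p)" and acc: "accurate p z" and N: "0 < N"
    and bound: "\<And>x. x \<in> space \<mu> \<Longrightarrow> weight p z x * sum_squares N L x \<le> K" and K: "0 < K"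
    and vanish: "\<And>x. x \<in> space \<mu> \<Longrightarrow> 1 \<le> p \<Longrightarrow> sum_squares (n p) L x = 0 \<Longrightarrow> sum_squares N L x = 0"
    and \<delta>: "0 < \<delta>" "\<delta> < 1" and r: "gamma_const * K * ln (2 * real N / \<delta>) \<le> real r"
  shows "emeasure (\<Pi>\<^sub>M i\<in>{1..r}. \<sigma> p z) {y \<in> space (\<Pi>\<^sub>M i\<in>{1..r}. \<sigma> p z).
      \<not> near_identity N (gram (empirical_inner r (weight p z) y) L)} \<le> ennreal \<delta>"
proof -
  note \<sigma> = sigma_prob_space[OF p z] space_sigma[OF p z]
  have w: "weight p z \<in> borel_measurable \<mu>"
    by (cases "p = 0") (use borel_measurable_weight[OF _ z acc] p in \<open>auto simp: level_weight_def\<close>)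
  have iso: "(\<integral>x. weight p z x * L j x * L k x \<partial>\<sigma> p z) = identity_matrix j k"
    if jk: "j \<in> {1..N}" "k \<in> {1..N}" for j k
  proof (cases "p = 0")
    case True
    then show ?thesis using sigma_0 z orthonormal_L jk by (simp add: level_weight_def)
  next
    case False
    then have p1: "p \<in> {1..q}" using p by simp
    note [measurable] = L_measurable'[OF jk(1)] L_measurable'[OF jk(2)]
    have "L j x * L k x = 0" if x: "x \<in> space \<mu>" "sum_squares (n p) L x = 0" for x
      using vanish[of x] x p1 jk(1) by (simp add: sum_squares_eq_0)
    then have "(\<integral>x. weight p z x * (L j x * L k x) \<partial>\<sigma> p z) = (\<integral>x. L j x * L k x \<partial>\<mu>)"
      by (intro integral_weight_sigma[OF p1 z acc]) measurable
    then show ?thesis using orthonormal_L jk by (simp add: mult.assoc)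
  qed
  show ?thesis
  proof (rule prob_space.empirical_gram_concentration[OF \<sigma>(1), where K = K])
    show "weight p z \<in> borel_measurable (\<sigma> p z)" using w by (simp cong: measurable_cong_sets add: \<sigma>(2))
    show "L j \<in> borel_measurable (\<sigma> p z)" if "j \<in> {1..N}" for j
      using L_measurable'[OF that] by (simp cong: measurable_cong_sets add: \<sigma>(2))
  qed (use bound iso level_weight_nonneg K N \<delta> r \<sigma>(3) in auto)
qed

text \<open>The samples of level \<open>p + 1\<close> are drawn from the density adapted to level \<open>p\<close>; moving up one level costs
  the factor \<open>\<kappa>\<close>.\<close>

lemma offline_level_concentration:
  assumes p: "Suc p \<le> q" and z: "z \<in> space (offline p)" and acc: "accurate p z"
  shows "emeasure (\<Pi>\<^sub>M i\<in>{1..M (Suc p)}. \<sigma> p z) {y \<in> space (\<Pi>\<^sub>M i\<in>{1..M (Suc p)}. \<sigma> p z).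
      \<not> near_identity (n (Suc p)) (gram (empirical_inner (M (Suc p)) (weight p z) y) L)}
    \<le> ennreal (eps (Suc p))"
proof (rule sampling_concentration[where K = "3 * \<kappa> * real (n (Suc p))"])
  let ?N = "n (Suc p)"
  show pq: "p \<le> q" using p by simp
  show N: "0 < ?N" using n_pos by simp
  show "0 < 3 * \<kappa> * real ?N" using kappa N by simp
  show "weight p z x * sum_squares ?N L x \<le> 3 * \<kappa> * real ?N" if x: "x \<in> space \<mu>" for x
  proof (cases "p = 0")
    case True
    then show ?thesis using k_first[OF x] by (simp add: level_weight_def One_nat_def)
  next
    case False
    then have p1: "p \<in> {1..q}" using pq by simp
    have "weight p z x * sum_squares ?N L x \<le> weight p z x * (\<kappa> * sum_squares (n p) L x)"
      using k_step[of p x] x p1 by (intro mult_left_mono level_weight_nonneg) auto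
    also have "\<dots> = \<kappa> * (weight p z x * sum_squares (n p) L x)" by simp
    also have "\<dots> \<le> \<kappa> * (3 * real (n p))"
      using kappa weight_times_sum_squares_le[OF p1 z acc] by (intro mult_left_mono) auto
    also have "\<dots> \<le> \<kappa> * (3 * real ?N)"
      using kappa n_mono[of p] p1 by (intro mult_left_mono) auto
    finally show ?thesis by (simp add: mult_ac)
  qed
  show "sum_squares ?N L x = 0" if "x \<in> space \<mu>" "1 \<le> p" "sum_squares (n p) L x = 0" for x
    using k_step[of p x] that sum_squares_nonneg[of ?N L x] by simp
  show "0 < eps (Suc p)" "eps (Suc p) < 1"
    using eps_pos[of "Suc p"] eps_le_epsilon[of "Suc p"] epsilon_less_1 p by auto
  show "gamma_const * (3 * \<kappa> * real ?N) * ln (2 * real ?N / eps (Suc p)) \<le> real (M (Suc p))"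
    using M_bound[of "Suc p"] p by (simp add: mult_ac)
qed (use z acc in auto)

lemma online_concentration:
  assumes z: "z \<in> space (offline q)" and acc: "accurate q z"
  shows "emeasure (\<Pi>\<^sub>M i\<in>{1..m}. \<sigma> q z) {x \<in> space (\<Pi>\<^sub>M i\<in>{1..m}. \<sigma> q z).
      \<not> near_identity (n q) (gram (empirical_inner m (weight q z) x) L)} \<le> ennreal \<epsilon>"
proof (rule sampling_concentration[where K = "3 * real (n q)"])
  show "gamma_const * (3 * real (n q)) * ln (2 * real (n q) / \<epsilon>) \<le> real m"
    using m_bound by (simp add: mult_ac)
  show "weight q z x * sum_squares (n q) L x \<le> 3 * real (n q)" for x
    using q_pos by (intro weight_times_sum_squares_le z acc) auto
qed (use z acc n_pos q_pos epsilon_pos epsilon_less_1 in auto)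

lemma accurate_extend_iff:
  assumes "accurate p z"
  shows "accurate (Suc p) (z(Suc p := y)) \<longleftrightarrow>
    near_identity (n (Suc p)) (gram (empirical_inner (M (Suc p)) (weight p z) y) L)"
proof -
  have r: "restrict (z(Suc p := y)) {1..p} = restrict z {1..p}"
    by (auto simp: restrict_def fun_eq_iff)
  have "regular p (z(Suc p := y)) = regular p z"
    using regular_upto_restrict[of p p \<mu> L n M B "z(Suc p := y)"] regular_upto_restrict[of p p \<mu> L n M B z] r by simp
  moreover have "weight p (z(Suc p := y)) = weight p z"
    using level_weight_restrict[of p p \<mu> n B "z(Suc p := y)"] level_weight_restrict[of p p \<mu> n B z] r by simp
  ultimately show ?thesis
    using assms accurate_SucI[of p "z(Suc p := y)"]
    by (auto simp: accurate_def close_def level_inner_def)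
qed

text \<open>Failure probabilities of successive levels add up.\<close>

lemma offline_failure_probability:
  "p \<le> q \<Longrightarrow> emeasure (offline_law \<mu> M \<sigma> p) {z \<in> space (offline p). \<not> accurate p z} \<le> ennreal (\<Sum>r=1..p. eps r)"
proof (induction p)
  case 0
  then show ?case by (simp add: accurate_def regular_upto_def)
next
  case (Suc p)
  let ?Q = "offline_law \<mu> M \<sigma> p"
  have p: "p \<le> q" using Suc.prems by simp
  define X where "X = {z \<in> space (offline (Suc p)). \<not> accurate (Suc p) z}"
  define Y where "Y = {z \<in> space (offline p). \<not> accurate p z}"
  have X: "X \<in> sets (offline (Suc p))"
    using sets_accurate[OF Suc.prems] unfolding X_def by (rule sets.sets_Collect_neg)
  have Y: "Y \<in> sets (offline p)"
    using sets_accurate[OF p] unfolding Y_def by (rule sets.sets_Collect_neg)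
  have "emeasure (offline_law \<mu> M \<sigma> (Suc p)) X \<le> emeasure ?Q Y + ennreal (eps (Suc p))"
    unfolding offline_law.simps
  proof (rule emeasure_bind_le[OF offline_law_in_prob_algebra[OF p] measurable_offline_step[OF Suc.prems] X Y])
    fix z assume z: "z \<in> space (offline p)" and "z \<notin> Y"
    then have acc: "accurate p z" by (simp add: Y_def)
    let ?P = "\<Pi>\<^sub>M i\<in>{1..M (Suc p)}. \<sigma> p z"
    have upd: "(\<lambda>y. z(Suc p := y)) \<in> ?P \<rightarrow>\<^sub>M offline (Suc p)"
    proof -
      have "(\<lambda>y. (z, y)) \<in> ?P \<rightarrow>\<^sub>M offline p \<Otimes>\<^sub>M (\<Pi>\<^sub>M i\<in>{1..M (Suc p)}. \<mu>)"
        using z by (simp cong: measurable_cong_sets add: sets_PiM_sigma p)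
      from measurable_compose[OF this measurable_append_level] show ?thesis by simp
    qed
    have "(\<lambda>y. z(Suc p := y)) -` X \<inter> space ?P = {y \<in> space ?P.
        \<not> near_identity (n (Suc p)) (gram (empirical_inner (M (Suc p)) (weight p z) y) L)}"
      using measurable_space[OF upd] accurate_extend_iff[OF acc] by (auto simp: X_def)
    then show "emeasure (distr ?P (offline (Suc p)) (\<lambda>y. z(Suc p := y))) X \<le> ennreal (eps (Suc p))"
      using offline_level_concentration[OF Suc.prems z acc] by (simp add: emeasure_distr[OF upd X])
  qed
  also have "\<dots> \<le> ennreal (\<Sum>r=1..p. eps r) + ennreal (eps (Suc p))"
    using Suc.IH[OF p] by (simp add: Y_def)
  also have "\<dots> = ennreal (\<Sum>r=1..Suc p. eps r)"
  proof -
    have "0 \<le> (\<Sum>r=1..p. eps r)" "0 \<le> eps (Suc p)"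
      using p Suc.prems by (intro sum_nonneg less_imp_le eps_pos; simp)+
    then show ?thesis by (simp add: ennreal_plus)
  qed
  finally show ?case by (simp add: X_def)
qed

abbreviation "law \<equiv> draws_law \<mu> M \<sigma> q m"
abbreviation "good \<equiv> good_event \<mu> L n M B q m"
abbreviation "online_gram z x \<equiv> gram (empirical_inner m (weight q z) x) L"

lemma good_iff:
  "(z, x) \<in> good \<longleftrightarrow> (z, x) \<in> space (joint_space m) \<and> accurate q z \<and>
     near_identity (n q) (online_gram z x)"
  using q_pos by (auto simp: good_event_eq accurate_def)

lemma space_law: "space law = space (joint_space m)"
  by (rule sets_eq_imp_space_eq[OF sets_draws_law])

lemma good_failure_probability: "measure law (space law - good) \<le> 2 * \<epsilon>"
proof -
  let ?J = "joint_space m"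
  let ?Q = "offline_law \<mu> M \<sigma> q"
  define X where "X = space ?J - good"
  define Y where "Y = {z \<in> space (offline q). \<not> accurate q z}"
  have X: "X \<in> sets ?J" unfolding X_def using sets_good_event[OF q_pos] by auto
  have Y: "Y \<in> sets (offline q)"
    using sets_accurate[OF order_refl] unfolding Y_def by (rule sets.sets_Collect_neg)
  have "emeasure law X \<le> emeasure ?Q Y + ennreal \<epsilon>"
    unfolding draws_law_def
  proof (rule emeasure_bind_le[OF offline_law_in_prob_algebra[OF order_refl] measurable_online_step X Y])
    fix z assume z: "z \<in> space (offline q)" and "z \<notin> Y"
    then have acc: "accurate q z" by (simp add: Y_def)
    let ?P = "\<Pi>\<^sub>M i\<in>{1..m}. \<sigma> q z"
    have pair: "Pair z \<in> ?P \<rightarrow>\<^sub>M ?J"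
      using z by (simp cong: measurable_cong_sets add: sets_PiM_sigma)
    have "Pair z -` X \<inter> space ?P = {x \<in> space ?P. \<not> near_identity (n q) (online_gram z x)}"
      using acc z space_PiM_sigma[OF order_refl z, of "{1..m}"] by (auto simp: X_def good_iff space_pair_measure)
    then show "emeasure (distr ?P ?J (Pair z)) X \<le> ennreal \<epsilon>"
      using online_concentration[OF z acc] by (simp add: emeasure_distr[OF pair X])
  qed
  also have "\<dots> \<le> ennreal \<epsilon> + ennreal \<epsilon>"
    using offline_failure_probability[OF order_refl] by (simp add: Y_def epsilon_eq)
  also have "\<dots> = ennreal (2 * \<epsilon>)"
    using epsilon_pos by (simp flip: ennreal_plus)
  finally have "emeasure law X \<le> ennreal (2 * \<epsilon>)" .
  then show ?thesis
    using epsilon_pos by (simp add: measure_def X_def space_law enn2real_leI)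
qed

section \<open>Error of the weighted least-squares estimator\<close>

text \<open>The normal equations give \<open>\<langle>h, h\<rangle> = \<langle>g, h\<rangle>\<close> for the difference \<open>h\<close> of the estimator and another
  element of the space, and for the residual \<open>g\<close> of the latter. With \<open>\<langle>h, h\<rangle> \<ge> |d|\<^sup>2 / 2\<close> for the coefficients
  \<open>d\<close> of \<open>h\<close>, the Cauchy-Schwarz inequality bounds \<open>|d|\<close> by twice the length of the vector of the
  \<open>\<langle>g, L\<^sub>j\<rangle>\<close>. The normal equations are read off from perturbations of the minimizer by multiples of \<open>h\<close>.\<close>

lemma least_squares_stability:
  fixes c a :: "nat \<Rightarrow> real"
  assumes close: "near_identity N (gram (empirical_inner r w x) L)"
    and min: "\<And>v. v \<in> lin_span N L \<Longrightarrow>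
      (\<Sum>i=1..r. w (x i) * \<bar>u (x i) - lin_comb N L c (x i)\<bar>\<^sup>2) \<le> (\<Sum>i=1..r. w (x i) * \<bar>u (x i) - v (x i)\<bar>\<^sup>2)"
  shows "dot N (\<lambda>j. c j - a j) (\<lambda>j. c j - a j)
    \<le> 4 * (\<Sum>j=1..N. (empirical_inner r w x (\<lambda>y. u y - lin_comb N L a y) (L j))\<^sup>2)"
proof -
  define d where "d = (\<lambda>j. c j - a j)"
  define h where "h = lin_comb N L d"
  define g where "g = (\<lambda>y. u y - lin_comb N L a y)"
  define e where "e = (\<lambda>j. empirical_inner r w x g (L j))"
  define f where "f = (\<lambda>y. u y - lin_comb N L c y)"
  have f_eq: "f y = g y - h y" for y
    by (simp add: f_def g_def h_def d_def lin_comb_diff)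
  define S1 where "S1 = (\<Sum>i=1..r. w (x i) * f (x i) * h (x i))"
  define S2 where "S2 = (\<Sum>i=1..r. w (x i) * h (x i) * h (x i))"
  have ineq: "2 * t * S1 \<le> t\<^sup>2 * S2" for t
  proof -
    have v: "lin_comb N L (\<lambda>j. c j + t * d j) \<in> lin_span N L" by (simp add: lin_span_eq_range)
    have eq: "u y - lin_comb N L (\<lambda>j. c j + t * d j) y = f y - t * h y" for y
      by (simp add: f_def h_def lin_comb_add lin_comb_scale)
    have f: "u y - lin_comb N L c y = f y" for y by (simp add: f_def)
    have "(\<Sum>i=1..r. w (x i) * (f (x i))\<^sup>2) \<le> (\<Sum>i=1..r. w (x i) * (f (x i) - t * h (x i))\<^sup>2)"
      using min[OF v] by (simp only: eq f power2_abs)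
    also have "\<dots> = (\<Sum>i=1..r. w (x i) * (f (x i))\<^sup>2) - 2 * t * S1 + t\<^sup>2 * S2"
      by (simp add: S1_def S2_def sum_distrib_left power2_eq_square algebra_simps sum.distrib sum_subtractf)
    finally show ?thesis by simp
  qed
  have "S1 = 0"
  proof (rule ccontr)
    assume "S1 \<noteq> 0"
    \<comment> \<open>The choice \<open>t = S1 / C\<close> makes the linear term dominate the quadratic one.\<close>
    define C where "C = \<bar>S2\<bar> + 1"
    have C: "C > 0" "S2 \<le> C" by (auto simp: C_def)
    have "2 * (S1 / C) * S1 \<le> (S1 / C)\<^sup>2 * S2" by (rule ineq)
    also have "\<dots> \<le> (S1 / C)\<^sup>2 * C" using C by (intro mult_left_mono) auto
    also have "\<dots> = S1 * S1 / C" using C by (simp add: power2_eq_square)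
    finally have "2 * (S1 * S1) \<le> S1 * S1" using C by (simp add: field_simps)
    moreover have "S1 * S1 > 0" using \<open>S1 \<noteq> 0\<close> by (metis not_real_square_gt_zero)
    ultimately show False by simp
  qed
  then have "empirical_inner r w x g h = empirical_inner r w x h h"
    by (simp add: empirical_inner_def S1_def f_eq algebra_simps sum_subtractf)
  then have "quad N (gram (empirical_inner r w x) L) d = empirical_inner r w x g h"
    by (simp add: h_def empirical_inner_lin_comb_self)
  also have "\<dots> = dot N d e"
    by (simp add: h_def empirical_inner_lin_comb_right dot_def e_def)
  finally have "1/2 * dot N d d \<le> dot N d e"
    using gram_close_to_identity(1)[OF close, of d] by simp
  then have "(1/2 * dot N d d)\<^sup>2 \<le> (dot N d e)\<^sup>2"
    using dot_self_nonneg by (intro power_mono) auto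
  also have "\<dots> \<le> dot N d d * dot N e e" by (rule dot_Cauchy_Schwarz)
  finally have *: "dot N d d * dot N d d \<le> dot N d d * (4 * dot N e e)"
    by (simp add: power2_eq_square)
  have "dot N d d \<le> 4 * dot N e e"
  proof (cases "dot N d d = 0")
    case True
    then show ?thesis using dot_self_nonneg[of N e] by simp
  next
    case False
    then have "dot N d d > 0" using dot_self_nonneg[of N d] by simp
    then show ?thesis using * by simp
  qed
  then show ?thesis by (simp add: d_def e_def g_def dot_def power2_eq_square)
qed

lemma square_integrable_diff:
  assumes "square_integrable \<mu> f" "square_integrable \<mu> g"
  shows "square_integrable \<mu> (\<lambda>x. f x - g x)"
proof -
  have [measurable]: "f \<in> borel_measurable \<mu>" "g \<in> borel_measurable \<mu>"
    using assms by (simp_all add: square_integrable_def)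
  have "integrable \<mu> (\<lambda>x. (f x)\<^sup>2 + (g x)\<^sup>2 - 2 * (f x * g x))"
    using assms integrable_product[OF assms] by (auto simp: square_integrable_def)
  then show ?thesis by (simp add: square_integrable_def power2_diff mult.assoc)
qed

lemma l2_norm_square: "(l2_norm \<mu> f)\<^sup>2 = (\<integral>x. (f x)\<^sup>2 \<partial>\<mu>)"
  by (simp add: l2_norm_def)

context
  fixes u :: "'a \<Rightarrow> real"
  assumes u: "square_integrable \<mu> u"
begin

definition projection_coeffs :: "nat \<Rightarrow> real" where
  "projection_coeffs j = (\<integral>x. u x * L j x \<partial>\<mu>)"

definition residual :: "'a \<Rightarrow> real" where
  "residual x = u x - lin_comb (n q) L projection_coeffs x"

lemma square_integrable_residual: "square_integrable \<mu> residual"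
  unfolding residual_def[abs_def] by (intro square_integrable_diff u square_integrable_lin_comb)

lemma residual_orthogonal:
  assumes j: "j \<in> {1..n q}"
  shows "(\<integral>x. residual x * L j x \<partial>\<mu>) = 0"
proof -
  have L: "square_integrable \<mu> (L j)" using j square_integrable_L by simp
  have "(\<integral>x. residual x * L j x \<partial>\<mu>)
      = (\<integral>x. u x * L j x - L j x * lin_comb (n q) L projection_coeffs x \<partial>\<mu>)"
    by (simp add: residual_def algebra_simps)
  also have "\<dots> = 0"
    using integrable_product[OF u L] integrable_product[OF L square_integrable_lin_comb]
      integral_L_times_lin_comb[OF j]
    by (simp add: projection_coeffs_def)
  finally show ?thesis .
qed

lemma l2_error_Pythagoras:
  "(l2_norm \<mu> (\<lambda>x. u x - lin_comb (n q) L c x))\<^sup>2 = (l2_norm \<mu> residual)\<^sup>2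
     + dot (n q) (\<lambda>j. c j - projection_coeffs j) (\<lambda>j. c j - projection_coeffs j)"
proof -
  define d where "d = (\<lambda>j. c j - projection_coeffs j)"
  let ?h = "lin_comb (n q) L d"
  note r = square_integrable_residual and h = square_integrable_lin_comb[of "n q" d]
  have error: "u x - lin_comb (n q) L c x = residual x - ?h x" for x
    by (simp add: residual_def d_def lin_comb_diff)
  have "(residual x - ?h x)\<^sup>2 = (residual x)\<^sup>2 - 2 * (residual x * ?h x) + ?h x * ?h x" for x
    by (simp add: power2_eq_square algebra_simps)
  then have "(l2_norm \<mu> (\<lambda>x. u x - lin_comb (n q) L c x))\<^sup>2
      = (\<integral>x. (residual x)\<^sup>2 - 2 * (residual x * ?h x) + ?h x * ?h x \<partial>\<mu>)"
    by (simp only: l2_norm_square error)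
  also have "\<dots> = (\<integral>x. (residual x)\<^sup>2 \<partial>\<mu>) - 2 * (\<integral>x. residual x * ?h x \<partial>\<mu>) + (\<integral>x. ?h x * ?h x \<partial>\<mu>)"
    using r integrable_product[OF r h] integrable_product[OF h h]
    by (simp add: square_integrable_def)
  also have "(\<integral>x. residual x * ?h x \<partial>\<mu>) = 0"
    using residual_orthogonal by (simp add: integral_times_lin_comb[OF r])
  also have "(\<integral>x. ?h x * ?h x \<partial>\<mu>) = dot (n q) d d"
  proof -
    have "(\<integral>x. ?h x * L j x \<partial>\<mu>) = d j" if "j \<in> {1..n q}" for j
      using integral_L_times_lin_comb[OF that, of d] by (simp add: mult.commute)
    then show ?thesis by (simp add: integral_times_lin_comb[OF h] dot_def)
  qed
  finally show ?thesis by (simp add: l2_norm_square d_def)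
qed

lemma best_error_eq: "best_error \<mu> (lin_span (n q) L) u = l2_norm \<mu> residual"
  unfolding best_error_def
proof (rule cInf_eq_minimum)
  show "l2_norm \<mu> residual \<in> (\<lambda>v. l2_norm \<mu> (\<lambda>x. u x - v x)) ` lin_span (n q) L"
    by (auto simp: lin_span_eq_range residual_def[abs_def])
next
  fix y assume "y \<in> (\<lambda>v. l2_norm \<mu> (\<lambda>x. u x - v x)) ` lin_span (n q) L"
  then obtain c where y: "y = l2_norm \<mu> (\<lambda>x. u x - lin_comb (n q) L c x)" by (auto simp: lin_span_eq_range)
  have "(l2_norm \<mu> residual)\<^sup>2 \<le> y\<^sup>2"
    unfolding y l2_error_Pythagoras using dot_self_nonneg by simp
  then show "l2_norm \<mu> residual \<le> y"
    by (rule power2_le_imp_le) (simp add: y l2_norm_def)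
qed

text \<open>The residual is orthogonal to the \<open>L\<^sub>j\<close>, so each empirical product is a centred mean of independent
  terms, with variance \<open>1/m\<close> times that of one term. Summed over \<open>j\<close>, one factor of the squared
  weight combines with \<open>k\<close> into at most \<open>3 n\<close>, and the other turns the sampling measure back into \<open>\<mu>\<close>.\<close>

lemma expected_empirical_residual:
  assumes z: "z \<in> space (offline q)" and acc: "accurate q z"
  shows "(\<integral>\<^sup>+x. ennreal (\<Sum>j=1..n q. (empirical_inner m (weight q z) x residual (L j))\<^sup>2) \<partial>(\<Pi>\<^sub>M i\<in>{1..m}. \<sigma> q z))
    \<le> ennreal (3 * real (n q) / real m * (l2_norm \<mu> residual)\<^sup>2)"
proof -
  have q: "q \<in> {1..q}" using q_pos by simp
  note \<sigma> = sigma_prob_space[OF order_refl z] space_sigma[OF order_refl z]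
  interpret \<sigma>: prob_space "\<sigma> q z" by (rule \<sigma>)
  let ?N = "n q" and ?P = "\<Pi>\<^sub>M i\<in>{1..m}. \<sigma> q z"
  define w where "w = weight q z"
  define Y where "Y = (\<lambda>j x. w x * (residual x * L j x))"
  \<comment> \<open>The cut-off restricts to the set where the sampling density is positive.\<close>
  define h where "h = (\<lambda>x. if sum_squares ?N L x = 0 then 0 else (residual x)\<^sup>2)"
  have w [measurable]: "w \<in> borel_measurable \<mu>"
    using borel_measurable_weight[OF q z acc] by (simp add: w_def)
  have r [measurable]: "residual \<in> borel_measurable \<mu>" and r2: "integrable \<mu> (\<lambda>x. (residual x)\<^sup>2)"
    using square_integrable_residual by (simp_all add: square_integrable_def)
  have [measurable]: "sum_squares ?N L \<in> borel_measurable \<mu>"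
    using integrable_sum_squares_L by (rule borel_measurable_integrable)
  have [measurable]: "h \<in> borel_measurable \<mu>" unfolding h_def by measurable
  have to_\<sigma>: "f \<in> borel_measurable (\<sigma> q z)" if "f \<in> borel_measurable \<mu>" for f :: "'a \<Rightarrow> real"
    using that by (simp cong: measurable_cong_sets add: \<sigma>(2))
  have wk: "w x * sum_squares ?N L x \<le> 3 * real ?N" and w0: "0 \<le> w x" for x
    using weight_times_sum_squares_le[OF q z acc] level_weight_nonneg by (simp_all add: w_def)
  have Y2: "(\<Sum>j=1..?N. (Y j x)\<^sup>2) \<le> 3 * real ?N * (w x * h x)" for x
  proof (cases "sum_squares ?N L x = 0")
    case True
    then show ?thesis by (simp add: Y_def h_def sum_squares_eq_0)
  next
    case False
    have "(\<Sum>j=1..?N. (Y j x)\<^sup>2) = (w x * sum_squares ?N L x) * (w x * (residual x)\<^sup>2)"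
      by (simp add: Y_def sum_squares_def sum_distrib_left sum_distrib_right power2_eq_square mult_ac)
    also have "\<dots> \<le> 3 * real ?N * (w x * (residual x)\<^sup>2)"
      using wk w0 by (intro mult_right_mono) auto
    finally show ?thesis using False by (simp add: h_def)
  qed
  have h_int: "integrable \<mu> h"
    by (rule Bochner_Integration.integrable_bound[OF r2]) (auto simp: h_def)
  have wh: "integrable (\<sigma> q z) (\<lambda>x. w x * h x)" "(\<integral>x. w x * h x \<partial>\<sigma> q z) = (\<integral>x. h x \<partial>\<mu>)"
    unfolding w_def using h_int
    by (subst integrable_weight_sigma[OF q z acc] integral_weight_sigma[OF q z acc]; simp add: h_def)+
  have Y_meas: "Y j \<in> borel_measurable (\<sigma> q z)" if "j \<in> {1..?N}" for j
  proof -
    note [measurable] = L_measurable'[OF that]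
    show ?thesis unfolding Y_def by (intro to_\<sigma>) measurable
  qed
  have Yj2: "integrable (\<sigma> q z) (\<lambda>x. (Y j x)\<^sup>2)" if j: "j \<in> {1..?N}" for j
  proof (rule Bochner_Integration.integrable_bound)
    show "integrable (\<sigma> q z) (\<lambda>x. 3 * real ?N * (w x * h x))" using wh by simp
    have "(Y j x)\<^sup>2 \<le> 3 * real ?N * (w x * h x)" for x
      using member_le_sum[OF j, of "\<lambda>j. (Y j x)\<^sup>2"] Y2[of x] by (auto intro: order_trans)
    then show "AE x in \<sigma> q z. norm ((Y j x)\<^sup>2) \<le> norm (3 * real ?N * (w x * h x))"
      by (auto intro!: AE_I2 order_trans[OF _ abs_ge_self])
  qed (use Y_meas[OF j] in measurable)
  have Y0: "(\<integral>x. Y j x \<partial>\<sigma> q z) = 0" if j: "j \<in> {1..?N}" for j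
  proof -
    note [measurable] = L_measurable'[OF j]
    have "(\<integral>x. Y j x \<partial>\<sigma> q z) = (\<integral>x. residual x * L j x \<partial>\<mu>)"
      unfolding Y_def w_def
      by (rule integral_weight_sigma[OF q z acc]) (use j in \<open>auto simp: sum_squares_eq_0\<close>)
    then show ?thesis using residual_orthogonal[OF j] by simp
  qed
  have emp: "(empirical_inner m (weight q z) x residual (L j))\<^sup>2 = (1 / real m)\<^sup>2 * (\<Sum>i=1..m. Y j (x i))\<^sup>2" for x j
    by (simp add: empirical_inner_def Y_def w_def power_mult_distrib power_divide mult.assoc)
  have "(\<integral>\<^sup>+x. ennreal (\<Sum>j=1..?N. (empirical_inner m (weight q z) x residual (L j))\<^sup>2) \<partial>?P)
      = (\<integral>\<^sup>+x. (\<Sum>j=1..?N. ennreal ((1 / real m)\<^sup>2) * ennreal ((\<Sum>i=1..m. Y j (x i))\<^sup>2)) \<partial>?P)"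
    unfolding emp by (intro nn_integral_cong) (subst sum_ennreal[symmetric], auto simp: ennreal_mult')
  also have "\<dots> = (\<Sum>j=1..?N. \<integral>\<^sup>+x. ennreal ((1 / real m)\<^sup>2) * ennreal ((\<Sum>i=1..m. Y j (x i))\<^sup>2) \<partial>?P)"
  proof (rule nn_integral_sum)
    fix j assume "j \<in> {1..?N}"
    note [measurable] = Y_meas[OF this]
    show "(\<lambda>x. ennreal ((1 / real m)\<^sup>2) * ennreal ((\<Sum>i=1..m. Y j (x i))\<^sup>2)) \<in> borel_measurable ?P"
      by measurable
  qed
  also have "\<dots> = (\<Sum>j=1..?N. ennreal ((1 / real m)\<^sup>2) * ennreal (real m * (\<integral>x. (Y j x)\<^sup>2 \<partial>\<sigma> q z)))"
  proof (intro sum.cong refl)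
    fix j assume j: "j \<in> {1..?N}"
    note [measurable] = Y_meas[OF j]
    have "(\<integral>\<^sup>+x. ennreal ((1 / real m)\<^sup>2) * ennreal ((\<Sum>i=1..m. Y j (x i))\<^sup>2) \<partial>?P)
        = ennreal ((1 / real m)\<^sup>2) * (\<integral>\<^sup>+x. ennreal ((\<Sum>i=1..m. Y j (x i))\<^sup>2) \<partial>?P)"
      by (intro nn_integral_cmult) measurable
    then show "(\<integral>\<^sup>+x. ennreal ((1 / real m)\<^sup>2) * ennreal ((\<Sum>i=1..m. Y j (x i))\<^sup>2) \<partial>?P)
        = ennreal ((1 / real m)\<^sup>2) * ennreal (real m * (\<integral>x. (Y j x)\<^sup>2 \<partial>\<sigma> q z))"
      by (simp only: \<sigma>.nn_integral_square_iid_sum[OF Y_meas[OF j] Yj2[OF j] Y0[OF j]])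
  qed
  also have "\<dots> = (\<Sum>j=1..?N. ennreal (1 / real m * (\<integral>x. (Y j x)\<^sup>2 \<partial>\<sigma> q z)))"
    by (intro sum.cong refl) (simp add: ennreal_mult'[symmetric] power2_eq_square)
  also have "\<dots> = ennreal (1 / real m * (\<integral>x. (\<Sum>j=1..?N. (Y j x)\<^sup>2) \<partial>\<sigma> q z))"
    using Yj2 by (simp add: Bochner_Integration.integral_sum sum_distrib_left sum_divide_distrib)
  also have "\<dots> \<le> ennreal (1 / real m * (3 * real ?N * (\<integral>x. (residual x)\<^sup>2 \<partial>\<mu>)))"
  proof (intro ennreal_leI mult_left_mono)
    have "(\<integral>x. (\<Sum>j=1..?N. (Y j x)\<^sup>2) \<partial>\<sigma> q z) \<le> (\<integral>x. 3 * real ?N * (w x * h x) \<partial>\<sigma> q z)"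
      using Yj2 wh Y2 by (intro integral_mono Bochner_Integration.integrable_sum) auto
    also have "\<dots> = 3 * real ?N * (\<integral>x. h x \<partial>\<mu>)" using wh by simp
    also have "\<dots> \<le> 3 * real ?N * (\<integral>x. (residual x)\<^sup>2 \<partial>\<mu>)"
      using h_int r2 by (intro mult_left_mono integral_mono) (auto simp: h_def)
    finally show "(\<integral>x. (\<Sum>j=1..?N. (Y j x)\<^sup>2) \<partial>\<sigma> q z) \<le> 3 * real ?N * (\<integral>x. (residual x)\<^sup>2 \<partial>\<mu>)" .
  qed simp
  finally show ?thesis by (simp add: l2_norm_square)
qed

end

end

section \<open>Expected errors\<close>

lemma nn_integral_le_imp_integral_le:
  fixes f :: "'a \<Rightarrow> real"
  assumes f: "f \<in> borel_measurable P" "\<And>x. 0 \<le> f x" and C: "0 \<le> C"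
    and le: "(\<integral>\<^sup>+x. ennreal (f x) \<partial>P) \<le> ennreal C"
  shows "integrable P f" and "(\<integral>x. f x \<partial>P) \<le> C"
proof -
  have "(\<integral>\<^sup>+x. ennreal (f x) \<partial>P) < \<infinity>" using le by (rule order_le_less_trans) simp
  then show int: "integrable P f" using f by (intro integrableI_nonneg) auto
  have "ennreal (\<integral>x. f x \<partial>P) = (\<integral>\<^sup>+x. ennreal (f x) \<partial>P)"
    using int f by (intro nn_integral_eq_integral[symmetric]) auto
  then have "ennreal (\<integral>x. f x \<partial>P) \<le> ennreal C" using le by simp
  then show "(\<integral>x. f x \<partial>P) \<le> C" using C by (simp add: ennreal_le_iff)
qed

lemma abs_diff_truncate_at_le:
  assumes "\<bar>a\<bar> \<le> \<tau>"
  shows "\<bar>a - truncate_at \<tau> b\<bar> \<le> \<bar>a - b\<bar>"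
  using assms by (auto simp: truncate_at_def sgn_if min_def)

lemma abs_truncate_at_le: "0 < \<tau> \<Longrightarrow> \<bar>truncate_at \<tau> b\<bar> \<le> \<tau>"
  by (auto simp: truncate_at_def sgn_if min_def)

context multilevel_sampling
begin

lemma log_factor_pos: "0 < ln (2 * real (n q) / \<epsilon>)"
proof -
  have "1 \<le> real (n q)" using n_pos[OF q_pos] by simp
  then have "1 < 2 * real (n q) / \<epsilon>" using epsilon_pos epsilon_less_1 by (simp add: field_simps)
  then show ?thesis by simp
qed

lemma m_pos: "0 < real m"
  using n_pos[OF q_pos] gamma_const_pos log_factor_pos
  by (intro less_le_trans[OF _ m_bound] mult_pos_pos) auto

lemma eta_le: "12 * real (n q) / real m \<le> 4 / (gamma_const * ln (2 * real (n q) / \<epsilon>))"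
proof -
  define l where "l = gamma_const * ln (2 * real (n q) / \<epsilon>)"
  have l: "0 < l" using gamma_const_pos log_factor_pos by (simp add: l_def)
  have "12 * real (n q) * l \<le> 4 * real m" using m_bound by (simp add: l_def mult_ac)
  then show ?thesis using l m_pos unfolding l_def[symmetric] by (simp add: field_simps)
qed

context
  fixes u :: "'a \<Rightarrow> real" and ut :: "(nat \<Rightarrow> nat \<Rightarrow> 'a) \<times> (nat \<Rightarrow> 'a) \<Rightarrow> 'a \<Rightarrow> real"
  assumes u: "square_integrable \<mu> u"
    and ut: "least_squares_estimator \<mu> L n M B q m u ut"
begin

definition squared_error :: "(nat \<Rightarrow> nat \<Rightarrow> 'a) \<times> (nat \<Rightarrow> 'a) \<Rightarrow> real" where
  "squared_error \<omega> = (l2_norm \<mu> (\<lambda>y. u y - ut \<omega> y))\<^sup>2 * indicator good \<omega>"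

definition truncated_error :: "real \<Rightarrow> (nat \<Rightarrow> nat \<Rightarrow> 'a) \<times> (nat \<Rightarrow> 'a) \<Rightarrow> real" where
  "truncated_error \<tau> \<omega> = (l2_norm \<mu> (\<lambda>y. u y - truncate_at \<tau> (ut \<omega> y)))\<^sup>2"

lemma u_measurable [measurable]: "u \<in> borel_measurable \<mu>"
  using u by (simp add: square_integrable_def)

lemma ut_measurable [measurable]: "(\<lambda>(\<omega>, y). ut \<omega> y) \<in> borel_measurable (joint_space m \<Otimes>\<^sub>M \<mu>)"
  using ut by (simp add: least_squares_estimator_def)

lemma borel_measurable_squared_error: "squared_error \<in> borel_measurable (joint_space m)"
proof -
  have [measurable]: "good \<in> sets (joint_space m)" by (rule sets_good_event[OF q_pos])
  show ?thesis unfolding squared_error_def[abs_def] l2_norm_square by measurable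
qed

lemma borel_measurable_truncated_error: "truncated_error \<tau> \<in> borel_measurable (joint_space m)"
  unfolding truncated_error_def[abs_def] l2_norm_square truncate_at_def by measurable

lemma squared_error_nonneg: "0 \<le> squared_error \<omega>"
  by (simp add: squared_error_def)

lemma ut_in_span: "\<omega> \<in> space (joint_space m) \<Longrightarrow> \<exists>c. ut \<omega> = lin_comb (n q) L c"
  using ut by (cases \<omega>) (auto simp: least_squares_estimator_def lin_span_eq_range)

text \<open>The estimator differs from \<open>u\<close> by the residual of the projection plus an orthogonal element of the
  space, whose coefficients the stability of least squares controls.\<close>

lemma squared_error_le:
  assumes zx: "(z, x) \<in> space (joint_space m)"
  shows "squared_error (z, x) \<le> (l2_norm \<mu> (residual u))\<^sup>2
    + 4 * (\<Sum>j=1..n q. (empirical_inner m (weight q z) x (residual u) (L j))\<^sup>2)"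
proof (cases "(z, x) \<in> good")
  case False
  then show ?thesis by (simp add: squared_error_def sum_nonneg)
next
  case True
  then have acc: "accurate q z" and close:
    "near_identity (n q) (online_gram z x)"
    by (simp_all add: good_iff)
  obtain c where c: "ut (z, x) = lin_comb (n q) L c" using ut_in_span[OF zx] by blast
  have "regular q z" using acc by (simp add: accurate_def)
  then have min: "(\<Sum>i=1..m. weight q z (x i) * \<bar>u (x i) - lin_comb (n q) L c (x i)\<bar>\<^sup>2)
      \<le> (\<Sum>i=1..m. weight q z (x i) * \<bar>u (x i) - v (x i)\<bar>\<^sup>2)" if "v \<in> lin_span (n q) L" for v
    using ut zx that unfolding least_squares_estimator_def c[symmetric] by blast
  have "squared_error (z, x) = (l2_norm \<mu> (\<lambda>y. u y - lin_comb (n q) L c y))\<^sup>2"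
    using True by (simp add: squared_error_def c)
  also have "\<dots> = (l2_norm \<mu> (residual u))\<^sup>2
      + dot (n q) (\<lambda>j. c j - projection_coeffs u j) (\<lambda>j. c j - projection_coeffs u j)"
    by (rule l2_error_Pythagoras[OF u])
  also have "\<dots> \<le> (l2_norm \<mu> (residual u))\<^sup>2
    + 4 * (\<Sum>j=1..n q. (empirical_inner m (weight q z) x (residual u) (L j))\<^sup>2)"
    using least_squares_stability[OF close min, of "projection_coeffs u"]
    by (simp add: residual_def[OF u, abs_def])
  finally show ?thesis .
qed

lemma expected_squared_error_le:
  "(\<integral>\<^sup>+\<omega>. ennreal (squared_error \<omega>) \<partial>law)
     \<le> ennreal ((1 + 12 * real (n q) / real m) * (best_error \<mu> (lin_span (n q) L) u)\<^sup>2)"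
proof -
  let ?Q = "offline_law \<mu> M \<sigma> q"
  define e where "e = (l2_norm \<mu> (residual u))\<^sup>2"
  define C where "C = (1 + 12 * real (n q) / real m) * e"
  have e0: "0 \<le> e" by (simp add: e_def)
  have Q: "prob_space ?Q" "space ?Q = space (offline q)"
    using offline_law_in_prob_algebra[OF order_refl] sets_eq_imp_space_eq[of ?Q] by (auto simp: space_prob_algebra)
  have "(\<integral>\<^sup>+\<omega>. ennreal (squared_error \<omega>) \<partial>law)
      = (\<integral>\<^sup>+z. (\<integral>\<^sup>+x. ennreal (squared_error (z, x)) \<partial>(\<Pi>\<^sub>M i\<in>{1..m}. \<sigma> q z)) \<partial>?Q)"
    using borel_measurable_squared_error by (intro nn_integral_draws_law) measurable
  also have "\<dots> \<le> (\<integral>\<^sup>+z. ennreal C \<partial>?Q)"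
  proof (rule nn_integral_mono)
    fix z assume "z \<in> space ?Q"
    then have z: "z \<in> space (offline q)" using Q by simp
    let ?P = "\<Pi>\<^sub>M i\<in>{1..m}. \<sigma> q z"
    interpret P: prob_space ?P by (intro prob_space_PiM sigma_prob_space order_refl z)
    show "(\<integral>\<^sup>+x. ennreal (squared_error (z, x)) \<partial>?P) \<le> ennreal C"
    proof (cases "accurate q z")
      case False
      then show ?thesis by (simp add: squared_error_def good_iff)
    next
      case True
      define S where "S = (\<lambda>x. \<Sum>j=1..n q. (empirical_inner m (weight q z) x (residual u) (L j))\<^sup>2)"
      have "(\<integral>\<^sup>+x. ennreal (squared_error (z, x)) \<partial>?P) \<le> (\<integral>\<^sup>+x. ennreal e + 4 * ennreal (S x) \<partial>?P)"
      proof (rule nn_integral_mono)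
        fix x assume "x \<in> space ?P"
        then have "(z, x) \<in> space (joint_space m)"
          using z by (simp add: space_PiM_sigma space_pair_measure)
        from squared_error_le[OF this] have "squared_error (z, x) \<le> e + 4 * S x"
          by (simp add: e_def S_def)
        then have "ennreal (squared_error (z, x)) \<le> ennreal (e + 4 * S x)" by (rule ennreal_leI)
        also have "\<dots> = ennreal e + 4 * ennreal (S x)"
          using e0 by (simp add: S_def sum_nonneg ennreal_mult')
        finally show "ennreal (squared_error (z, x)) \<le> ennreal e + 4 * ennreal (S x)" .
      qed
      also have "\<dots> = ennreal e + 4 * (\<integral>\<^sup>+x. ennreal (S x) \<partial>?P)"
      proof -
        have w: "weight q z \<in> borel_measurable \<mu>"
          using borel_measurable_weight[OF _ z True] q_pos by simp
        have r: "residual u \<in> borel_measurable \<mu>"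
          using square_integrable_residual[OF u] by (simp add: square_integrable_def)
        have [measurable_cong]: "sets (\<sigma> q z) = sets \<mu>" by (rule sigma_prob_space[OF order_refl z])
        have "S \<in> borel_measurable ?P"
          unfolding S_def
        proof (intro borel_measurable_sum borel_measurable_power)
          fix j assume "j \<in> {1..n q}"
          note [measurable] = L_measurable'[OF this] w r
          show "(\<lambda>x. empirical_inner m (weight q z) x (residual u) (L j)) \<in> borel_measurable ?P"
            unfolding empirical_inner_def by measurable
        qed
        then show ?thesis
          by (subst nn_integral_add) (auto simp: nn_integral_cmult P.emeasure_space_1)
      qed
      also have "\<dots> \<le> ennreal e + 4 * ennreal (3 * real (n q) / real m * e)"
        using expected_empirical_residual[OF u z True] unfolding S_def e_def
        by (intro add_left_mono mult_left_mono) auto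
      also have "\<dots> = ennreal e + ennreal (4 * (3 * real (n q) / real m * e))"
      proof -
        have "4 * ennreal t = ennreal (4 * t)" for t by (simp add: ennreal_mult')
        then show ?thesis by (simp only:)
      qed
      also have "\<dots> = ennreal C"
        using e0 by (subst ennreal_plus[symmetric]) (auto simp: C_def algebra_simps)
      finally show ?thesis .
    qed
  qed
  also have "\<dots> = ennreal C" using prob_space.emeasure_space_1[OF Q(1)] by simp
  finally show ?thesis by (simp add: C_def e_def best_error_eq[OF u])
qed

lemma squared_error_bound_nonneg:
  "0 \<le> (1 + 12 * real (n q) / real m) * (best_error \<mu> (lin_span (n q) L) u)\<^sup>2"
  by simp

lemma
  shows integrable_squared_error: "integrable law squared_error"
    and integral_squared_error_le: "(\<integral>\<omega>. squared_error \<omega> \<partial>law)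
      \<le> (1 + 12 * real (n q) / real m) * (best_error \<mu> (lin_span (n q) L) u)\<^sup>2"
  by (rule nn_integral_le_imp_integral_le[OF _ squared_error_nonneg squared_error_bound_nonneg
        expected_squared_error_le];
      simp add: borel_measurable_squared_error sets_draws_law cong: measurable_cong_sets)+

text \<open>Truncation at a bound for \<open>u\<close> brings the estimator closer to \<open>u\<close>; on the exceptional event both
  functions are bounded by \<open>\<tau>\<close>.\<close>

lemma truncated_error_le:
  assumes \<tau>: "0 < \<tau>" and u_le: "AE y in \<mu>. \<bar>u y\<bar> \<le> \<tau>" and \<omega>: "\<omega> \<in> space law"
  shows "truncated_error \<tau> \<omega> \<le> squared_error \<omega> + 4 * \<tau>\<^sup>2 * indicator (space law - good) \<omega>"
proof (cases "\<omega> \<in> good")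
  case True
  obtain c where c: "ut \<omega> = lin_comb (n q) L c" using ut_in_span \<omega> unfolding space_law by blast
  have int: "integrable \<mu> (\<lambda>y. (u y - ut \<omega> y)\<^sup>2)"
    using square_integrable_diff[OF u square_integrable_lin_comb] by (simp add: c square_integrable_def)
  have "(\<integral>y. (u y - truncate_at \<tau> (ut \<omega> y))\<^sup>2 \<partial>\<mu>) \<le> (\<integral>y. (u y - ut \<omega> y)\<^sup>2 \<partial>\<mu>)"
  proof (rule integral_mono_AE'[OF int])
    show "AE y in \<mu>. (u y - truncate_at \<tau> (ut \<omega> y))\<^sup>2 \<le> (u y - ut \<omega> y)\<^sup>2"
      using u_le by eventually_elim (use abs_diff_truncate_at_le in \<open>simp add: abs_le_square_iff[symmetric]\<close>)
  qed simp
  then show ?thesis using True by (simp add: truncated_error_def squared_error_def l2_norm_square)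
next
  case False
  have "(\<integral>y. (u y - truncate_at \<tau> (ut \<omega> y))\<^sup>2 \<partial>\<mu>) \<le> (\<integral>y. 4 * \<tau>\<^sup>2 \<partial>\<mu>)"
  proof (rule integral_mono_AE')
    show "AE y in \<mu>. (u y - truncate_at \<tau> (ut \<omega> y))\<^sup>2 \<le> 4 * \<tau>\<^sup>2"
      using u_le
    proof eventually_elim
      case (elim y)
      have "\<bar>u y - truncate_at \<tau> (ut \<omega> y)\<bar> \<le> \<bar>2 * \<tau>\<bar>"
        using elim abs_truncate_at_le[OF \<tau>, of "ut \<omega> y"] \<tau> by linarith
      then have "(u y - truncate_at \<tau> (ut \<omega> y))\<^sup>2 \<le> (2 * \<tau>)\<^sup>2" by (simp only: abs_le_square_iff)
      then show ?case by (simp add: power_mult_distrib)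
    qed
  qed simp_all
  then show ?thesis using False \<omega> by (simp add: truncated_error_def squared_error_def l2_norm_square prob_space)
qed

lemma
  assumes \<tau>: "0 < \<tau>" and u_le: "AE y in \<mu>. \<bar>u y\<bar> \<le> \<tau>"
  shows integrable_truncated_error: "integrable law (truncated_error \<tau>)"
    and integral_truncated_error_le: "(\<integral>\<omega>. truncated_error \<tau> \<omega> \<partial>law)
      \<le> (1 + 12 * real (n q) / real m) * (best_error \<mu> (lin_span (n q) L) u)\<^sup>2 + 8 * \<epsilon> * \<tau>\<^sup>2"
proof -
  interpret law: prob_space law by (rule prob_space_draws_law)
  have X: "space law - good \<in> sets law"
    by (rule sets.compl_sets) (simp add: sets_draws_law sets_good_event[OF q_pos])
  let ?f = "\<lambda>\<omega>. squared_error \<omega> + 4 * \<tau>\<^sup>2 * indicator (space law - good) \<omega>"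
  have f: "integrable law ?f"
    using integrable_squared_error X by (intro Bochner_Integration.integrable_add integrable_mult_right) (auto simp: law.emeasure_eq_measure)
  have meas: "truncated_error \<tau> \<in> borel_measurable law"
    using borel_measurable_truncated_error by (simp add: sets_draws_law cong: measurable_cong_sets)
  have nonneg: "0 \<le> truncated_error \<tau> \<omega>" for \<omega> by (simp add: truncated_error_def)
  show int: "integrable law (truncated_error \<tau>)"
  proof (rule Bochner_Integration.integrable_bound[OF f meas])
    show "AE \<omega> in law. norm (truncated_error \<tau> \<omega>) \<le> norm (?f \<omega>)"
      using truncated_error_le[OF \<tau> u_le] nonneg
      by (auto intro!: AE_I2 order_trans[OF _ abs_ge_self])
  qed
  have "(\<integral>\<omega>. truncated_error \<tau> \<omega> \<partial>law) \<le> (\<integral>\<omega>. ?f \<omega> \<partial>law)"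
    using int f truncated_error_le[OF \<tau> u_le] by (intro integral_mono) auto
  also have "\<dots> = (\<integral>\<omega>. squared_error \<omega> \<partial>law) + 4 * \<tau>\<^sup>2 * measure law (space law - good)"
    using integrable_squared_error X by (simp add: law.emeasure_eq_measure)
  also have "\<dots> \<le> (1 + 12 * real (n q) / real m) * (best_error \<mu> (lin_span (n q) L) u)\<^sup>2 + 4 * \<tau>\<^sup>2 * (2 * \<epsilon>)"
    by (intro add_mono integral_squared_error_le mult_left_mono good_failure_probability) auto
  finally show "(\<integral>\<omega>. truncated_error \<tau> \<omega> \<partial>law)
      \<le> (1 + 12 * real (n q) / real m) * (best_error \<mu> (lin_span (n q) L) u)\<^sup>2 + 8 * \<epsilon> * \<tau>\<^sup>2"
    by (simp add: mult_ac)
qed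

end

end

theorem theorem4p1:
  fixes D :: "(real ^ 'd) set"
    and \<mu> :: "(real ^ 'd) measure"
    and L :: "nat \<Rightarrow> real ^ 'd \<Rightarrow> real"
    and n M :: "nat \<Rightarrow> nat"
    and q m :: nat
    and \<kappa> \<epsilon> :: real
    and eps :: "nat \<Rightarrow> real"
    and B :: "nat \<Rightarrow> (nat \<Rightarrow> nat \<Rightarrow> real ^ 'd) \<Rightarrow> nat \<Rightarrow> real ^ 'd \<Rightarrow> real"
    and \<sigma> :: "nat \<Rightarrow> (nat \<Rightarrow> nat \<Rightarrow> real ^ 'd) \<Rightarrow> (real ^ 'd) measure"
  assumes "prob_space \<mu>" and "space \<mu> = D"
    and "\<forall>j\<ge>1. square_integrable \<mu> (L j)"
    and "\<forall>j\<ge>1. \<forall>k\<ge>1. (\<integral>x. L j x * L k x \<partial>\<mu>) = (if j = k then 1 else 0)"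
    and "1 \<le> n 1" and "mono_on {1..} n"
    and "\<kappa> > 1"
    and "\<forall>x\<in>D. sum_squares (n 1) L x \<le> 3 * \<kappa> * real (n 1)"
    and "\<forall>p\<ge>1. \<forall>x\<in>D. sum_squares (n p) L x \<le> sum_squares (n (p + 1)) L x
           \<and> sum_squares (n (p + 1)) L x \<le> \<kappa> * sum_squares (n p) L x"
    and "q > 1"
    and "\<forall>p\<in>{1..q}. eps p > 0" and "\<epsilon> = (\<Sum>p=1..q. eps p)" and "\<epsilon> < 1"
    and "\<forall>p\<in>{1..q}. real (M p) \<ge> 3 * \<kappa> * gamma_const * real (n p) * ln (2 * real (n p) / eps p)"
    and "real m \<ge> 3 * gamma_const * real (n q) * ln (2 * real (n q) / \<epsilon>)"
    and "multilevel_algorithm \<mu> L n M B q \<sigma>"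
  shows "let P = draws_law \<mu> M \<sigma> q m;
             E = good_event \<mu> L n M B q m;
             V = lin_span (n q) L;
             \<eta> = 12 * real (n q) / real m
         in E \<in> sets P
          \<and> measure P (space P - E) \<le> 2 * \<epsilon>
          \<and> \<eta> \<le> 4 / (gamma_const * ln (2 * real (n q) / \<epsilon>))
          \<and> (\<forall>u ut. square_integrable \<mu> u \<and> least_squares_estimator \<mu> L n M B q m u ut \<longrightarrow>
               (let err = (\<lambda>\<omega>. (l2_norm \<mu> (\<lambda>y. u y - ut \<omega> y))\<^sup>2 * indicator E \<omega>)
                in integrable P err
                 \<and> (\<integral>\<omega>. err \<omega> \<partial>P) \<le> (1 + \<eta>) * (best_error \<mu> V u)\<^sup>2)
             \<and> (\<forall>\<tau>>0. (AE y in \<mu>. \<bar>u y\<bar> \<le> \<tau>) \<longrightarrow>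
                 (let err = (\<lambda>\<omega>. (l2_norm \<mu> (\<lambda>y. u y - truncate_at \<tau> (ut \<omega> y)))\<^sup>2)
                  in integrable P err
                   \<and> (\<integral>\<omega>. err \<omega> \<partial>P) \<le> (1 + \<eta>) * (best_error \<mu> V u)\<^sup>2 + 8 * \<epsilon> * \<tau>\<^sup>2)))"
proof -
  interpret prob_space \<mu> by fact
  have n1: "1 \<le> n p" if "1 \<le> p" for p
    using \<open>1 \<le> n 1\<close> mono_onD[OF \<open>mono_on {1..} n\<close>, of 1 p] that by simp
  interpret multilevel_sampling \<mu> L n M B q \<sigma> \<kappa> \<epsilon> eps m
  proof
    show "multilevel_algorithm \<mu> L n M B q \<sigma>" by fact
    show "n p \<le> n (Suc p)" if "1 \<le> p" for p
      using mono_onD[OF \<open>mono_on {1..} n\<close>, of p "Suc p"] that by simp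
    show "0 < n p" if "1 \<le> p" for p using n1[OF that] by simp
    show "sum_squares (n (Suc p)) L x \<le> \<kappa> * sum_squares (n p) L x" if "1 \<le> p" "x \<in> space \<mu>" for p x
      using assms(9) \<open>space \<mu> = D\<close> that by (simp add: Suc_eq_plus1)
  qed (use assms in \<open>auto simp: identity_matrix_def\<close>)
  show ?thesis
    unfolding Let_def
  proof (intro conjI allI impI; (elim conjE)?)
    show "good_event \<mu> L n M B q m \<in> sets (draws_law \<mu> M \<sigma> q m)"
      using sets_good_event[OF q_pos] by (simp add: sets_draws_law)
    show "measure law (space law - good) \<le> 2 * \<epsilon>" by (rule good_failure_probability)
    show "12 * real (n q) / real m \<le> 4 / (gamma_const * ln (2 * real (n q) / \<epsilon>))" by (rule eta_le)
    fix u ut assume u: "square_integrable \<mu> u" "least_squares_estimator \<mu> L n M B q m u ut"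
    show "integrable law (\<lambda>\<omega>. (l2_norm \<mu> (\<lambda>y. u y - ut \<omega> y))\<^sup>2 * indicator good \<omega>)"
      using integrable_squared_error[OF u] by (simp add: squared_error_def[OF u, abs_def])
    show "(\<integral>\<omega>. (l2_norm \<mu> (\<lambda>y. u y - ut \<omega> y))\<^sup>2 * indicator good \<omega> \<partial>law)
        \<le> (1 + 12 * real (n q) / real m) * (best_error \<mu> (lin_span (n q) L) u)\<^sup>2"
      using integral_squared_error_le[OF u] by (simp add: squared_error_def[OF u, abs_def])
    fix \<tau> :: real assume \<tau>: "0 < \<tau>" "AE y in \<mu>. \<bar>u y\<bar> \<le> \<tau>"
    show "integrable law (\<lambda>\<omega>. (l2_norm \<mu> (\<lambda>y. u y - truncate_at \<tau> (ut \<omega> y)))\<^sup>2)"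
      using integrable_truncated_error[OF u \<tau>] by (simp add: truncated_error_def[OF u, abs_def])
    show "(\<integral>\<omega>. (l2_norm \<mu> (\<lambda>y. u y - truncate_at \<tau> (ut \<omega> y)))\<^sup>2 \<partial>law)
        \<le> (1 + 12 * real (n q) / real m) * (best_error \<mu> (lin_span (n q) L) u)\<^sup>2 + 8 * \<epsilon> * \<tau>\<^sup>2"
      using integral_truncated_error_le[OF u \<tau>] by (simp add: truncated_error_def[OF u, abs_def])
  qed
qed

end
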